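(* Let $R>0$ and let $t<0$ (i.e. the temperature regime $T<T^*$). Then the energy functional $$I(h)=\int_0^R r^2\Big(\frac12 |h'(r)|^2+\frac{3|h(r)|^2}{r^2}+g(h(r))\Big)\,dr$$ admits a unique global minimizer $h$ in the admissible space $W_h$; that is, there exists exactly one $h\in W_h$ such that $I(h)=\min_{W_h} I$.
   Context: Here $t=27a_0(T-T^* )c/b^2$ is the dimensionless (reduced) temperature, where $T$ is the temperature, $T^*$ the spinodal temperature, and $a_0,b,c>0$ are material constants, so $T<T^*$ means $t<0$. The number $h_+$ is $$h_+=\frac{3+\sqrt{9-8t}}{4},$$ and $g:\mathbb{R}\to\mathbb{R}$ is the bulk energy density $$g(h)=\frac{t}{2}h^2-h^3+\frac12 h^4+C(t),$$ where the constant $C(t)$ is chosen so that $\min_{\mathbb{R}} g=0$ (the minimum being attained at $h_+$). The admissible space is $$W_h=\left\lbrace h\in L^2(0,R;dr)\ :\ h'\in L^2(0,R;r^2dr),\ h(R)=h_+\right\rbrace,$$ where $h'$ is the weak derivative of $h$ on $(0,R)$, functions are identified when equal almost everywhere, and $h(R)$ is the value at $R$ of the continuous representative of $h$ on $(0,R]$. *)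

theory Defs
  imports "HOL-Analysis.Analysis"
begin

definition h_plus :: "real \<Rightarrow> real" where
  "h_plus t = (3 + sqrt (9 - 8 * t)) / 4"

definition bulk_poly :: "real \<Rightarrow> real \<Rightarrow> real" where
  "bulk_poly t h = t / 2 * h\<^sup>2 - h ^ 3 + 1 / 2 * h ^ 4"

definition bulk_const :: "real \<Rightarrow> real" where
  "bulk_const t = - (INF h. bulk_poly t h)"

definition bulk :: "real \<Rightarrow> real \<Rightarrow> real" where
  "bulk t h = bulk_poly t h + bulk_const t"

lemma bulk_poly_min:
  assumes "t < 0"
  shows "bulk_poly t (h_plus t) \<le> bulk_poly t h"
proof -
  define a where "a = h_plus t"
  have pos: "9 - 8 * t \<ge> 0" and sq: "sqrt (9 - 8 * t) \<ge> 3"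
    using assms by (auto intro: real_le_rsqrt)
  have s: "sqrt (9 - 8 * t) = 4 * a - 3"
    by (simp add: a_def h_plus_def field_simps)
  have "(4 * a - 3)\<^sup>2 = 9 - 8 * t"
    using real_sqrt_pow2[OF pos] s by simp
  then have t: "t = 3 * a - 2 * a\<^sup>2"
    by (simp add: power2_eq_square algebra_simps)
  have a: "a \<ge> 1"
    using sq s by simp
  have "bulk_poly t h - bulk_poly t a = (h - a)\<^sup>2 * ((h + (a - 1))\<^sup>2 + (a - 1)) / 2"
    unfolding bulk_poly_def t
    by (simp add: field_simps power2_eq_square power3_eq_cube power4_eq_xxxx)
  also have "\<dots> \<ge> 0"
    using a by simp
  finally show ?thesis
    by (simp add: a_def)
qed

lemma bulk_nonneg:
  assumes "t < 0"
  shows "bulk t h \<ge> 0"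
proof -
  have "(INF h. bulk_poly t h) \<le> bulk_poly t h"
    using bulk_poly_min[OF assms] by (intro cINF_lower bdd_belowI2) auto
  then show ?thesis
    by (simp add: bulk_def bulk_const_def)
qed

lemma bulk_h_plus:
  assumes "t < 0"
  shows "bulk t (h_plus t) = 0"
proof -
  have "(INF h. bulk_poly t h) = bulk_poly t (h_plus t)"
    using bulk_poly_min[OF assms] by (intro cInf_eq_minimum) auto
  then show ?thesis
    by (simp add: bulk_def bulk_const_def)
qed

definition test_function :: "real set \<Rightarrow> (real \<Rightarrow> real) \<Rightarrow> bool" where
  "test_function S \<phi> \<longleftrightarrow>
     (\<forall>n x. ((deriv ^^ n) \<phi>) field_differentiable (at x)) \<and>
     compact (closure {x. \<phi> x \<noteq> 0}) \<and> closure {x. \<phi> x \<noteq> 0} \<subseteq> S"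

definition locally_integrable :: "real set \<Rightarrow> (real \<Rightarrow> real) \<Rightarrow> bool" where
  "locally_integrable S f \<longleftrightarrow> (\<forall>K. compact K \<and> K \<subseteq> S \<longrightarrow> set_integrable lebesgue K f)"

definition has_weak_deriv :: "(real \<Rightarrow> real) \<Rightarrow> (real \<Rightarrow> real) \<Rightarrow> real set \<Rightarrow> bool" where
  "has_weak_deriv h v S \<longleftrightarrow>
     locally_integrable S h \<and> locally_integrable S v \<and>
     (\<forall>\<phi>. test_function S \<phi> \<longrightarrow>
        (LINT x:S|lebesgue. h x * deriv \<phi> x) = - (LINT x:S|lebesgue. v x * \<phi> x))"

text \<open>A weak derivative is determined on \<open>S\<close> up to a null set, so the choice is immaterial under
  an integral over \<open>S\<close>.\<close>

definition weak_deriv :: "(real \<Rightarrow> real) \<Rightarrow> real set \<Rightarrow> real \<Rightarrow> real" where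
  "weak_deriv h S = (SOME v. has_weak_deriv h v S)"

definition eq_ae_on :: "real set \<Rightarrow> (real \<Rightarrow> real) \<Rightarrow> (real \<Rightarrow> real) \<Rightarrow> bool" where
  "eq_ae_on S h k \<longleftrightarrow> (AE x in lebesgue_on S. h x = k x)"

text \<open>Elements are representatives: two functions with \<open>eq_ae_on {0<..<R}\<close> stand for the same
  element, and the actual value \<open>h R\<close> of a representative plays no role. The boundary condition
  is imposed on the representative that is continuous on \<open>{0<..R}\<close>.\<close>

definition admissible :: "real \<Rightarrow> real \<Rightarrow> (real \<Rightarrow> real) set" where
  "admissible R t = {h.
     h \<in> borel_measurable (lebesgue_on {0<..<R}) \<and>
     integrable (lebesgue_on {0<..<R}) (\<lambda>r. (h r)\<^sup>2) \<and>
     (\<exists>v. has_weak_deriv h v {0<..<R} \<and>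
          integrable (lebesgue_on {0<..<R}) (\<lambda>r. r\<^sup>2 * (v r)\<^sup>2)) \<and>
     (\<exists>hc. continuous_on {0<..R} hc \<and> eq_ae_on {0<..<R} h hc \<and> hc R = h_plus t)}"

text \<open>For \<open>t < 0\<close> the integrand is nonnegative by \<open>bulk_nonneg\<close>, so \<open>ennreal\<close> truncates nothing
  and no integrability side condition is needed.\<close>

definition energy :: "real \<Rightarrow> real \<Rightarrow> (real \<Rightarrow> real) \<Rightarrow> ennreal" where
  "energy R t h =
     (\<integral>\<^sup>+ r. ennreal (r\<^sup>2 * (1 / 2 * \<bar>weak_deriv h {0<..<R} r\<bar>\<^sup>2 + 3 * \<bar>h r\<bar>\<^sup>2 / r\<^sup>2 + bulk t (h r)))
        \<partial>lebesgue_on {0<..<R})"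

definition global_minimizer :: "real \<Rightarrow> real \<Rightarrow> (real \<Rightarrow> real) \<Rightarrow> bool" where
  "global_minimizer R t h \<longleftrightarrow>
     h \<in> admissible R t \<and> (\<forall>k \<in> admissible R t. energy R t h \<le> energy R t k)"

end

theory Submission
  imports Defs "HOL-Complex_Analysis.Great_Picard"
begin

text \<open>
  The bulk density \<open>g\<close> is not convex, and for large \<open>R\<close> neither is the energy, so neither half of the
  statement is a direct application of convexity. Write the energy as \<open>D + G\<close> with
  \<open>D(h) = \<integral> r\<^sup>2 h'\<^sup>2 / 2 + 3 h\<^sup>2\<close> and \<open>G(h) = \<integral> r\<^sup>2 g(h)\<close>. For \<open>t < 0\<close> the function \<open>g\<close> is strictly
  decreasing on \<open>[0, h\<^sub>+]\<close>, and replacing \<open>h\<close> by \<open>min \<bar>h\<bar> h\<^sub>+\<close> lowers the energy unless it changes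
  nothing. So only functions with values in \<open>[0, h\<^sub>+]\<close> matter.

  \<^emph>\<open>Uniqueness\<close> comes from dilating one minimizer against another. Let \<open>u\<^sub>1, u\<^sub>2\<close> be minimizers with
  values in \<open>[0, h\<^sub>+]\<close>, let \<open>0 < l < 1\<close>, \<open>k(r) = u\<^sub>1(l r)\<close> and \<open>A = {k > u\<^sub>2}\<close>. The competitor
  \<open>max k u\<^sub>2\<close> for \<open>u\<^sub>2\<close> gives \<open>D\<^sub>A(u\<^sub>2) + G\<^sub>A(u\<^sub>2) \<le> D\<^sub>A(k) + G\<^sub>A(k)\<close>. The competitor
  \<open>min u\<^sub>1 (u\<^sub>2(\<cdot>/l))\<close> for \<open>u\<^sub>1\<close> gives, after rescaling,
  \<open>D\<^sub>A(k) + l\<^sup>2 G\<^sub>A(k) \<le> D\<^sub>A(u\<^sub>2) + l\<^sup>2 G\<^sub>A(u\<^sub>2)\<close>, because \<open>D\<close> and \<open>G\<close> scale with different powers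
  of \<open>l\<close>. Adding the two, \<open>D\<close> cancels and \<open>(1 - l\<^sup>2) (G\<^sub>A(u\<^sub>2) - G\<^sub>A(k)) \<le> 0\<close>. As \<open>g\<close> is strictly
  decreasing and \<open>k > u\<^sub>2\<close> on \<open>A\<close>, the set \<open>A\<close> is null, so \<open>u\<^sub>1(l r) \<le> u\<^sub>2(r)\<close>; \<open>l \<rightarrow> 1\<close> gives
  \<open>u\<^sub>1 \<le> u\<^sub>2\<close> and symmetry finishes. This is \<open>minimizers_ordered_after_dilation\<close> and
  \<open>bounded_minimizers_ordered\<close>.

  \<^emph>\<open>Existence\<close> is a direct method in which strong convergence replaces weak compactness. Along a
  minimizing sequence \<open>u\<^sub>n\<close> in \<open>[0, h\<^sub>+]\<close> the functions \<open>r u\<^sub>n(r)\<close> are uniformly Hoelder continuous on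
  \<open>[0, R]\<close>, so by Arzela-Ascoli a subsequence of \<open>u\<^sub>n\<close> converges pointwise
  (\<open>bounded_profiles_compact\<close>), and the terms of the energy without derivative converge. The
  gradient term is a Hilbert norm: the parallelogram identity, applied to averages of two members of
  the sequence (which are again competitors), forces \<open>r u\<^sub>n'\<close> to be Cauchy in \<open>L\<^sup>2\<close>
  (\<open>parallelogram_energy_bound\<close>). For a fast subsequence these derivatives
  converge almost everywhere under an integrable majorant, which identifies the derivative of the
  limit, and Fatou's lemma bounds its energy (\<open>bounded_profile_of_limit\<close>).

  All of this takes place for pairs \<open>(u, w)\<close> with \<open>u(y) - u(x) = \<integral>\<^sub>x\<^sup>y w\<close>. The link to weak derivatives is
  the lemma of du Bois-Reymond (\<open>primitive_on_if_has_weak_deriv\<close>), whose proof tests with explicit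
  smooth plateau functions, and integration by parts (\<open>has_weak_deriv_if_primitive_on\<close>).
\<close>

section \<open>Integral primitives and their calculus\<close>

lemma DERIV_zero_if_quadratic_bound:
  fixes f :: "real \<Rightarrow> real"
  assumes "\<And>x. \<bar>f x - f a\<bar> \<le> C * (x - a)\<^sup>2"
  shows "(f has_real_derivative 0) (at a)"
  unfolding has_field_derivative_iff
proof (rule Lim_null_comparison)
  show "eventually (\<lambda>x. norm ((f x - f a) / (x - a)) \<le> C * \<bar>x - a\<bar>) (at a)"
  proof (rule eventually_at_filter[THEN iffD2], rule always_eventually, intro allI impI)
    fix x assume "x \<noteq> a"
    then have "\<bar>f x - f a\<bar> / \<bar>x - a\<bar> \<le> (C * (x - a)\<^sup>2) / \<bar>x - a\<bar>"
      by (intro divide_right_mono assms) auto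
    also have "\<dots> = C * \<bar>x - a\<bar>"
      using \<open>x \<noteq> a\<close> by (simp add: field_simps power2_eq_square)
    finally show "norm ((f x - f a) / (x - a)) \<le> C * \<bar>x - a\<bar>"
      by simp
  qed
  have "((\<lambda>x. C * \<bar>x - a\<bar>) \<longlongrightarrow> C * \<bar>a - a\<bar>) (at a)"
    by (intro tendsto_intros)
  then show "((\<lambda>x. C * \<bar>x - a\<bar>) \<longlongrightarrow> 0) (at a)" by simp
qed

text \<open>Absolute continuity, with the derivative \<open>w\<close> as an explicit parameter: it is only determined up to
  null sets, and keeping it in the relation avoids choosing representatives. Integrability is
  required on compact subintervals only, since the derivative of an admissible function may fail to be
  integrable near \<open>r = 0\<close>.\<close>

definition primitive_on :: "real set \<Rightarrow> (real \<Rightarrow> real) \<Rightarrow> (real \<Rightarrow> real) \<Rightarrow> bool" where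
  "primitive_on I u w \<longleftrightarrow> (\<forall>x\<in>I. \<forall>y\<in>I. x \<le> y \<longrightarrow>
     w absolutely_integrable_on {x..y} \<and> (w has_integral (u y - u x)) {x..y})"

lemma primitive_onD:
  assumes "primitive_on I u w" "x \<in> I" "y \<in> I" "x \<le> y"
  shows "w absolutely_integrable_on {x..y}" "(w has_integral (u y - u x)) {x..y}"
    "u y - u x = integral {x..y} w" "w integrable_on {x..y}"
  using assms by (auto simp: primitive_on_def has_integral_iff)

lemma primitive_on_continuous_on_Icc:
  assumes "primitive_on I u w" "a \<in> I" "b \<in> I" "is_interval I"
  shows "continuous_on {a..b} u"
proof (cases "a \<le> b")
  case True
  have "continuous_on {a..b} (\<lambda>x. u a + integral {a..x} w)"
    by (intro continuous_intros indefinite_integral_continuous_1 primitive_onD(4)[OF assms(1)] assms True)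
  moreover have "u a + integral {a..x} w = u x" if "x \<in> {a..b}" for x
  proof -
    have "x \<in> I" using that assms by (auto intro: mem_is_interval_1_I)
    then show ?thesis using primitive_onD(3)[OF assms(1), of a x] that assms(2) by auto
  qed
  ultimately show ?thesis by (rule continuous_on_eq)
qed auto

lemma primitive_on_continuous_on:
  assumes "primitive_on I u w" "is_interval I" "open I"
  shows "continuous_on I u"
proof (rule continuous_at_imp_continuous_on, rule ballI)
  fix x assume "x \<in> I"
  then obtain e where e: "e > 0" "cball x e \<subseteq> I"
    using assms(3) open_contains_cball by blast
  have "continuous_on {x-e..x+e} u"
    using e by (intro primitive_on_continuous_on_Icc[OF assms(1) _ _ assms(2)]) (auto simp: subset_eq dist_real_def)
  then have "continuous_on {x-e<..<x+e} u"
    by (rule continuous_on_subset) auto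
  then show "isCont u x"
    using e(1) by (auto simp: continuous_on_eq_continuous_at)
qed

text \<open>A function is a primitive of \<open>f\<close> once this holds up to an error that is small relative to the
  integral of some fixed \<open>g\<close> on all short subintervals: both the defect and the bound are additive in the
  interval, so the local bounds add up (Bolzano's bisection principle). This is the substitute for almost
  everywhere differentiability in the product and chain rules.\<close>

lemma has_integral_by_small_defect:
  fixes U f g :: "real \<Rightarrow> real"
  assumes ab: "a \<le> b" and f: "f integrable_on {a..b}" and g: "g integrable_on {a..b}"
    and small: "\<And>e. e > 0 \<Longrightarrow> \<exists>d>0. \<forall>x y. a \<le> x \<and> x \<le> y \<and> y \<le> b \<and> y - x < d \<longrightarrow>
                  \<bar>U y - U x - integral {x..y} f\<bar> \<le> e * integral {x..y} g"
  shows "(f has_integral (U b - U a)) {a..b}"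
proof -
  have fi: "f integrable_on {x..y}" and gi: "g integrable_on {x..y}" if "a \<le> x" "y \<le> b" for x y
    using f g that by (auto intro: integrable_on_subinterval)
  have le: "\<bar>U b - U a - integral {a..b} f\<bar> \<le> e * integral {a..b} g" if e: "e > 0" for e
  proof -
    obtain d where d: "d > 0" "\<And>x y. a \<le> x \<Longrightarrow> x \<le> y \<Longrightarrow> y \<le> b \<Longrightarrow> y - x < d \<Longrightarrow>
                  \<bar>U y - U x - integral {x..y} f\<bar> \<le> e * integral {x..y} g"
      using small[OF e] by blast
    define D where "D x y \<longleftrightarrow> (a \<le> x \<and> y \<le> b \<longrightarrow>
        \<bar>U y - U x - integral {x..y} f\<bar> \<le> e * integral {x..y} g)" for x y
    have "D a b"
      using ab
    proof (rule Bolzano)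
      fix x y z assume trans: "D x y" "D y z" "x \<le> y" "y \<le> z"
      show "D x z"
        unfolding D_def
      proof
        assume *: "a \<le> x \<and> z \<le> b"
        have "integral {x..z} f = integral {x..y} f + integral {y..z} f"
             "integral {x..z} g = integral {x..y} g + integral {y..z} g"
          using Henstock_Kurzweil_Integration.integral_combine[of x y z, symmetric] trans(3,4) fi[of x z] gi[of x z] *
          by auto
        then show "\<bar>U z - U x - integral {x..z} f\<bar> \<le> e * integral {x..z} g"
          using trans * by (auto simp: algebra_simps D_def)
      qed
    next
      fix x show "\<exists>d>0. \<forall>a b. a \<le> x \<and> x \<le> b \<and> b - a < d \<longrightarrow> D a b"
        using d by (force simp: D_def)
    qed
    then have "\<bar>U b - U a - integral {a..b} f\<bar> \<le> e * integral {a..b} g"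
      by (simp add: D_def)
    then show ?thesis by simp
  qed
  have "((\<lambda>e. e * integral {a..b} g) \<longlongrightarrow> 0 * integral {a..b} g) (at_right 0)"
    by (intro tendsto_intros)
  moreover have "eventually (\<lambda>e::real. \<bar>U b - U a - integral {a..b} f\<bar> \<le> e * integral {a..b} g) (at_right 0)"
    using le by (auto simp: eventually_at_right_less eventually_at_filter)
  ultimately have "\<bar>U b - U a - integral {a..b} f\<bar> \<le> 0"
    using tendsto_lowerbound[of "\<lambda>e. e * integral {a..b} g" 0 "at_right 0" "\<bar>U b - U a - integral {a..b} f\<bar>"] by simp
  then have "integral {a..b} f = U b - U a" by linarith
  then show ?thesis using f by (simp add: has_integral_iff)
qed

lemma absolutely_integrable_continuous_mult:
  fixes f w :: "real \<Rightarrow> real"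
  assumes "continuous_on {a..b} f" "w absolutely_integrable_on {a..b}"
  shows "(\<lambda>x. f x * w x) absolutely_integrable_on {a..b}"
  using assms
  by (intro absolutely_integrable_bounded_measurable_product_real)
     (auto intro!: continuous_imp_measurable_on_sets_lebesgue compact_imp_bounded compact_continuous_image)

text \<open>On a short interval \<open>u\<close> and \<open>f\<close> are almost constant, so replacing \<open>f w + u f'\<close> by
  \<open>f(x) w + u(y) f'\<close>, whose integral is exactly the increment of \<open>u f\<close>, costs a small multiple of
  \<open>\<integral> \<bar>w\<bar> + \<bar>f'\<bar>\<close>.\<close>

lemma primitive_on_mult:
  assumes I: "is_interval I" and u: "primitive_on I u w" and f: "primitive_on I f f'"
  shows "primitive_on I (\<lambda>x. u x * f x) (\<lambda>x. f x * w x + u x * f' x)"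
  unfolding primitive_on_def
proof (intro ballI impI)
  fix a b assume ab: "a \<in> I" "b \<in> I" "a \<le> b"
  note cu = primitive_on_continuous_on_Icc[OF u ab(1,2) I]
  note cf = primitive_on_continuous_on_Icc[OF f ab(1,2) I]
  have sub: "x \<in> I" if "a \<le> x" "x \<le> b" for x
    using that ab I by (auto intro: mem_is_interval_1_I)
  have ai1: "(\<lambda>x. f x * w x) absolutely_integrable_on {a..b}"
    by (intro absolutely_integrable_continuous_mult cf primitive_onD(1)[OF u] ab)
  have ai2: "(\<lambda>x. u x * f' x) absolutely_integrable_on {a..b}"
    by (intro absolutely_integrable_continuous_mult cu primitive_onD(1)[OF f] ab)
  have ai: "(\<lambda>x. f x * w x + u x * f' x) absolutely_integrable_on {a..b}"
    using ai1 ai2 by (rule set_integral_add)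
  let ?g = "\<lambda>x. \<bar>w x\<bar> + \<bar>f' x\<bar>"
  have gi: "?g absolutely_integrable_on {a..b}"
    by (intro set_integral_add(1) absolutely_integrable_norm[unfolded o_def, where 'b=real, simplified] primitive_onD(1)[OF u] primitive_onD(1)[OF f] ab)
  have "((\<lambda>x. f x * w x + u x * f' x) has_integral (u b * f b - u a * f a)) {a..b}"
  proof (rule has_integral_by_small_defect[where g = ?g])
    fix e :: real assume e: "e > 0"
    have "uniformly_continuous_on {a..b} u" "uniformly_continuous_on {a..b} f"
      using cu cf by (auto intro: compact_uniformly_continuous)
    then obtain d1 d2 where d1: "d1 > 0" "\<And>x y. x \<in> {a..b} \<Longrightarrow> y \<in> {a..b} \<Longrightarrow> dist y x < d1 \<Longrightarrow> dist (u y) (u x) < e"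
      and d2: "d2 > 0" "\<And>x y. x \<in> {a..b} \<Longrightarrow> y \<in> {a..b} \<Longrightarrow> dist y x < d2 \<Longrightarrow> dist (f y) (f x) < e"
      using e unfolding uniformly_continuous_on_def by metis
    show "\<exists>d>0. \<forall>x y. a \<le> x \<and> x \<le> y \<and> y \<le> b \<and> y - x < d \<longrightarrow>
           \<bar>u y * f y - u x * f x - integral {x..y} (\<lambda>x. f x * w x + u x * f' x)\<bar>
             \<le> e * integral {x..y} ?g"
    proof (intro exI[of _ "min d1 d2"] conjI allI impI)
      show "min d1 d2 > 0" using d1 d2 by auto
    next
      fix x y assume xy: "a \<le> x \<and> x \<le> y \<and> y \<le> b \<and> y - x < min d1 d2"
      have xyI: "x \<in> I" "y \<in> I" "x \<le> y" using xy sub by auto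
      have 1: "((\<lambda>z. f x * w z + u y * f' z) has_integral (f x * (u y - u x) + u y * (f y - f x))) {x..y}"
        by (intro has_integral_add has_integral_mult_right primitive_onD(2)[OF u] primitive_onD(2)[OF f] xyI)
      have 2: "((\<lambda>x. f x * w x + u x * f' x) has_integral integral {x..y} (\<lambda>x. f x * w x + u x * f' x)) {x..y}"
        using ai xy by (intro integrable_integral integrable_on_subinterval[OF set_lebesgue_integral_eq_integral(1)[OF ai]]) auto
      have 3: "((\<lambda>z. (f x * w z + u y * f' z) - (f z * w z + u z * f' z)) has_integral
          (f x * (u y - u x) + u y * (f y - f x)) - integral {x..y} (\<lambda>x. f x * w x + u x * f' x)) {x..y}"
        by (rule has_integral_diff[OF 1 2])
      have g2: "?g integrable_on {x..y}"
        using gi xy by (intro integrable_on_subinterval[OF set_lebesgue_integral_eq_integral(1)[OF gi]]) auto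
      have "norm (integral {x..y} (\<lambda>z. (f x * w z + u y * f' z) - (f z * w z + u z * f' z)))
            \<le> integral {x..y} (\<lambda>z. e * ?g z)"
      proof (rule integral_norm_bound_integral)
        show "(\<lambda>z. (f x * w z + u y * f' z) - (f z * w z + u z * f' z)) integrable_on {x..y}"
          using 3 by blast
        show "(\<lambda>z. e * ?g z) integrable_on {x..y}"
          using integrable_on_cmult_left[OF g2, of e] by simp
        fix z assume z: "z \<in> {x..y}"
        have A: "\<bar>f x - f z\<bar> \<le> e" "\<bar>u y - u z\<bar> \<le> e"
          using d2(2)[of x z] d1(2)[of y z] z xy by (auto simp: dist_real_def abs_minus_commute intro!: less_imp_le)
        have "(f x * w z + u y * f' z) - (f z * w z + u z * f' z) = (f x - f z) * w z + (u y - u z) * f' z"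
          by (simp add: algebra_simps)
        also have "norm \<dots> \<le> \<bar>f x - f z\<bar> * \<bar>w z\<bar> + \<bar>u y - u z\<bar> * \<bar>f' z\<bar>"
          by (simp add: abs_mult[symmetric])
        also have "\<dots> \<le> e * \<bar>w z\<bar> + e * \<bar>f' z\<bar>"
          using A by (intro add_mono mult_right_mono) auto
        finally show "norm ((f x * w z + u y * f' z) - (f z * w z + u z * f' z)) \<le> e * ?g z"
          by (simp add: algebra_simps)
      qed
      then show "\<bar>u y * f y - u x * f x - integral {x..y} (\<lambda>x. f x * w x + u x * f' x)\<bar>
             \<le> e * integral {x..y} ?g"
        using integral_unique[OF 3] unfolding integral_mult_right by (simp only: real_norm_def) (simp add: algebra_simps)
    qed
  qed (use ab ai gi in \<open>auto intro: set_lebesgue_integral_eq_integral(1)\<close>)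
  with ai show "(\<lambda>x. f x * w x + u x * f' x) absolutely_integrable_on {a..b} \<and>
     ((\<lambda>x. f x * w x + u x * f' x) has_integral u b * f b - u a * f a) {a..b}" by simp
qed

text \<open>By the mean value theorem the increment of \<open>F \<circ> u\<close> is \<open>F'(\<xi>)\<close> times that of \<open>u\<close>, with \<open>\<xi>\<close> between two
  nearby values of \<open>u\<close>; the Lipschitz bound compares \<open>F'(\<xi>)\<close> with \<open>F'(u)\<close>.\<close>

lemma primitive_on_compose:
  assumes I: "is_interval I" and u: "primitive_on I u w"
    and F: "\<And>s. (F has_real_derivative F' s) (at s)"
    and L: "\<And>s t. \<bar>F' s - F' t\<bar> \<le> L * \<bar>s - t\<bar>"
  shows "primitive_on I (\<lambda>x. F (u x)) (\<lambda>x. F' (u x) * w x)"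
  unfolding primitive_on_def
proof (intro ballI impI)
  fix a b assume ab: "a \<in> I" "b \<in> I" "a \<le> b"
  note cu = primitive_on_continuous_on_Icc[OF u ab(1,2) I]
  have Lnn: "L \<ge> 0" using L[of 1 0] by (auto intro: order_trans[OF abs_ge_zero])
  have cF: "continuous_on UNIV F'"
    by (rule lipschitz_on_continuous_on[of L], rule lipschitz_onI) (use L Lnn in \<open>auto simp: dist_real_def\<close>)
  have cFu: "continuous_on {a..b} (\<lambda>x. F' (u x))"
    by (rule continuous_on_compose2[OF cF cu]) auto
  have sub: "x \<in> I" if "a \<le> x" "x \<le> b" for x
    using that ab I by (auto intro: mem_is_interval_1_I)
  have ai: "(\<lambda>x. F' (u x) * w x) absolutely_integrable_on {a..b}"
    by (intro absolutely_integrable_continuous_mult cFu primitive_onD(1)[OF u] ab)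
  let ?g = "\<lambda>x. \<bar>w x\<bar>"
  have gi: "?g absolutely_integrable_on {a..b}"
    by (intro absolutely_integrable_norm[unfolded o_def, where 'b=real, simplified] primitive_onD(1)[OF u] ab)
  have "((\<lambda>x. F' (u x) * w x) has_integral (F (u b) - F (u a))) {a..b}"
  proof (rule has_integral_by_small_defect[where g = ?g])
    fix e :: real assume e: "e > 0"
    have "uniformly_continuous_on {a..b} u"
      using cu by (auto intro: compact_uniformly_continuous)
    moreover have "e / (2 * L + 1) > 0" using e Lnn by auto
    ultimately obtain d1 where d1: "d1 > 0" "\<And>x y. x \<in> {a..b} \<Longrightarrow> y \<in> {a..b} \<Longrightarrow> dist y x < d1 \<Longrightarrow> dist (u y) (u x) < e / (2 * L + 1)"
      unfolding uniformly_continuous_on_def by metis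
    show "\<exists>d>0. \<forall>x y. a \<le> x \<and> x \<le> y \<and> y \<le> b \<and> y - x < d \<longrightarrow>
           \<bar>F (u y) - F (u x) - integral {x..y} (\<lambda>x. F' (u x) * w x)\<bar>
             \<le> e * integral {x..y} ?g"
    proof (intro exI[of _ d1] conjI allI impI)
      show "d1 > 0" by fact
    next
      fix x y assume xy: "a \<le> x \<and> x \<le> y \<and> y \<le> b \<and> y - x < d1"
      have xyI: "x \<in> I" "y \<in> I" "x \<le> y" using xy sub by auto
      obtain \<xi> where xi: "F (u y) - F (u x) = F' \<xi> * (u y - u x)" "\<bar>\<xi> - u x\<bar> \<le> \<bar>u y - u x\<bar>"
      proof (cases "u x" "u y" rule: linorder_cases)
        case less
        from MVT2[OF less, of F F'] F obtain z where "u x < z" "z < u y" "F (u y) - F (u x) = (u y - u x) * F' z"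
          by blast
        then show ?thesis by (intro that[of z]) auto
      next
        case greater
        from MVT2[OF greater, of F F'] F obtain z where "u y < z" "z < u x" "F (u x) - F (u y) = (u x - u y) * F' z"
          by blast
        then show ?thesis by (intro that[of z]) (auto simp: algebra_simps)
      qed (auto intro: that[of "u x"])
      have 1: "((\<lambda>z. F' \<xi> * w z) has_integral (F' \<xi> * (u y - u x))) {x..y}"
        by (intro has_integral_mult_right primitive_onD(2)[OF u] xyI)
      have 2: "((\<lambda>x. F' (u x) * w x) has_integral integral {x..y} (\<lambda>x. F' (u x) * w x)) {x..y}"
        using ai xy by (intro integrable_integral integrable_on_subinterval[OF set_lebesgue_integral_eq_integral(1)[OF ai]]) auto
      note 3 = has_integral_diff[OF 1 2]
      have g2: "?g integrable_on {x..y}"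
        using gi xy by (intro integrable_on_subinterval[OF set_lebesgue_integral_eq_integral(1)[OF gi]]) auto
      have "norm (integral {x..y} (\<lambda>z. F' \<xi> * w z - F' (u z) * w z))
            \<le> integral {x..y} (\<lambda>z. e * ?g z)"
      proof (rule integral_norm_bound_integral)
        show "(\<lambda>z. F' \<xi> * w z - F' (u z) * w z) integrable_on {x..y}"
          using 3 by blast
        show "(\<lambda>z. e * ?g z) integrable_on {x..y}"
          using integrable_on_cmult_left[OF g2, of e] by simp
        fix z assume z: "z \<in> {x..y}"
        have A: "\<bar>u y - u x\<bar> \<le> e / (2 * L + 1)" "\<bar>u x - u z\<bar> \<le> e / (2 * L + 1)"
          using d1(2)[of x z] d1(2)[of y x] z xy by (auto simp: dist_real_def abs_minus_commute intro!: less_imp_le)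
        have "\<bar>F' \<xi> - F' (u z)\<bar> \<le> L * \<bar>\<xi> - u z\<bar>" by (rule L)
        also have "\<dots> \<le> L * (2 * (e / (2 * L + 1)))"
          using A xi(2) Lnn by (intro mult_left_mono) auto
        also have "\<dots> \<le> e" using Lnn e by (auto simp: field_simps)
        finally have B: "\<bar>F' \<xi> - F' (u z)\<bar> \<le> e" .
        have "norm (F' \<xi> * w z - F' (u z) * w z) = \<bar>F' \<xi> - F' (u z)\<bar> * \<bar>w z\<bar>"
          by (simp add: abs_mult[symmetric] algebra_simps)
        also have "\<dots> \<le> e * \<bar>w z\<bar>" using B by (intro mult_right_mono) auto
        finally show "norm (F' \<xi> * w z - F' (u z) * w z) \<le> e * ?g z" .
      qed
      then show "\<bar>F (u y) - F (u x) - integral {x..y} (\<lambda>x. F' (u x) * w x)\<bar>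
             \<le> e * integral {x..y} ?g"
        using integral_unique[OF 3] xi(1) unfolding integral_mult_right by (simp only: real_norm_def)
    qed
  qed (use ab ai gi in \<open>auto intro: set_lebesgue_integral_eq_integral(1)\<close>)
  with ai show "(\<lambda>x. F' (u x) * w x) absolutely_integrable_on {a..b} \<and>
     ((\<lambda>x. F' (u x) * w x) has_integral F (u b) - F (u a)) {a..b}" by simp
qed

lemma primitive_on_add:
  assumes "primitive_on I u w" "primitive_on I u' w'"
  shows "primitive_on I (\<lambda>x. u x + u' x) (\<lambda>x. w x + w' x)"
  unfolding primitive_on_def
proof (intro ballI impI conjI)
  fix x y assume xy: "x \<in> I" "y \<in> I" "x \<le> y"
  show "(\<lambda>x. w x + w' x) absolutely_integrable_on {x..y}"
    by (intro set_integral_add(1) primitive_onD(1)[OF assms(1)] primitive_onD(1)[OF assms(2)] xy)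
  show "((\<lambda>x. w x + w' x) has_integral (u y + u' y - (u x + u' x))) {x..y}"
    using has_integral_add[OF primitive_onD(2)[OF assms(1) xy] primitive_onD(2)[OF assms(2) xy]]
    by (simp add: algebra_simps)
qed

lemma primitive_on_cmult:
  assumes "primitive_on I u w"
  shows "primitive_on I (\<lambda>x. c * u x) (\<lambda>x. c * w x)"
  unfolding primitive_on_def
proof (intro ballI impI conjI)
  fix x y assume xy: "x \<in> I" "y \<in> I" "x \<le> y"
  show "(\<lambda>x. c * w x) absolutely_integrable_on {x..y}"
    using primitive_onD(1)[OF assms(1) xy] by simp
  show "((\<lambda>x. c * w x) has_integral (c * u y - c * u x)) {x..y}"
    using has_integral_mult_right[OF primitive_onD(2)[OF assms(1) xy], of c]
    by (simp add: algebra_simps)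
qed

lemma primitive_on_const: "primitive_on I (\<lambda>x. c) (\<lambda>x. 0)"
  by (auto simp: primitive_on_def)

lemma primitive_on_minus:
  "primitive_on I u w \<Longrightarrow> primitive_on I (\<lambda>x. - u x) (\<lambda>x. - w x)"
  using primitive_on_cmult[of I u w "-1"] by simp

lemma primitive_on_diff:
  assumes "primitive_on I u w" "primitive_on I u' w'"
  shows "primitive_on I (\<lambda>x. u x - u' x) (\<lambda>x. w x - w' x)"
  using primitive_on_add[OF assms(1) primitive_on_minus[OF assms(2)]] by simp

text \<open>Dominated convergence on each compact subinterval.\<close>

lemma primitive_on_limit:
  assumes prim: "\<And>n. primitive_on I (U n) (W n)"
    and U: "\<And>x. x \<in> I \<Longrightarrow> (\<lambda>n. U n x) \<longlonglongrightarrow> u x"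
    and W: "\<And>x y z. x \<in> I \<Longrightarrow> y \<in> I \<Longrightarrow> x \<le> z \<Longrightarrow> z \<le> y \<Longrightarrow> (\<lambda>n. W n z) \<longlonglongrightarrow> w z"
    and dom: "\<And>x y. x \<in> I \<Longrightarrow> y \<in> I \<Longrightarrow> x \<le> y \<Longrightarrow>
       \<exists>h. h integrable_on {x..y} \<and> (\<forall>n. \<forall>z\<in>{x..y}. \<bar>W n z\<bar> \<le> h z)"
  shows "primitive_on I u w"
  unfolding primitive_on_def
proof (intro ballI impI conjI)
  fix x y assume xy: "x \<in> I" "y \<in> I" "x \<le> y"
  obtain h where h: "h integrable_on {x..y}" "\<And>n z. z \<in> {x..y} \<Longrightarrow> \<bar>W n z\<bar> \<le> h z"
    using dom[OF xy] by blast
  have lim: "(\<lambda>n. W n z) \<longlonglongrightarrow> w z" if "z \<in> {x..y}" for z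
    using W[OF xy(1,2)] that by auto
  have wi: "w integrable_on {x..y}" and "(\<lambda>n. integral {x..y} (W n)) \<longlonglongrightarrow> integral {x..y} w"
    using dominated_convergence[of W "{x..y}" h w] primitive_onD(4)[OF prim xy] h lim by auto
  moreover have "integral {x..y} (W n) = U n y - U n x" for n
    using primitive_onD(3)[OF prim xy] by simp
  ultimately have "(\<lambda>n. U n y - U n x) \<longlonglongrightarrow> integral {x..y} w" by simp
  moreover have "(\<lambda>n. U n y - U n x) \<longlonglongrightarrow> u y - u x"
    by (intro tendsto_diff U xy)
  ultimately have "u y - u x = integral {x..y} w" using LIMSEQ_unique by blast
  with wi show "(w has_integral (u y - u x)) {x..y}" by (simp add: has_integral_iff)
  have "norm (w z) \<le> h z" if "z \<in> {x..y}" for z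
    using tendsto_upperbound[OF tendsto_norm[OF lim[OF that]]] h(2)[OF that] by auto
  then show "w absolutely_integrable_on {x..y}"
    by (intro absolutely_integrable_integrable_bound[OF _ wi h(1)]) auto
qed

text \<open>The positive part is the limit of functions that are quadratic on a short interval
  to the right of \<open>0\<close>, have Lipschitz derivatives, and
  whose derivatives lie in \<open>[0, 1]\<close> and tend to the indicator of \<open>{0<..}\<close>.\<close>

lemma primitive_on_positive_part:
  assumes I: "is_interval I" and u: "primitive_on I u w"
  shows "primitive_on I (\<lambda>x. max 0 (u x)) (\<lambda>x. if u x > 0 then w x else 0)"
proof -
  define P :: "real \<Rightarrow> real" where "P s = (if s \<le> 0 then 0 else s\<^sup>2 / 2)" for s
  have P: "(P has_real_derivative max 0 s) (at s)" for s
  proof -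
    consider "s < 0" | "s = 0" | "s > 0" by linarith
    then show ?thesis
    proof cases
      case 1
      have "(P has_real_derivative 0) (at s)"
        by (rule has_field_derivative_transform_within_open[OF DERIV_const, where S = "{..<0}"])
           (use 1 in \<open>auto simp: P_def\<close>)
      then show ?thesis using 1 by simp
    next
      case 2
      have "(P has_real_derivative 0) (at 0)"
        by (rule DERIV_zero_if_quadratic_bound[where C = 1]) (auto simp: P_def)
      then show ?thesis using 2 by simp
    next
      case 3
      have "((\<lambda>s. s\<^sup>2 / 2) has_real_derivative s) (at s)"
        by (auto intro!: derivative_eq_intros)
      then have "(P has_real_derivative s) (at s)"
        by (rule has_field_derivative_transform_within_open[where S = "{0<..}"])
           (use 3 in \<open>auto simp: P_def\<close>)
      then show ?thesis using 3 by simp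
    qed
  qed
  define c where "c n = real (Suc n)" for n
  have c: "c n > 0" for n by (auto simp: c_def)
  \<comment> \<open>\<open>P\<close> is half the squared positive part, so \<open>F' n\<close> is the ramp from \<open>0\<close> to \<open>1\<close> on \<open>[0, 1 / c n]\<close>.\<close>
  define F where "F n s = c n * (P s - P (s - 1 / c n))" for n s
  define F' where "F' n s = c n * (max 0 s - max 0 (s - 1 / c n))" for n s
  have cr: "c n * (1 / c n) = 1" for n using c[of n] by simp
  have F'b: "0 \<le> F' n s" "F' n s \<le> 1" for n s
  proof -
    have "0 \<le> max 0 s - max 0 (s - q) \<and> max 0 s - max 0 (s - q) \<le> q" if "q > 0" for q
      using that by (auto simp: max_def)
    from this[of "1 / c n"] have "0 \<le> max 0 s - max 0 (s - 1 / c n)" "max 0 s - max 0 (s - 1 / c n) \<le> 1 / c n"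
      using c[of n] by auto
    then show "0 \<le> F' n s" "F' n s \<le> 1"
      unfolding F'_def using c[of n] mult_left_mono[of _ "1 / c n" "c n"] cr[of n]
      by (auto intro!: mult_nonneg_nonneg simp del: max_less_iff_conj)
  qed
    have ev: "eventually (\<lambda>n. F n s = s - 1 / (2 * c n) \<and> F' n s = 1) sequentially" if s: "s > 0" for s
    proof -
      obtain N where N: "1 / s < real N" using reals_Archimedean2 by blast
      show ?thesis
      proof (rule eventually_sequentiallyI[of N])
        fix n assume "n \<ge> N"
        then have "1 / s < c n" using N by (auto simp: c_def)
        then have "s - 1 / c n > 0" using s c[of n] by (auto simp: field_simps)
        then show "F n s = s - 1 / (2 * c n) \<and> F' n s = 1"
          using s c[of n] unfolding F_def F'_def P_def
          by (auto simp: field_simps power2_eq_square)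
      qed
    qed
    have c0: "(\<lambda>n. 1 / (2 * c n)) \<longlonglongrightarrow> 0"
      unfolding c_def using tendsto_mult_right_zero[OF LIMSEQ_inverse_real_of_nat, of "1/2"] by (simp add: field_simps)
  show ?thesis
  proof (rule primitive_on_limit)
    fix n
    show "primitive_on I (\<lambda>x. F n (u x)) (\<lambda>x. F' n (u x) * w x)"
    proof (rule primitive_on_compose[OF I u])
      show "(F n has_real_derivative F' n s) (at s)" for s
        unfolding F_def[abs_def] F'_def
        by (auto intro!: derivative_eq_intros DERIV_chain2[OF P] P)
      show "\<bar>F' n s - F' n t\<bar> \<le> (2 * c n) * \<bar>s - t\<bar>" for s t
      proof -
        have "\<bar>(max 0 s - max 0 (s - q)) - (max 0 t - max 0 (t - q))\<bar> \<le> 2 * \<bar>s - t\<bar>" if "q > 0" for q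
          using that by (auto simp: max_def)
        from this[of "1 / c n"]
        have "\<bar>(max 0 s - max 0 (s - 1 / c n)) - (max 0 t - max 0 (t - 1 / c n))\<bar> \<le> 2 * \<bar>s - t\<bar>"
          using c[of n] by simp
        then have "c n * \<bar>(max 0 s - max 0 (s - 1 / c n)) - (max 0 t - max 0 (t - 1 / c n))\<bar> \<le> c n * (2 * \<bar>s - t\<bar>)"
          using c[of n] by (intro mult_left_mono) auto
        moreover have "\<bar>F' n s - F' n t\<bar> = c n * \<bar>(max 0 s - max 0 (s - 1 / c n)) - (max 0 t - max 0 (t - 1 / c n))\<bar>"
          unfolding F'_def right_diff_distrib[symmetric] using c[of n] by (simp add: abs_mult)
        ultimately show ?thesis by (simp add: algebra_simps)
      qed
    qed
  next
    fix x assume "x \<in> I"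
    show "(\<lambda>n. F n (u x)) \<longlonglongrightarrow> max 0 (u x)"
    proof (cases "u x > 0")
      case True
      have "(\<lambda>n. u x - 1 / (2 * c n)) \<longlonglongrightarrow> u x - 0" by (intro tendsto_intros c0)
      then have "(\<lambda>n. F n (u x)) \<longlonglongrightarrow> u x - 0"
        by (rule Lim_transform_eventually) (use ev[OF True] in \<open>eventually_elim, simp\<close>)
      then show ?thesis using True by simp
    next
      case False
      then have "u x \<le> 1 / c n" for n using c[of n] by (meson divide_nonneg_pos leI le_less_trans order.trans zero_le_one less_imp_le)
      then have "F n (u x) = 0" for n using False by (auto simp: F_def P_def)
      then show ?thesis using False by simp
    qed
  next
    fix x y z assume xy: "x \<in> I" "y \<in> I" "x \<le> z" "z \<le> y"
    show "(\<lambda>n. F' n (u z) * w z) \<longlonglongrightarrow> (if 0 < u z then w z else 0)"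
    proof (cases "u z > 0")
      case True
      have "eventually (\<lambda>n. F' n (u z) * w z = w z) sequentially"
        using ev[OF True] by eventually_elim auto
      then show ?thesis using True by (simp add: tendsto_eventually)
    next
      case False
      then have "u z \<le> 1 / c n" for n using c[of n] by (meson divide_nonneg_pos leI le_less_trans order.trans zero_le_one less_imp_le)
      then have "F' n (u z) = 0" for n using False by (auto simp: F'_def)
      then show ?thesis using False by simp
    qed
  next
    fix x y assume xy: "x \<in> I" "y \<in> I" "x \<le> y"
    show "\<exists>h. h integrable_on {x..y} \<and> (\<forall>n. \<forall>z\<in>{x..y}. \<bar>F' n (u z) * w z\<bar> \<le> h z)"
    proof (intro exI[of _ "\<lambda>z. \<bar>w z\<bar>"] conjI allI ballI)
      show "(\<lambda>z. \<bar>w z\<bar>) integrable_on {x..y}"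
        using primitive_onD(1)[OF u xy] by (simp add: absolutely_integrable_on_def)
      show "\<bar>F' n (u z) * w z\<bar> \<le> \<bar>w z\<bar>" for n z
        using mult_right_mono[OF F'b(2)[of n "u z"], of "\<bar>w z\<bar>"] F'b(1)[of n "u z"] by (simp add: abs_mult)
    qed
  qed
qed

lemma primitive_on_max:
  assumes I: "is_interval I" and "primitive_on I u w" "primitive_on I u' w'"
  shows "primitive_on I (\<lambda>x. max (u x) (u' x)) (\<lambda>x. if u x > u' x then w x else w' x)"
proof -
  have "primitive_on I (\<lambda>x. u' x + max 0 (u x - u' x)) (\<lambda>x. w' x + (if u x - u' x > 0 then w x - w' x else 0))"
    by (intro primitive_on_add primitive_on_positive_part primitive_on_diff assms)
  moreover have "u' x + max 0 (u x - u' x) = max (u x) (u' x)" for x by auto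
  moreover have "w' x + (if u x - u' x > 0 then w x - w' x else 0) = (if u x > u' x then w x else w' x)" for x by auto
  ultimately show ?thesis by simp
qed

lemma primitive_on_min:
  assumes I: "is_interval I" and "primitive_on I u w" "primitive_on I u' w'"
  shows "primitive_on I (\<lambda>x. min (u x) (u' x)) (\<lambda>x. if u x > u' x then w' x else w x)"
proof -
  have "primitive_on I (\<lambda>x. u x - max 0 (u x - u' x)) (\<lambda>x. w x - (if u x - u' x > 0 then w x - w' x else 0))"
    by (intro primitive_on_diff primitive_on_positive_part assms)
  moreover have "u x - max 0 (u x - u' x) = min (u x) (u' x)" for x by auto
  moreover have "w x - (if u x - u' x > 0 then w x - w' x else 0) = (if u x > u' x then w' x else w x)" for x by auto
  ultimately show ?thesis by simp
qed

lemma primitive_on_dilate: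
  assumes u: "primitive_on {0<..} u w" and c: "c > 0"
  shows "primitive_on {0<..} (\<lambda>x. u (c * x)) (\<lambda>x. c * w (c * x))"
  unfolding primitive_on_def
proof (intro ballI impI)
  fix x y :: real assume xy: "x \<in> {0<..}" "y \<in> {0<..}" "x \<le> y"
  have cxy: "c * x \<in> {0<..}" "c * y \<in> {0<..}" "c * x \<le> c * y" using xy c by auto
  have im: "(\<lambda>x. x / c) ` {c * x..c * y} = {x..y}"
    using c xy by (simp add: image_divide_atLeastAtMost)
  note h = primitive_onD[OF u cxy]
  have 1: "((\<lambda>z. w (c * z)) has_integral (u (c * y) - u (c * x)) / c) {x..y}"
    using has_integral_stretch_real[OF h(2), of c] c im by simp
  have 2: "(\<lambda>z. \<bar>w (c * z)\<bar>) integrable_on {x..y}"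
    using integrable_stretch_real[of "\<lambda>z. \<bar>w z\<bar>", of "c*x" "c*y" c] h(1) c im
    by (simp add: absolutely_integrable_on_def)
  have "(\<lambda>z. w (c * z)) absolutely_integrable_on {x..y}"
    using 1 2 by (auto simp: absolutely_integrable_on_def)
  moreover have "((\<lambda>z. c * w (c * z)) has_integral (u (c * y) - u (c * x))) {x..y}"
    using has_integral_mult_right[OF 1, of c] c by simp
  ultimately show "(\<lambda>z. c * w (c * z)) absolutely_integrable_on {x..y} \<and>
    ((\<lambda>z. c * w (c * z)) has_integral (u (c * y) - u (c * x))) {x..y}" by simp
qed

section \<open>Profiles and their energy\<close>

definition energy_density :: "(real \<Rightarrow> real) \<Rightarrow> (real \<Rightarrow> real) \<Rightarrow> (real \<Rightarrow> real) \<Rightarrow> real \<Rightarrow> real" where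
  "energy_density g u w r = 1 / 2 * (r\<^sup>2 * (w r)\<^sup>2) + 3 * (u r)\<^sup>2 + r\<^sup>2 * g (u r)"

text \<open>A profile is an admissible function together with a Borel version of its derivative, extended beyond
  \<open>R\<close> by the boundary value \<open>M\<close>. The extension lets a dilated function be compared with the original
  on the whole half-line.\<close>

definition profile :: "real \<Rightarrow> real \<Rightarrow> (real \<Rightarrow> real) \<Rightarrow> (real \<Rightarrow> real) \<Rightarrow> bool" where
  "profile R M u w \<longleftrightarrow>
     u \<in> borel_measurable borel \<and> w \<in> borel_measurable borel \<and>
     primitive_on {0<..} u w \<and> (\<forall>x\<ge>R. u x = M) \<and> (\<forall>x. x \<notin> {0<..<R} \<longrightarrow> w x = 0) \<and>
     integrable lborel (\<lambda>r. r\<^sup>2 * (w r)\<^sup>2)"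

definition bounded_profile :: "real \<Rightarrow> real \<Rightarrow> (real \<Rightarrow> real) \<Rightarrow> (real \<Rightarrow> real) \<Rightarrow> bool" where
  "bounded_profile R M u w \<longleftrightarrow> profile R M u w \<and> (\<forall>r. 0 \<le> u r \<and> u r \<le> M)"

abbreviation on_Ioo :: "real \<Rightarrow> real measure" where
  "on_Ioo R \<equiv> restrict_space lborel {0<..<R}"

definition profile_energy :: "real \<Rightarrow> (real \<Rightarrow> real) \<Rightarrow> (real \<Rightarrow> real) \<Rightarrow> (real \<Rightarrow> real) \<Rightarrow> real" where
  "profile_energy R g u w = (\<integral>r. energy_density g u w r \<partial>on_Ioo R)"

lemma is_interval_positive: "is_interval {0::real<..}"
  by (simp add: is_interval_1)

lemma finite_measure_on_Ioo: "finite_measure (on_Ioo R)"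
  by (intro finite_measureI) (cases "R \<ge> 0", auto simp: emeasure_restrict_space space_restrict_space)

lemma borel_measurable_on_Ioo: "f \<in> borel_measurable borel \<Longrightarrow> f \<in> borel_measurable (on_Ioo R)"
  by (rule measurable_restrict_space1) simp

lemma integrable_on_Ioo_bounded:
  fixes f :: "real \<Rightarrow> real"
  assumes "f \<in> borel_measurable borel" "\<And>r. 0 < r \<Longrightarrow> r < R \<Longrightarrow> \<bar>f r\<bar> \<le> B"
  shows "integrable (on_Ioo R) f"
  by (rule finite_measure.integrable_const_bound[OF finite_measure_on_Ioo, where B = B])
     (use assms in \<open>auto intro!: AE_I2 borel_measurable_on_Ioo simp: space_restrict_space\<close>)

lemma integrable_on_IooI: "integrable lborel f \<Longrightarrow> integrable (on_Ioo R) (f :: real \<Rightarrow> real)"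
  using integrable_restrict_space[of "{0<..<R}" lborel f] integrable_mult_indicator[of "{0<..<R}" lborel f]
  by simp

lemma integrable_on_Ioo_iff:
  fixes f :: "real \<Rightarrow> real"
  assumes "\<And>x. x \<notin> {0<..<R} \<Longrightarrow> f x = 0"
  shows "integrable (on_Ioo R) f \<longleftrightarrow> integrable lborel f" "(\<integral>x. f x \<partial>on_Ioo R) = (\<integral>x. f x \<partial>lborel)"
proof -
  have "(\<lambda>x. indicat_real {0<..<R} x *\<^sub>R f x) = f"
    using assms by (auto simp: indicator_def fun_eq_iff)
  then show "integrable (on_Ioo R) f \<longleftrightarrow> integrable lborel f" "(\<integral>x. f x \<partial>on_Ioo R) = (\<integral>x. f x \<partial>lborel)"
    using integrable_restrict_space[of "{0<..<R}" lborel f] integral_restrict_space[of "{0<..<R}" lborel f]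
    by auto
qed

lemma profileD:
  assumes "profile R M u w"
  shows "u \<in> borel_measurable borel" "w \<in> borel_measurable borel" "primitive_on {0<..} u w"
    "\<And>x. R \<le> x \<Longrightarrow> u x = M" "\<And>x. x \<notin> {0<..<R} \<Longrightarrow> w x = 0" "integrable lborel (\<lambda>r. r\<^sup>2 * (w r)\<^sup>2)"
  using assms by (auto simp: profile_def)

lemma bounded_profileD:
  assumes "bounded_profile R M u w"
  shows "profile R M u w" "0 \<le> u r" "u r \<le> M"
  using assms by (auto simp: bounded_profile_def)

lemma potential_bounded:
  assumes "continuous_on UNIV (g :: real \<Rightarrow> real)"
  obtains B where "\<And>a. 0 \<le> a \<Longrightarrow> a \<le> M \<Longrightarrow> \<bar>g a\<bar> \<le> B"
proof -
  have "bounded (g ` {0..M})"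
    by (intro compact_imp_bounded compact_continuous_image) (use assms continuous_on_subset in blast)+
  then show ?thesis using that unfolding bounded_iff by (metis atLeastAtMost_iff image_eqI real_norm_def)
qed

lemma integrable_energy_density:
  assumes g: "continuous_on UNIV g" and p: "bounded_profile R M u w"
  shows "integrable (on_Ioo R) (energy_density g u w)"
proof -
  note u = profileD[OF bounded_profileD(1)[OF p]]
  note b = bounded_profileD(2,3)[OF p]
  obtain B where B: "\<And>a. 0 \<le> a \<Longrightarrow> a \<le> M \<Longrightarrow> \<bar>g a\<bar> \<le> B" using potential_bounded[OF g] by blast
  have gm: "g \<in> borel_measurable borel" using g by (rule borel_measurable_continuous_onI)
  have "integrable (on_Ioo R) (\<lambda>r. r\<^sup>2 * (w r)\<^sup>2)" by (rule integrable_on_IooI[OF u(6)])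
  moreover have "integrable (on_Ioo R) (\<lambda>r. (u r)\<^sup>2)"
  proof (rule integrable_on_Ioo_bounded)
    show "\<bar>(u r)\<^sup>2\<bar> \<le> M\<^sup>2" for r using b[of r] by (auto intro: power_mono)
  qed (use u(1) in measurable)
  moreover have "integrable (on_Ioo R) (\<lambda>r. r\<^sup>2 * g (u r))"
  proof (rule integrable_on_Ioo_bounded)
    show "\<bar>r\<^sup>2 * g (u r)\<bar> \<le> R\<^sup>2 * B" if "0 < r" "r < R" for r
      using B[of "u r"] b[of r] that by (auto simp: abs_mult intro!: mult_mono power_mono)
    show "(\<lambda>r. r\<^sup>2 * g (u r)) \<in> borel_measurable borel"
      using u(1) gm by measurable
  qed
  ultimately show ?thesis
    unfolding energy_density_def by (intro Bochner_Integration.integrable_add integrable_mult_right) auto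
qed

lemma bounded_profile_const:
  assumes "M \<ge> 0"
  shows "bounded_profile R M (\<lambda>_. M) (\<lambda>_. 0)"
  using assms by (auto simp: bounded_profile_def profile_def primitive_on_const)

text \<open>The weight \<open>r\<^sup>2\<close> absorbs the factor that the chain rule produces.\<close>

lemma integrable_dilate:
  assumes "integrable lborel (\<lambda>r. r\<^sup>2 * (w r)\<^sup>2)" "c > (0::real)"
  shows "integrable lborel (\<lambda>r. r\<^sup>2 * (c * w (c * r))\<^sup>2 :: real)"
proof -
  have "integrable lborel (\<lambda>r. (0 + c * r)\<^sup>2 * (w (0 + c * r))\<^sup>2)"
    using lborel_integrable_real_affine[OF assms(1), of c 0] assms(2) by simp
  then show ?thesis by (simp add: power_mult_distrib mult_ac)
qed

lemma square_integrable_if_between: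
  fixes w :: "real \<Rightarrow> real"
  assumes "integrable lborel (\<lambda>r. r\<^sup>2 * (v1 r)\<^sup>2)" "integrable lborel (\<lambda>r. r\<^sup>2 * (v2 r)\<^sup>2)"
    and "w \<in> borel_measurable borel" "\<And>r. w r = v1 r \<or> w r = v2 r"
  shows "integrable lborel (\<lambda>r. r\<^sup>2 * (w r)\<^sup>2)"
proof (rule Bochner_Integration.integrable_bound[OF Bochner_Integration.integrable_add[OF assms(1,2)]])
  show "(\<lambda>r. r\<^sup>2 * (w r)\<^sup>2) \<in> borel_measurable lborel" using assms(3) by measurable
  show "AE r in lborel. norm (r\<^sup>2 * (w r)\<^sup>2) \<le> norm (r\<^sup>2 * (v1 r)\<^sup>2 + r\<^sup>2 * (v2 r)\<^sup>2)"
  proof (rule AE_I2)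
    fix r show "norm (r\<^sup>2 * (w r)\<^sup>2) \<le> norm (r\<^sup>2 * (v1 r)\<^sup>2 + r\<^sup>2 * (v2 r)\<^sup>2)"
      using assms(4)[of r] by auto
  qed
qed

text \<open>The boundary value survives because the dilated function never exceeds \<open>M\<close>.\<close>

lemma bounded_profile_max_dilate:
  assumes p1: "bounded_profile R M u1 w1" and p2: "bounded_profile R M u2 w2"
    and c: "0 < c"
  shows "bounded_profile R M (\<lambda>r. max (u1 (c * r)) (u2 r))
           (\<lambda>r. if u1 (c * r) > u2 r then c * w1 (c * r) else w2 r)"
proof -
  note u1 = profileD[OF bounded_profileD(1)[OF p1]] and b1 = bounded_profileD(2,3)[OF p1]
  note u2 = profileD[OF bounded_profileD(1)[OF p2]] and b2 = bounded_profileD(2,3)[OF p2]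
  have m[measurable]: "(\<lambda>r. u1 (c * r)) \<in> borel_measurable borel" "(\<lambda>r. w1 (c * r)) \<in> borel_measurable borel"
    "u2 \<in> borel_measurable borel" "w2 \<in> borel_measurable borel"
    using u1(1,2) u2(1,2) by auto
  have wm: "(\<lambda>r. if u1 (c * r) > u2 r then c * w1 (c * r) else w2 r) \<in> borel_measurable borel"
    by measurable
  show ?thesis
    unfolding bounded_profile_def profile_def
  proof (intro conjI allI impI)
    show "primitive_on {0<..} (\<lambda>r. max (u1 (c * r)) (u2 r)) (\<lambda>r. if u1 (c * r) > u2 r then c * w1 (c * r) else w2 r)"
      by (intro primitive_on_max primitive_on_dilate u1(3) u2(3) c is_interval_positive)
    show "integrable lborel (\<lambda>r. r\<^sup>2 * (if u1 (c * r) > u2 r then c * w1 (c * r) else w2 r)\<^sup>2)"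
      by (rule square_integrable_if_between[OF integrable_dilate[OF u1(6) c] u2(6) wm]) auto
    show "max (u1 (c * x)) (u2 x) = M" if "R \<le> x" for x
      using u2(4)[OF that] b1(2)[of "c * x"] by auto
    show "(if u1 (c * x) > u2 x then c * w1 (c * x) else w2 x) = 0" if "x \<notin> {0<..<R}" for x
    proof (cases "x \<le> 0")
      case True
      then have "c * x \<le> 0" using c by (simp add: mult_nonneg_nonpos)
      then show ?thesis using u1(5)[of "c * x"] u2(5)[OF that] by auto
    next
      case False
      then show ?thesis using that u2(4)[of x] u2(5)[OF that] b1(2)[of "c * x"] by auto
    qed
    show "0 \<le> max (u1 (c * r)) (u2 r)" "max (u1 (c * r)) (u2 r) \<le> M" for r
      using b1[of "c * r"] b2[of r] by auto
  qed (use wm in measurable)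
qed

text \<open>Here the dilated function has reached \<open>M\<close> before \<open>R\<close>, so the minimum keeps the boundary value.\<close>

lemma bounded_profile_min_dilate:
  assumes R: "R > 0" and p1: "bounded_profile R M u1 w1" and p2: "bounded_profile R M u2 w2"
    and c: "1 \<le> c"
  shows "bounded_profile R M (\<lambda>r. min (u1 r) (u2 (c * r)))
           (\<lambda>r. if u1 r > u2 (c * r) then c * w2 (c * r) else w1 r)"
proof -
  note u1 = profileD[OF bounded_profileD(1)[OF p1]] and b1 = bounded_profileD(2,3)[OF p1]
  note u2 = profileD[OF bounded_profileD(1)[OF p2]] and b2 = bounded_profileD(2,3)[OF p2]
  have c0: "c > 0" using c by simp
  have m[measurable]: "(\<lambda>r. u2 (c * r)) \<in> borel_measurable borel" "(\<lambda>r. w2 (c * r)) \<in> borel_measurable borel"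
    "u1 \<in> borel_measurable borel" "w1 \<in> borel_measurable borel"
    using u1(1,2) u2(1,2) by auto
  have wm: "(\<lambda>r. if u1 r > u2 (c * r) then c * w2 (c * r) else w1 r) \<in> borel_measurable borel"
    by measurable
  have cR: "c * x \<ge> R" if "x \<ge> R" for x
    using mult_right_mono[OF c, of x] R that by linarith
  show ?thesis
    unfolding bounded_profile_def profile_def
  proof (intro conjI allI impI)
    show "primitive_on {0<..} (\<lambda>r. min (u1 r) (u2 (c * r))) (\<lambda>r. if u1 r > u2 (c * r) then c * w2 (c * r) else w1 r)"
      by (intro primitive_on_min primitive_on_dilate u1(3) u2(3) c0 is_interval_positive)
    show "integrable lborel (\<lambda>r. r\<^sup>2 * (if u1 r > u2 (c * r) then c * w2 (c * r) else w1 r)\<^sup>2)"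
      by (rule square_integrable_if_between[OF integrable_dilate[OF u2(6) c0] u1(6) wm]) auto
    show "min (u1 x) (u2 (c * x)) = M" if "R \<le> x" for x
      using u1(4)[OF that] u2(4)[OF cR[OF that]] by auto
    show "(if u1 x > u2 (c * x) then c * w2 (c * x) else w1 x) = 0" if "x \<notin> {0<..<R}" for x
    proof (cases "x \<le> 0")
      case True
      then have "c * x \<le> 0" using c0 by (simp add: mult_nonneg_nonpos)
      then show ?thesis using u2(5)[of "c * x"] u1(5)[OF that] by auto
    next
      case False
      then show ?thesis using that u1(5)[OF that] u2(5)[of "c * x"] cR[of x] by auto
    qed
    show "0 \<le> min (u1 r) (u2 (c * r))" "min (u1 r) (u2 (c * r)) \<le> M" for r
      using b1[of r] b2[of "c * r"] by auto
  qed (use wm in measurable)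
qed

section \<open>Uniqueness by dilation\<close>

text \<open>Each of the two minimizers is tested against a competitor that borrows from a dilation of the other. On
  the set where the competitor differs, the quadratic part and the bulk part scale differently; after the
  two inequalities are brought to the same variable, the quadratic parts cancel and only the bulk part
  with the factor \<open>1 - l\<^sup>2\<close> is left.\<close>

lemma minimizers_ordered_after_dilation:
  assumes R: "R > 0" and g: "continuous_on UNIV g"
    and dec: "\<And>a b. 0 \<le> a \<Longrightarrow> a < b \<Longrightarrow> b \<le> M \<Longrightarrow> g b < g a"
    and p1: "bounded_profile R M u1 w1" and p2: "bounded_profile R M u2 w2"
    and min1: "\<And>u w. bounded_profile R M u w \<Longrightarrow> profile_energy R g u1 w1 \<le> profile_energy R g u w"
    and min2: "\<And>u w. bounded_profile R M u w \<Longrightarrow> profile_energy R g u2 w2 \<le> profile_energy R g u w"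
    and l: "0 < l" "l < 1"
  shows "AE r in lborel. r \<in> {0<..<R} \<longrightarrow> u1 (l * r) \<le> u2 r"
proof -
  define c where "c = 1 / l"
  have c: "c \<ge> 1" "c > 0" "\<And>r. c * (l * r) = r" "c * l = 1" using l by (auto simp: c_def)
  note u1 = profileD[OF bounded_profileD(1)[OF p1]] and b1 = bounded_profileD(2,3)[OF p1]
  note u2 = profileD[OF bounded_profileD(1)[OF p2]] and b2 = bounded_profileD(2,3)[OF p2]
  define P where "P r = max (u1 (l * r)) (u2 r)" for r
  define P' where "P' r = (if u1 (l * r) > u2 r then l * w1 (l * r) else w2 r)" for r
  define Q where "Q r = min (u1 r) (u2 (c * r))" for r
  define Q' where "Q' r = (if u1 r > u2 (c * r) then c * w2 (c * r) else w1 r)" for r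
  have pP: "bounded_profile R M P P'"
    unfolding P_def P'_def by (rule bounded_profile_max_dilate[OF p1 p2 l(1)])
  have pQ: "bounded_profile R M Q Q'"
    unfolding Q_def Q'_def by (rule bounded_profile_min_dilate[OF R p1 p2 c(1)])
  define i where "i r = indicat_real {0<..<R} r" for r
  \<comment> \<open>The changes of the energy density in the two comparisons. Both vanish unless \<open>u1 (l * r) > u2 r\<close>, once
    the second is evaluated at \<open>l * r\<close>.\<close>
  define d1 where "d1 r = i r * (energy_density g P P' r - energy_density g u2 w2 r)" for r
  define d2 where "d2 r = i r * (energy_density g Q Q' r - energy_density g u1 w1 r)" for r
  have conv: "integrable lborel (\<lambda>r. i r * (energy_density g a a' r - energy_density g b b' r)) \<and>
      (\<integral>r. i r * (energy_density g a a' r - energy_density g b b' r) \<partial>lborel) = profile_energy R g a a' - profile_energy R g b b'"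
    if "bounded_profile R M a a'" "bounded_profile R M b b'" for a a' b b'
  proof -
    have "integrable (on_Ioo R) (\<lambda>r. energy_density g a a' r - energy_density g b b' r)"
      using integrable_energy_density[OF g] that by (intro Bochner_Integration.integrable_diff)
    moreover have "(\<integral>r. energy_density g a a' r - energy_density g b b' r \<partial>on_Ioo R) = profile_energy R g a a' - profile_energy R g b b'"
      unfolding profile_energy_def using integrable_energy_density[OF g] that by (intro Bochner_Integration.integral_diff)
    ultimately show ?thesis
      by (simp add: integrable_restrict_space integral_restrict_space i_def)
  qed
  have d1: "integrable lborel d1" "(\<integral>r. d1 r \<partial>lborel) \<ge> 0"
    using conv[OF pP p2] min2[OF pP] by (auto simp: d1_def[abs_def])
  have d2: "integrable lborel d2" "(\<integral>r. d2 r \<partial>lborel) \<ge> 0"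
    using conv[OF pQ p1] min1[OF pQ] by (auto simp: d2_def[abs_def])
  have d2': "integrable lborel (\<lambda>r. d2 (l * r))" "(\<integral>r. d2 (l * r) \<partial>lborel) \<ge> 0"
  proof -
    show "integrable lborel (\<lambda>r. d2 (l * r))"
      using lborel_integrable_real_affine[OF d2(1), of l 0] l by simp
    have "(\<integral>r. d2 r \<partial>lborel) = l * (\<integral>r. d2 (l * r) \<partial>lborel)"
      using lborel_integral_real_affine[of l d2 0] l by simp
    then show "(\<integral>r. d2 (l * r) \<partial>lborel) \<ge> 0"
      using d2(2) l by (simp add: zero_le_mult_iff)
  qed
  define s where "s r = i r * (if u1 (l * r) > u2 r then (1 - l\<^sup>2) * r\<^sup>2 * (g (u2 r) - g (u1 (l * r))) else 0)" for r
  have key: "d1 r + d2 (l * r) = - s r" for r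
  proof (cases "u1 (l * r) > u2 r \<and> r > 0")
    case True
    then have rR: "r < R" using u2(4)[of r] b1(2)[of "l * r"] by (auto simp: not_less[symmetric])
    then have "l * r < R" using l True mult_strict_right_mono[of l 1 r] by linarith
    then have i: "i r = 1" "i (l * r) = 1" using True rR l by (auto simp: i_def)
    have A: "c\<^sup>2 * l\<^sup>2 = 1" using c(4) by (metis power_mult_distrib power_one)
    have B: "energy_density g P P' r = 1/2 * (l\<^sup>2 * r\<^sup>2 * (w1 (l * r))\<^sup>2) + 3 * (u1 (l * r))\<^sup>2 + r\<^sup>2 * g (u1 (l * r))"
      using True by (simp add: energy_density_def P_def P'_def max_def power_mult_distrib)
    have C: "energy_density g Q Q' (l * r) = 1/2 * ((c\<^sup>2 * l\<^sup>2) * r\<^sup>2 * (w2 r)\<^sup>2) + 3 * (u2 r)\<^sup>2 + l\<^sup>2 * r\<^sup>2 * g (u2 r)"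
      using True by (simp add: energy_density_def Q_def Q'_def min_def c(3) power_mult_distrib)
    show ?thesis
      using True unfolding d1_def d2_def s_def i B C A
      by (simp add: energy_density_def power_mult_distrib algebra_simps)
  next
    case False
    then consider "r \<le> 0" | "u1 (l * r) \<le> u2 r" "r > 0" by linarith
    then show ?thesis
    proof cases
      case 1
      then have "l * r \<le> 0" using l by (simp add: mult_nonneg_nonpos)
      then have "i r = 0" "i (l * r) = 0" using 1 by (auto simp: i_def)
      then show ?thesis by (simp add: d1_def d2_def s_def)
    next
      case 2
      then show ?thesis by (auto simp: d1_def d2_def s_def energy_density_def P_def P'_def Q_def Q'_def c(3))
    qed
  qed
  have l2: "1 - l\<^sup>2 > 0" using l by (simp add: power_less_one_iff abs_square_less_1)
  have s: "s r \<ge> 0" "s r = 0 \<Longrightarrow> r \<in> {0<..<R} \<Longrightarrow> u1 (l * r) \<le> u2 r" for r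
  proof -
    have *: "(1 - l\<^sup>2) * r\<^sup>2 * (g (u2 r) - g (u1 (l * r))) > 0" if "u1 (l * r) > u2 r" "r \<in> {0<..<R}"
      using dec[of "u2 r" "u1 (l * r)"] b1[of "l * r"] b2[of r] that l2 by (intro mult_pos_pos) auto
    then show "s r \<ge> 0" "s r = 0 \<Longrightarrow> r \<in> {0<..<R} \<Longrightarrow> u1 (l * r) \<le> u2 r"
      by (auto simp: s_def i_def indicator_def less_imp_le not_less[symmetric])
  qed
  have "integrable lborel (\<lambda>r. - (d1 r + d2 (l * r)))"
    using d1(1) d2'(1) by auto
  then have si: "integrable lborel s" by (simp add: key)
  have "(\<integral>r. s r \<partial>lborel) = - ((\<integral>r. d1 r \<partial>lborel) + (\<integral>r. d2 (l * r) \<partial>lborel))"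
    using Bochner_Integration.integral_add[OF d1(1) d2'(1)] by (simp add: key)
  then have "(\<integral>r. s r \<partial>lborel) \<le> 0" using d1(2) d2'(2) by simp
  moreover have "(\<integral>r. s r \<partial>lborel) \<ge> 0" using s(1) by (intro Bochner_Integration.integral_nonneg)
  ultimately have "(\<integral>r. s r \<partial>lborel) = 0" by (rule antisym)
  then have "AE r in lborel. s r = 0"
    using integral_nonneg_eq_0_iff_AE[OF si AE_I2[OF s(1)]] by blast
  then show ?thesis by eventually_elim (use s(2) in auto)
qed

text \<open>Letting the dilation factor tend to \<open>1\<close> along a sequence keeps the exceptional set null.\<close>

lemma bounded_minimizers_ordered:
  assumes R: "R > 0" and g: "continuous_on UNIV g"
    and dec: "\<And>a b. 0 \<le> a \<Longrightarrow> a < b \<Longrightarrow> b \<le> M \<Longrightarrow> g b < g a"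
    and p1: "bounded_profile R M u1 w1" and p2: "bounded_profile R M u2 w2"
    and min1: "\<And>u w. bounded_profile R M u w \<Longrightarrow> profile_energy R g u1 w1 \<le> profile_energy R g u w"
    and min2: "\<And>u w. bounded_profile R M u w \<Longrightarrow> profile_energy R g u2 w2 \<le> profile_energy R g u w"
  shows "AE r in lborel. r \<in> {0<..<R} \<longrightarrow> u1 r \<le> u2 r"
proof -
  define l where "l n = 1 - 1 / (real n + 2)" for n
  have l: "0 < l n" "l n < 1" for n by (auto simp: l_def)
  have "(\<lambda>n. inverse (real (Suc (Suc n)))) \<longlonglongrightarrow> 0"
    by (rule LIMSEQ_Suc[OF LIMSEQ_inverse_real_of_nat])
  then have "(\<lambda>n. 1 - inverse (real (Suc (Suc n)))) \<longlonglongrightarrow> 1 - 0"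
    by (intro tendsto_intros)
  then have l1: "l \<longlonglongrightarrow> 1"
    by (simp add: l_def[abs_def] inverse_eq_divide add.commute)
  note u1 = profileD[OF bounded_profileD(1)[OF p1]]
  have cont: "isCont u1 r" if "r > 0" for r
    using primitive_on_continuous_on[OF u1(3)] that
    by (auto simp: continuous_on_eq_continuous_at is_interval_positive)
  have "AE r in lborel. \<forall>n. r \<in> {0<..<R} \<longrightarrow> u1 (l n * r) \<le> u2 r"
    unfolding AE_all_countable
    using minimizers_ordered_after_dilation[OF R g dec p1 p2 min1 min2 l] by blast
  then show ?thesis
  proof eventually_elim
    case (elim r)
    show ?case
    proof
      assume r: "r \<in> {0<..<R}"
      have "(\<lambda>n. l n * r) \<longlonglongrightarrow> 1 * r" by (intro tendsto_intros l1)
      then have "(\<lambda>n. u1 (l n * r)) \<longlonglongrightarrow> u1 r"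
        using isCont_tendsto_compose[OF cont] r by auto
      then show "u1 r \<le> u2 r" using elim r by (intro LIMSEQ_le_const2[of _ "u1 r"]) auto
    qed
  qed
qed

section \<open>Existence of a minimizer with bounded values\<close>

lemma bounded_profile_average:
  assumes p1: "bounded_profile R M u1 w1" and p2: "bounded_profile R M u2 w2"
  shows "bounded_profile R M (\<lambda>r. (u1 r + u2 r) / 2) (\<lambda>r. (w1 r + w2 r) / 2)"
proof -
  note u1 = profileD[OF bounded_profileD(1)[OF p1]] and b1 = bounded_profileD(2,3)[OF p1]
  note u2 = profileD[OF bounded_profileD(1)[OF p2]] and b2 = bounded_profileD(2,3)[OF p2]
  note [measurable] = u1(1,2) u2(1,2)
  show ?thesis
    unfolding bounded_profile_def profile_def
  proof (intro conjI allI impI)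
    show "primitive_on {0<..} (\<lambda>r. (u1 r + u2 r) / 2) (\<lambda>r. (w1 r + w2 r) / 2)"
      using primitive_on_cmult[OF primitive_on_add[OF u1(3) u2(3)], of "1/2"] by simp
    show "(u1 x + u2 x) / 2 = M" if "R \<le> x" for x using u1(4)[OF that] u2(4)[OF that] by simp
    show "(w1 x + w2 x) / 2 = 0" if "x \<notin> {0<..<R}" for x using u1(5)[OF that] u2(5)[OF that] by simp
    show "0 \<le> (u1 r + u2 r) / 2" "(u1 r + u2 r) / 2 \<le> M" for r using b1[of r] b2[of r] by auto
    show "integrable lborel (\<lambda>r. r\<^sup>2 * ((w1 r + w2 r) / 2)\<^sup>2)"
    proof (rule Bochner_Integration.integrable_bound[OF Bochner_Integration.integrable_add[OF u1(6) u2(6)]])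
      show "AE r in lborel. norm (r\<^sup>2 * ((w1 r + w2 r) / 2)\<^sup>2) \<le> norm (r\<^sup>2 * (w1 r)\<^sup>2 + r\<^sup>2 * (w2 r)\<^sup>2)"
      proof (rule AE_I2)
        fix r
        have "(w1 r)\<^sup>2 + (w2 r)\<^sup>2 - ((w1 r + w2 r) / 2)\<^sup>2 = ((w1 r - w2 r)\<^sup>2 + 2 * (w1 r)\<^sup>2 + 2 * (w2 r)\<^sup>2) / 4"
          by (simp add: power2_eq_square field_simps)
        also have "\<dots> \<ge> 0" by simp
        finally have "((w1 r + w2 r) / 2)\<^sup>2 \<le> (w1 r)\<^sup>2 + (w2 r)\<^sup>2" by simp
        then have "r\<^sup>2 * ((w1 r + w2 r) / 2)\<^sup>2 \<le> r\<^sup>2 * ((w1 r)\<^sup>2 + (w2 r)\<^sup>2)" by (intro mult_left_mono) auto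
        then show "norm (r\<^sup>2 * ((w1 r + w2 r) / 2)\<^sup>2) \<le> norm (r\<^sup>2 * (w1 r)\<^sup>2 + r\<^sup>2 * (w2 r)\<^sup>2)"
          by (simp add: distrib_left)
      qed
    qed measurable
  qed measurable
qed

lemma energy_density_nonneg:
  assumes "\<And>a. g a \<ge> 0"
  shows "energy_density g u w r \<ge> 0"
  unfolding energy_density_def using assms by (intro add_nonneg_nonneg mult_nonneg_nonneg) auto

lemma profile_energy_nonneg:
  assumes "\<And>a. g a \<ge> 0"
  shows "profile_energy R g u w \<ge> 0"
  unfolding profile_energy_def using energy_density_nonneg[OF assms] by (intro Bochner_Integration.integral_nonneg)

lemma weighted_square_le_energy:
  assumes g: "continuous_on UNIV g" "\<And>a. g a \<ge> 0" and p: "bounded_profile R M u w"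
  shows "(\<integral>r. r\<^sup>2 * (w r)\<^sup>2 \<partial>lborel) \<le> 2 * profile_energy R g u w"
proof -
  note u = profileD[OF bounded_profileD(1)[OF p]]
  have eq: "integrable (on_Ioo R) (\<lambda>r. r\<^sup>2 * (w r)\<^sup>2)" "(\<integral>r. r\<^sup>2 * (w r)\<^sup>2 \<partial>on_Ioo R) = (\<integral>r. r\<^sup>2 * (w r)\<^sup>2 \<partial>lborel)"
    using integrable_on_Ioo_iff[of R "\<lambda>r. r\<^sup>2 * (w r)\<^sup>2"] u(5,6) by auto
  have "(\<integral>r. r\<^sup>2 * (w r)\<^sup>2 \<partial>on_Ioo R) \<le> (\<integral>r. 2 * energy_density g u w r \<partial>on_Ioo R)"
    using integrable_energy_density[OF g(1) p] g(2)
  proof (intro integral_mono eq integrable_mult_right)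
    fix r
    show "r\<^sup>2 * (w r)\<^sup>2 \<le> 2 * energy_density g u w r"
      using g(2)[of "u r"] by (simp add: energy_density_def)
  qed
  then show ?thesis by (simp add: eq profile_energy_def)
qed

text \<open>Bounds an \<open>L\<^sup>1\<close> norm by an \<open>L\<^sup>2\<close> norm with a free parameter, in place of the Cauchy-Schwarz
  inequality.\<close>

lemma linear_le_weighted_square:
  fixes a s :: real
  assumes "s > 0"
  shows "a \<le> s / 2 * a\<^sup>2 + 1 / (2 * s)"
proof -
  have "(s * a - 1)\<^sup>2 = s * s * a\<^sup>2 - 2 * s * a + 1"
    by (simp add: power2_eq_square algebra_simps)
  then have "2 * s * a \<le> s * s * a\<^sup>2 + 1"
    using zero_le_power2[of "s * a - 1"] by linarith
  then show ?thesis
    using assms by (simp add: field_simps power2_eq_square)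
qed

lemma le_square_plus_one: "(a :: real) \<le> a\<^sup>2 + 1"
proof -
  have "a \<le> 1 / 2 * a\<^sup>2 + 1 / 2" using linear_le_weighted_square[of 1 a] by simp
  then show ?thesis using zero_le_power2[of a] by linarith
qed

text \<open>The function itself is not equicontinuous near \<open>0\<close>, but \<open>r u(r)\<close> has the derivative \<open>r w + u\<close>, the sum of
  a function bounded in \<open>L\<^sup>2\<close> and a bounded function.\<close>

lemma weighted_profile_Hoelder:
  assumes p: "bounded_profile R M u w" and C: "(\<integral>r. r\<^sup>2 * (w r)\<^sup>2 \<partial>lborel) \<le> C"
    and xy: "0 \<le> x" "x \<le> y"
  shows "\<bar>y * u y - x * u x\<bar> \<le> (C + 1) / 2 * sqrt (y - x) + M * (y - x)"
proof -
  note u = profileD[OF bounded_profileD(1)[OF p]] and b = bounded_profileD(2,3)[OF p]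
  have M: "M \<ge> 0" using b[of 0] by simp
  have C0: "C \<ge> 0" using C by (rule order_trans[rotated]) (simp add: Bochner_Integration.integral_nonneg)
  consider "x = y" | "x = 0" "x < y" | "0 < x" "x < y" using xy by linarith
  then show ?thesis
  proof cases
    case 1 then show ?thesis using C0 M by simp
  next
    case 2
    have "\<bar>y * u y\<bar> \<le> M * y" using 2 b[of y] by (simp add: abs_mult mult.commute mult_left_mono)
    moreover have "(C + 1) / 2 * sqrt y \<ge> 0" using 2 C0 by simp
    ultimately show ?thesis using 2 by simp
  next
    case 3
    \<comment> \<open>This weight balances \<open>s C / 2\<close> against \<open>(y - x) / (2 s)\<close>.\<close>
    define s where "s = sqrt (y - x)"
    have s: "s > 0" "s * s = y - x" using 3 by (auto simp: s_def)
    have id: "primitive_on {0<..} (\<lambda>z. z) (\<lambda>z. 1)"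
      unfolding primitive_on_def using has_integral_const_real[of "1::real"] by (auto split: if_splits) (metis content_real mult.right_neutral real_scaleR_def)
    have I: "((\<lambda>z. z * w z + u z * 1) has_integral (u y * y - u x * x)) {x..y}"
      using primitive_onD(2)[OF primitive_on_mult[OF is_interval_positive u(3) id], of x y] 3 by auto
    have S: "set_integrable lborel {x..y} (\<lambda>r. r\<^sup>2 * (w r)\<^sup>2)"
      unfolding set_integrable_def using integrable_mult_indicator[OF _ u(6), of "{x..y}"] by simp
    note SI = set_borel_integral_eq_integral[OF S]
    have "integral {x..y} (\<lambda>r. r\<^sup>2 * (w r)\<^sup>2) = (LINT r:{x..y}|lborel. r\<^sup>2 * (w r)\<^sup>2)" using SI(2) by simp
    also have "\<dots> \<le> (\<integral>r. r\<^sup>2 * (w r)\<^sup>2 \<partial>lborel)"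
      unfolding set_lebesgue_integral_def
      by (rule integral_mono) (use S u(6) in \<open>auto simp: set_integrable_def indicator_def\<close>)
    finally have CC: "integral {x..y} (\<lambda>r. r\<^sup>2 * (w r)\<^sup>2) \<le> C" using C by simp
    have B: "((\<lambda>z. s / 2 * (z\<^sup>2 * (w z)\<^sup>2) + (1 / (2 * s) + M)) has_integral
       s / 2 * integral {x..y} (\<lambda>r. r\<^sup>2 * (w r)\<^sup>2) + (y - x) * (1 / (2 * s) + M)) {x..y}"
      using has_integral_add[OF has_integral_mult_right[OF integrable_integral[OF SI(1)], of "s/2"]
          has_integral_const_real[of "1 / (2 * s) + M" x y]] 3 by simp
    have "norm (integral {x..y} (\<lambda>z. z * w z + u z * 1)) \<le> integral {x..y} (\<lambda>z. s / 2 * (z\<^sup>2 * (w z)\<^sup>2) + (1 / (2 * s) + M))"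
    proof (rule integral_norm_bound_integral)
      fix z
      define a where "a = \<bar>z * w z\<bar>"
      have a2: "a\<^sup>2 = z\<^sup>2 * (w z)\<^sup>2" by (simp add: a_def power_mult_distrib)
      have "a \<le> s / 2 * a\<^sup>2 + 1 / (2 * s)" by (rule linear_le_weighted_square[OF s(1)])
      then have "\<bar>z * w z\<bar> \<le> s / 2 * (z\<^sup>2 * (w z)\<^sup>2) + 1 / (2 * s)"
        by (simp only: a2 a_def[symmetric])
      moreover have "\<bar>u z\<bar> \<le> M" using b[of z] by simp
      ultimately show "norm (z * w z + u z * 1) \<le> s / 2 * (z\<^sup>2 * (w z)\<^sup>2) + (1 / (2 * s) + M)"
        by (simp add: abs_le_iff)
    qed (use I B in blast)+
    then have "\<bar>y * u y - x * u x\<bar> \<le> s / 2 * integral {x..y} (\<lambda>r. r\<^sup>2 * (w r)\<^sup>2) + (y - x) * (1 / (2 * s) + M)"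
      using integral_unique[OF I] integral_unique[OF B] by (simp add: mult.commute)
    also have "\<dots> \<le> s / 2 * C + (y - x) * (1 / (2 * s) + M)"
      using CC s(1) by (intro add_right_mono mult_left_mono) auto
    also have "\<dots> = (C + 1) / 2 * s + M * (y - x)"
      unfolding s(2)[symmetric] using s(1) by (simp add: field_simps)
    finally show ?thesis by (simp add: s_def)
  qed
qed

lemma bounded_profiles_compact:
  assumes p: "\<And>n. bounded_profile R M (u n) (w n)"
    and C: "\<And>n. (\<integral>r. r\<^sup>2 * (w n r)\<^sup>2 \<partial>lborel) \<le> C"
  obtains k v where "strict_mono (k :: nat \<Rightarrow> nat)" "\<forall>r\<in>{0<..<R}. (\<lambda>n. u (k n) r) \<longlonglongrightarrow> v r"
proof -
  have b: "0 \<le> u n r" "u n r \<le> M" for n r using bounded_profileD(2,3)[OF p] by auto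
  have M: "M \<ge> 0" using b[of 0 0] by simp
  define K where "K d = (C + 1) / 2 * sqrt \<bar>d\<bar> + M * \<bar>d\<bar>" for d
  have Hol: "\<bar>x * u n x - y * u n y\<bar> \<le> K (x - y)" if "x \<ge> 0" "y \<ge> 0" for n x y
    using weighted_profile_Hoelder[OF p C, of x y n] weighted_profile_Hoelder[OF p C, of y x n] that
    by (cases "x \<le> y") (auto simp: K_def abs_minus_commute)
  have "isCont K 0" unfolding K_def by (intro continuous_intros)
  then have K0: "(K \<longlongrightarrow> 0) (at 0)" by (simp add: isCont_def K_def)
  obtain f k where "strict_mono (k :: nat \<Rightarrow> nat)"
    and f: "\<And>e. 0 < e \<Longrightarrow> \<exists>N. \<forall>n x. n \<ge> N \<and> x \<in> {0..R} \<longrightarrow> norm (x * u (k n) x - f x) < e"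
  proof (rule Arzela_Ascoli[of "{0..R}" "\<lambda>n x. x * u n x" "R * M"])
    show "norm (x * u n x) \<le> R * M" if "x \<in> {0..R}" for n x
      using that b[of n x] M by (auto simp: abs_mult intro!: mult_mono)
    show "\<exists>d>0. \<forall>n y. y \<in> {0..R} \<and> norm (x - y) < d \<longrightarrow> norm (x * u n x - y * u n y) < e"
      if x: "x \<in> {0..R}" and e: "e > 0" for x e
    proof -
      obtain d where d: "d > 0" "\<And>z. z \<noteq> 0 \<Longrightarrow> \<bar>z\<bar> < d \<Longrightarrow> \<bar>K z\<bar> < e"
        using K0[unfolded LIM_eq, rule_format, OF e] by auto
      have "norm (x * u n x - y * u n y) < e" if "y \<in> {0..R}" "norm (x - y) < d" for n y
        using d(2)[of "x - y"] that Hol[of x y n] x e by (cases "x = y") auto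
      then show ?thesis using d(1) by blast
    qed
  qed auto
  show ?thesis
  proof (rule that[OF \<open>strict_mono k\<close>], rule ballI)
    fix r assume r: "r \<in> {0<..<R}"
    have "(\<lambda>n. r * u (k n) r) \<longlonglongrightarrow> f r"
    proof (rule LIMSEQ_I)
      fix e :: real assume "e > 0"
      have "r \<in> {0..R}" using r by auto
      with f[OF \<open>e > 0\<close>] show "\<exists>N. \<forall>n\<ge>N. norm (r * u (k n) r - f r) < e" by blast
    qed
    then have "(\<lambda>n. r * u (k n) r / r) \<longlonglongrightarrow> f r / r"
      by (rule tendsto_divide) (use r in auto)
    then show "(\<lambda>n. u (k n) r) \<longlonglongrightarrow> f r / r" using r by simp
  qed
qed

lemma primitive_on_AE_cong:
  assumes u: "primitive_on I u w" and ae: "AE x in lborel. w x = w' x"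
  shows "primitive_on I u w'"
proof -
  have "AE x in lebesgue. w x = w' x" using ae by (rule AE_completion)
  then obtain N where N: "negligible N" "\<And>x. x \<notin> N \<Longrightarrow> w' x = w x"
    by (auto simp: eventually_ae_filter_negligible) (metis (mono_tags, lifting) mem_Collect_eq subset_iff)
  show ?thesis
    unfolding primitive_on_def
  proof (intro ballI impI conjI)
    fix x y assume xy: "x \<in> I" "y \<in> I" "x \<le> y"
    show "w' absolutely_integrable_on {x..y}"
      using absolutely_integrable_spike[OF primitive_onD(1)[OF u xy] N(1)] N(2) by auto
    show "(w' has_integral (u y - u x)) {x..y}"
      using has_integral_spike[OF N(1) _ primitive_onD(2)[OF u xy]] N(2) by auto
  qed
qed

text \<open>The average of two profiles is again a competitor, so its energy is at least \<open>m\<close>. Expanding the gradient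
  term by the parallelogram identity bounds the distance of the gradients by the excess energies, up to the
  change of the remaining terms, which are Lipschitz in the values. The function \<open>v\<close> will be the
  pointwise limit of a minimizing sequence, so that the right-hand side splits into two null sequences.\<close>

lemma parallelogram_energy_bound:
  assumes g: "continuous_on UNIV g"
    and Lnn: "L \<ge> 0" and L: "\<And>a b. 0 \<le> a \<Longrightarrow> a \<le> M \<Longrightarrow> 0 \<le> b \<Longrightarrow> b \<le> M \<Longrightarrow> \<bar>g a - g b\<bar> \<le> L * \<bar>a - b\<bar>"
    and p1: "bounded_profile R M u1 w1" and p2: "bounded_profile R M u2 w2"
    and m: "\<And>u w. bounded_profile R M u w \<Longrightarrow> m \<le> profile_energy R g u w"
    and v: "v \<in> borel_measurable (on_Ioo R)" "\<And>r. r \<in> {0<..<R} \<Longrightarrow> 0 \<le> v r \<and> v r \<le> M"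
  defines "L' \<equiv> 6 * M + R\<^sup>2 * L"
  shows "(\<integral>r. r\<^sup>2 * (w1 r - w2 r)\<^sup>2 \<partial>lborel)
    \<le> 4 * (profile_energy R g u1 w1 - m) + 4 * (profile_energy R g u2 w2 - m)
      + 4 * L' * (\<integral>r. \<bar>u1 r - v r\<bar> \<partial>on_Ioo R) + 4 * L' * (\<integral>r. \<bar>u2 r - v r\<bar> \<partial>on_Ioo R)"
    and "integrable lborel (\<lambda>r. r\<^sup>2 * (w1 r - w2 r)\<^sup>2)"
proof -
  note u1 = profileD[OF bounded_profileD(1)[OF p1]] and b1 = bounded_profileD(2,3)[OF p1]
  note u2 = profileD[OF bounded_profileD(1)[OF p2]] and b2 = bounded_profileD(2,3)[OF p2]
  note [measurable] = u1(1,2) u2(1,2) v(1)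
  have M: "M \<ge> 0" using b1[of 0] by simp
  show int: "integrable lborel (\<lambda>r. r\<^sup>2 * (w1 r - w2 r)\<^sup>2)"
  proof (rule Bochner_Integration.integrable_bound)
    show "integrable lborel (\<lambda>r. 2 * (r\<^sup>2 * (w1 r)\<^sup>2 + r\<^sup>2 * (w2 r)\<^sup>2))"
      using u1(6) u2(6) by auto
    show "AE r in lborel. norm (r\<^sup>2 * (w1 r - w2 r)\<^sup>2) \<le> norm (2 * (r\<^sup>2 * (w1 r)\<^sup>2 + r\<^sup>2 * (w2 r)\<^sup>2))"
    proof (rule AE_I2)
      fix r
      have "(w1 r - w2 r)\<^sup>2 + (w1 r + w2 r)\<^sup>2 = 2 * ((w1 r)\<^sup>2 + (w2 r)\<^sup>2)"
        by (simp add: power2_eq_square algebra_simps)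
      then have "(w1 r - w2 r)\<^sup>2 \<le> 2 * ((w1 r)\<^sup>2 + (w2 r)\<^sup>2)"
        using zero_le_power2[of "w1 r + w2 r"] by linarith
      then have "r\<^sup>2 * (w1 r - w2 r)\<^sup>2 \<le> r\<^sup>2 * (2 * ((w1 r)\<^sup>2 + (w2 r)\<^sup>2))" by (intro mult_left_mono) auto
      then show "norm (r\<^sup>2 * (w1 r - w2 r)\<^sup>2) \<le> norm (2 * (r\<^sup>2 * (w1 r)\<^sup>2 + r\<^sup>2 * (w2 r)\<^sup>2))"
        by (simp add: algebra_simps)
    qed
  qed measurable
  have eq: "integrable (on_Ioo R) (\<lambda>r. r\<^sup>2 * (w1 r - w2 r)\<^sup>2)"
    "(\<integral>r. r\<^sup>2 * (w1 r - w2 r)\<^sup>2 \<partial>on_Ioo R) = (\<integral>r. r\<^sup>2 * (w1 r - w2 r)\<^sup>2 \<partial>lborel)"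
    using integrable_on_Ioo_iff[of R "\<lambda>r. r\<^sup>2 * (w1 r - w2 r)\<^sup>2"] int u1(5) u2(5) by auto
  have ui: "integrable (on_Ioo R) (\<lambda>r. \<bar>u r - v r\<bar>)"
    if "u \<in> borel_measurable borel" "\<And>r. 0 \<le> u r \<and> u r \<le> M" for u
  proof (rule finite_measure.integrable_const_bound[OF finite_measure_on_Ioo, where B = M])
    show "AE r in on_Ioo R. norm \<bar>u r - v r\<bar> \<le> M"
      using that(2) v(2) by (intro AE_I2) (auto simp: space_restrict_space abs_le_iff, (metis add_increasing2 diff_le_eq order_trans)+)
    have "u \<in> borel_measurable (on_Ioo R)" using that(1) by (rule borel_measurable_on_Ioo)
    then show "(\<lambda>r. \<bar>u r - v r\<bar>) \<in> borel_measurable (on_Ioo R)" by measurable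
  qed
  note ui1 = ui[OF u1(1)] and ui2 = ui[OF u2(1)]
  note p = bounded_profile_average[OF p1 p2]
  let ?u = "\<lambda>r. (u1 r + u2 r) / 2" and ?w = "\<lambda>r. (w1 r + w2 r) / 2"
  note d1 = integrable_energy_density[OF g p1] and d2 = integrable_energy_density[OF g p2] and d = integrable_energy_density[OF g p]
  have "(\<integral>r. r\<^sup>2 * (w1 r - w2 r)\<^sup>2 \<partial>on_Ioo R) \<le>
     (\<integral>r. 4 * energy_density g u1 w1 r + 4 * energy_density g u2 w2 r - 8 * energy_density g ?u ?w r
       + 4 * L' * \<bar>u1 r - v r\<bar> + 4 * L' * \<bar>u2 r - v r\<bar> \<partial>on_Ioo R)"
  proof (rule integral_mono[OF eq(1)])
    show "integrable (on_Ioo R) (\<lambda>r. 4 * energy_density g u1 w1 r + 4 * energy_density g u2 w2 r - 8 * energy_density g ?u ?w r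
       + 4 * L' * \<bar>u1 r - v r\<bar> + 4 * L' * \<bar>u2 r - v r\<bar>)"
      using d1 d2 d ui1 ui2 b1 b2 by auto
    fix r assume "r \<in> space (on_Ioo R)"
    then have r: "0 < r" "r < R" by (auto simp: space_restrict_space)
    define pot where "pot a = 3 * a\<^sup>2 + r\<^sup>2 * g a" for a
    have pot: "pot a - pot b \<le> L' * \<bar>a - b\<bar>" if "0 \<le> a" "a \<le> M" "0 \<le> b" "b \<le> M" for a b
    proof -
      have "a\<^sup>2 - b\<^sup>2 = (a + b) * (a - b)" by (simp add: power2_eq_square algebra_simps)
      also have "\<dots> \<le> (a + b) * \<bar>a - b\<bar>" using that by (intro mult_left_mono) auto
      also have "\<dots> \<le> (2 * M) * \<bar>a - b\<bar>" using that by (intro mult_right_mono) auto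
      finally have 1: "3 * (a\<^sup>2 - b\<^sup>2) \<le> 6 * M * \<bar>a - b\<bar>" by simp
      have "r\<^sup>2 * (g a - g b) \<le> r\<^sup>2 * \<bar>g a - g b\<bar>" by (intro mult_left_mono) auto
      also have "\<dots> \<le> R\<^sup>2 * (L * \<bar>a - b\<bar>)"
        using r L[OF that] by (intro mult_mono power_mono) auto
      finally show ?thesis using 1 by (simp add: pot_def L'_def algebra_simps)
    qed
    define a b z where "a = u1 r" and "b = u2 r" and "z = v r"
    have ab: "0 \<le> a" "a \<le> M" "0 \<le> b" "b \<le> M" "0 \<le> z" "z \<le> M"
      using b1[of r] b2[of r] v(2)[of r] r by (auto simp: a_def b_def z_def)
    have L0: "L' \<ge> 0" using M Lnn by (simp add: L'_def)
    have h: "\<bar>(a + b) / 2 - a\<bar> = \<bar>a - b\<bar> / 2" "\<bar>(a + b) / 2 - b\<bar> = \<bar>a - b\<bar> / 2"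
      by (auto simp: abs_if field_simps)
    have "pot ((a + b) / 2) - pot a \<le> L' * (\<bar>a - b\<bar> / 2)" "pot ((a + b) / 2) - pot b \<le> L' * (\<bar>a - b\<bar> / 2)"
      using pot[of "(a + b) / 2" a] pot[of "(a + b) / 2" b] ab unfolding h by auto
    then have "8 * pot ((a + b) / 2) \<le> 4 * pot a + 4 * pot b + 4 * (L' * \<bar>a - b\<bar>)" by simp
    also have "L' * \<bar>a - b\<bar> \<le> L' * (\<bar>a - z\<bar> + \<bar>b - z\<bar>)"
      using L0 by (intro mult_left_mono) auto
    finally have P: "8 * pot ((a + b) / 2) \<le> 4 * pot a + 4 * pot b + 4 * L' * \<bar>a - z\<bar> + 4 * L' * \<bar>b - z\<bar>"
      by (simp add: algebra_simps)
    have W: "4 * (1/2 * (r\<^sup>2 * (w1 r)\<^sup>2)) + 4 * (1/2 * (r\<^sup>2 * (w2 r)\<^sup>2)) - 8 * (1/2 * (r\<^sup>2 * (?w r)\<^sup>2)) = r\<^sup>2 * (w1 r - w2 r)\<^sup>2"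
      by (simp add: power2_eq_square field_simps)
    have D: "energy_density g u1 w1 r = 1/2 * (r\<^sup>2 * (w1 r)\<^sup>2) + pot a" "energy_density g u2 w2 r = 1/2 * (r\<^sup>2 * (w2 r)\<^sup>2) + pot b"
      "energy_density g ?u ?w r = 1/2 * (r\<^sup>2 * (?w r)\<^sup>2) + pot ((a + b) / 2)"
      by (auto simp: energy_density_def pot_def a_def b_def)
    show "r\<^sup>2 * (w1 r - w2 r)\<^sup>2 \<le> 4 * energy_density g u1 w1 r + 4 * energy_density g u2 w2 r - 8 * energy_density g ?u ?w r
       + 4 * L' * \<bar>u1 r - v r\<bar> + 4 * L' * \<bar>u2 r - v r\<bar>"
      using P W[symmetric] unfolding D a_def[symmetric] b_def[symmetric] z_def[symmetric]
      by (simp only: algebra_simps)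
  qed
  also have "\<dots> = 4 * profile_energy R g u1 w1 + 4 * profile_energy R g u2 w2 - 8 * profile_energy R g ?u ?w
       + 4 * L' * (\<integral>r. \<bar>u1 r - v r\<bar> \<partial>on_Ioo R) + 4 * L' * (\<integral>r. \<bar>u2 r - v r\<bar> \<partial>on_Ioo R)"
    unfolding profile_energy_def using d1 d2 d ui1 ui2 b1 b2 by simp
  finally show "(\<integral>r. r\<^sup>2 * (w1 r - w2 r)\<^sup>2 \<partial>lborel)
    \<le> 4 * (profile_energy R g u1 w1 - m) + 4 * (profile_energy R g u2 w2 - m)
      + 4 * L' * (\<integral>r. \<bar>u1 r - v r\<bar> \<partial>on_Ioo R) + 4 * L' * (\<integral>r. \<bar>u2 r - v r\<bar> \<partial>on_Ioo R)"
    using m[OF p] by (simp add: eq)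
qed


text \<open>Geometrically small gradient differences are summable almost everywhere, and their sum is an integrable
  majorant. Hence the gradients converge almost everywhere and the limit is again a profile; the energy
  passes to the limit by Fatou's lemma.\<close>

lemma bounded_profile_of_limit:
  assumes R: "R > 0" and g: "continuous_on UNIV g" "\<And>a. g a \<ge> 0"
    and p: "\<And>k. bounded_profile R M (U k) (W k)"
    and lim: "\<And>r. r \<in> {0<..<R} \<Longrightarrow> (\<lambda>k. U k r) \<longlonglongrightarrow> v r"
    and cauchy: "\<And>k. (\<integral>r. r\<^sup>2 * (W (Suc k) r - W k r)\<^sup>2 \<partial>lborel) \<le> (1/4) ^ k"
      "\<And>k. integrable lborel (\<lambda>r. r\<^sup>2 * (W (Suc k) r - W k r)\<^sup>2)"
    and E: "(\<lambda>k. profile_energy R g (U k) (W k)) \<longlonglongrightarrow> m"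
  obtains u w where "bounded_profile R M u w" "profile_energy R g u w \<le> m"
proof -
  note pr = profileD[OF bounded_profileD(1)[OF p]]
  note b = bounded_profileD(2,3)[OF p]
  have M: "M \<ge> 0" using b[of 0 0] by simp
  note [measurable] = pr(1,2)
  define \<Delta> where "\<Delta> k r = \<bar>r * (W (Suc k) r - W k r)\<bar>" for k r
  have [measurable]: "\<Delta> k \<in> borel_measurable borel" for k unfolding \<Delta>_def[abs_def] by measurable
  have ind: "integrable lborel (indicat_real {0<..<R})" "(\<integral>r. indicat_real {0<..<R} r \<partial>lborel) = R"
    using R by (auto simp: integrable_indicator_iff)
  have \<Delta>: "(\<integral>\<^sup>+r. ennreal (\<Delta> k r) \<partial>lborel) \<le> ennreal ((1 + R) / 2 * (1/2) ^ k)" for k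
  proof -
    \<comment> \<open>The parameter that turns the rate \<open>(1/4)^k\<close> in \<open>L\<^sup>2\<close> into the rate \<open>(1/2)^k\<close> in \<open>L\<^sup>1\<close>.\<close>
    let ?c = "2 ^ k :: real"
    have c: "?c > 0" by simp
    let ?f = "\<lambda>r. ?c / 2 * (r\<^sup>2 * (W (Suc k) r - W k r)\<^sup>2) + 1 / (2 * ?c) * indicat_real {0<..<R} r"
    have f: "integrable lborel ?f" using cauchy(2) ind(1) by auto
    have "\<Delta> k r \<le> ?f r" for r
    proof (cases "r \<in> {0<..<R}")
      case True
      define a where "a = \<Delta> k r"
      have a2: "a\<^sup>2 = r\<^sup>2 * (W (Suc k) r - W k r)\<^sup>2" by (simp add: a_def \<Delta>_def power_mult_distrib)
      have "a \<le> ?c / 2 * a\<^sup>2 + 1 / (2 * ?c)" by (rule linear_le_weighted_square[OF c])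
      then show ?thesis using True by (simp add: a2 a_def[symmetric])
    next
      case False
      then show ?thesis using pr(5) by (simp add: \<Delta>_def)
    qed
    then have "(\<integral>\<^sup>+r. ennreal (\<Delta> k r) \<partial>lborel) \<le> (\<integral>\<^sup>+r. ennreal (?f r) \<partial>lborel)"
      by (intro nn_integral_mono ennreal_leI)
    also have "\<dots> = ennreal (\<integral>r. ?f r \<partial>lborel)"
      using f by (rule nn_integral_eq_integral) auto
    also have "(\<integral>r. ?f r \<partial>lborel) = ?c / 2 * (\<integral>r. r\<^sup>2 * (W (Suc k) r - W k r)\<^sup>2 \<partial>lborel) + 1 / (2 * ?c) * R"
      using cauchy(2)[of k] ind by simp
    also have "\<dots> \<le> ?c / 2 * (1/4) ^ k + 1 / (2 * ?c) * R"
      using cauchy(1)[of k] by (intro add_right_mono mult_left_mono) auto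
    also have "\<dots> = (1 + R) / 2 * (1/2) ^ k"
    proof -
      have "(1/4 :: real) ^ k = (1 / ?c) * (1 / ?c)" by (simp add: power_one_over power_mult_distrib[symmetric] flip: power_divide)
      then show ?thesis by (simp add: power_one_over field_simps)
    qed
    finally show ?thesis by (simp add: ennreal_leI)
  qed
  define Y where "Y r = (\<Sum>k. ennreal (\<Delta> k r))" for r
  have [measurable]: "Y \<in> borel_measurable borel" unfolding Y_def[abs_def] by measurable
  have Yfin: "(\<integral>\<^sup>+r. Y r \<partial>lborel) < \<infinity>"
  proof -
    have "(\<integral>\<^sup>+r. Y r \<partial>lborel) = (\<Sum>k. \<integral>\<^sup>+r. ennreal (\<Delta> k r) \<partial>lborel)"
      unfolding Y_def by (rule nn_integral_suminf) simp
    also have "\<dots> \<le> (\<Sum>k. ennreal ((1 + R) / 2 * (1/2) ^ k))"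
      by (intro suminf_le \<Delta>) auto
    also have "\<dots> = ennreal (\<Sum>k. (1 + R) / 2 * (1/2) ^ k)"
      using R by (intro suminf_ennreal2 summable_mult summable_geometric) auto
    finally show ?thesis by (simp add: le_less_trans[OF _ ennreal_less_top])
  qed
  have Yae: "AE r in lborel. Y r \<noteq> \<infinity>"
    using nn_integral_PInf_AE[of Y lborel] Yfin by auto
  \<comment> \<open>On the null set without convergence the gradients are set to \<open>0\<close>, so that limit and majorant exist everywhere.\<close>
  define W' where "W' k r = (if Y r = \<infinity> then 0 else W k r)" for k r
  have [measurable]: "W' k \<in> borel_measurable borel" for k unfolding W'_def[abs_def] by measurable
  define S where "S r = (if Y r = \<infinity> then 0 else enn2real (Y r))" for r
  have Ssum: "summable (\<lambda>k. \<Delta> k r)" "(\<Sum>k. \<Delta> k r) = S r" if "Y r \<noteq> \<infinity>" for r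
  proof -
    show s: "summable (\<lambda>k. \<Delta> k r)"
      using that by (intro summable_suminf_not_top) (auto simp: Y_def \<Delta>_def)
    have "Y r = ennreal (\<Sum>k. \<Delta> k r)" unfolding Y_def by (rule suminf_ennreal2[OF _ s]) (simp add: \<Delta>_def)
    moreover have "(\<Sum>k. \<Delta> k r) \<ge> 0" by (rule suminf_nonneg[OF s]) (simp add: \<Delta>_def)
    ultimately show "(\<Sum>k. \<Delta> k r) = S r" using that by (simp add: S_def)
  qed
  have conv: "convergent (\<lambda>k. W' k r)" for r
  proof (cases "Y r = \<infinity> \<or> r \<notin> {0<..<R}")
    case True
    then have "W' k r = 0" for k using pr(5) by (auto simp: W'_def)
    then show ?thesis by (simp add: convergent_const)
  next
    case False
    then have r: "r > 0" and Y: "Y r \<noteq> \<infinity>" by auto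
    have "summable (\<lambda>k. r * (W (Suc k) r - W k r))"
      by (rule summable_rabs_cancel) (use Ssum(1)[OF Y] in \<open>simp add: \<Delta>_def\<close>)
    then have "summable (\<lambda>k. (1 / r) * (r * (W (Suc k) r - W k r)))" by (rule summable_mult)
    then have "summable (\<lambda>k. W (Suc k) r - W k r)" using r by simp
    then have "convergent (\<lambda>n. \<Sum>k<n. W (Suc k) r - W k r)" by (simp add: summable_iff_convergent)
    then have "convergent (\<lambda>n. W n r - W 0 r)" by (subst (asm) sum_lessThan_telescope)
    then have "convergent (\<lambda>n. W 0 r + (W n r - W 0 r))"
      by (intro convergent_add convergent_const)
    then show ?thesis using Y by (simp add: W'_def)
  qed
  define w where "w r = lim (\<lambda>k. W' k r)" for r
  have W'lim: "(\<lambda>k. W' k r) \<longlonglongrightarrow> w r" for r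
    using conv[of r] by (simp add: w_def convergent_LIMSEQ_iff)
  have wm[measurable]: "w \<in> borel_measurable borel"
    by (rule borel_measurable_LIMSEQ_real[OF W'lim]) measurable
  define u where "u r = (if r \<ge> R then M else if r > 0 then v r else 0)" for r
  define U' where "U' k r = (if r > 0 then U k r else 0)" for k r
  have [measurable]: "U' k \<in> borel_measurable borel" for k unfolding U'_def[abs_def] by measurable
  have U'lim: "(\<lambda>k. U' k r) \<longlonglongrightarrow> u r" for r
  proof -
    consider "r \<ge> R" | "r \<in> {0<..<R}" | "r \<le> 0" using R by force
    then show ?thesis
      by cases (use R pr(4) lim in \<open>auto simp: u_def U'_def\<close>)
  qed
  have um[measurable]: "u \<in> borel_measurable borel"
    by (rule borel_measurable_LIMSEQ_real[OF U'lim]) measurable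
  have prim: "primitive_on {0<..} u w"
  proof (rule primitive_on_limit)
    fix k
    have "AE r in lborel. W k r = W' k r" using Yae by eventually_elim (simp add: W'_def)
    from primitive_on_AE_cong[OF pr(3) this] have "primitive_on {0<..} (U k) (W' k)" .
    then show "primitive_on {0<..} (U' k) (W' k)" by (simp add: primitive_on_def U'_def)
  next
    fix x y :: real assume xy: "x \<in> {0<..}" "y \<in> {0<..}" "x \<le> y"
    let ?h = "\<lambda>r. (\<bar>r * W 0 r\<bar> + S r) / x"
    have i0: "integrable lborel (\<lambda>r. r * W 0 r)"
    proof (rule Bochner_Integration.integrable_bound)
      show "integrable lborel (\<lambda>r. r\<^sup>2 * (W 0 r)\<^sup>2 + indicat_real {0<..<R} r)" using pr(6) ind(1) by auto
      show "AE r in lborel. norm (r * W 0 r) \<le> norm (r\<^sup>2 * (W 0 r)\<^sup>2 + indicat_real {0<..<R} r)"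
      proof (rule AE_I2)
        fix r show "norm (r * W 0 r) \<le> norm (r\<^sup>2 * (W 0 r)\<^sup>2 + indicat_real {0<..<R} r)"
        proof (cases "r \<in> {0<..<R}")
          case True
          define a where "a = \<bar>r * W 0 r\<bar>"
          have a2: "a\<^sup>2 = r\<^sup>2 * (W 0 r)\<^sup>2" by (simp add: a_def power_mult_distrib)
          have "a \<le> a\<^sup>2 + 1"
            by (rule le_square_plus_one)
          then show ?thesis using True by (simp add: a2 a_def[symmetric])
        next
          case False then show ?thesis using pr(5)[OF False] by simp
        qed
      qed
    qed measurable
    have iS: "integrable lborel S"
    proof (rule integrableI_bounded)
      show "S \<in> borel_measurable lborel" unfolding S_def[abs_def] by measurable
      have "(\<integral>\<^sup>+r. ennreal (norm (S r)) \<partial>lborel) \<le> (\<integral>\<^sup>+r. Y r \<partial>lborel)"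
        by (intro nn_integral_mono) (auto simp: S_def less_top)
      then show "(\<integral>\<^sup>+r. ennreal (norm (S r)) \<partial>lborel) < \<infinity>" using Yfin by simp
    qed
    show "\<exists>h. h integrable_on {x..y} \<and> (\<forall>n. \<forall>z\<in>{x..y}. \<bar>W' n z\<bar> \<le> h z)"
    proof (intro exI[of _ ?h] conjI allI ballI)
      have "integrable lborel ?h" using i0 iS by auto
      then have "?h integrable_on UNIV" by (rule integrable_on_lborel)
      then show "?h integrable_on {x..y}" by (rule integrable_on_subinterval) simp
    next
      fix n z assume z: "z \<in> {x..y}"
      have z0: "z > 0" using z xy by auto
      have S0: "S z \<ge> 0" by (simp add: S_def)
      show "\<bar>W' n z\<bar> \<le> ?h z"
      proof (cases "Y z = \<infinity>")
        case True
        then show ?thesis using xy S0 by (simp add: W'_def)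
      next
        case False
        have "z * W n z = z * W 0 z + (\<Sum>k<n. z * (W (Suc k) z - W k z))"
          unfolding sum_distrib_left[symmetric] sum_lessThan_telescope[of "\<lambda>k. W k z"]
          by (simp add: algebra_simps)
        also have "\<bar>\<dots>\<bar> \<le> \<bar>z * W 0 z\<bar> + (\<Sum>k<n. \<Delta> k z)"
          unfolding \<Delta>_def by (rule order_trans[OF abs_triangle_ineq add_left_mono[OF sum_abs]])
        also have "(\<Sum>k<n. \<Delta> k z) \<le> S z"
          using sum_le_suminf[OF Ssum(1)[OF False], of "{..<n}"] Ssum(2)[OF False] by (simp add: \<Delta>_def)
        finally have "\<bar>z * W n z\<bar> \<le> \<bar>z * W 0 z\<bar> + S z" by simp
        moreover have "x * \<bar>W n z\<bar> \<le> \<bar>z * W n z\<bar>"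
          using z xy by (auto simp: abs_mult intro: mult_right_mono)
        ultimately have "x * \<bar>W n z\<bar> \<le> \<bar>z * W 0 z\<bar> + S z" by linarith
        then show ?thesis using xy False by (simp add: W'_def field_simps)
      qed
    qed
  qed (use U'lim W'lim in auto)
  have W'z: "W' k r = 0" if "r \<notin> {0<..<R}" for k r using pr(5)[OF that] by (simp add: W'_def)
  have wz: "w r = 0" if "r \<notin> {0<..<R}" for r
    using W'lim[of r] W'z[OF that] LIMSEQ_unique tendsto_const by (metis (no_types, lifting) ext)
  have ub: "0 \<le> u r" "u r \<le> M" for r
  proof -
    have "0 \<le> U' k r \<and> U' k r \<le> M" for k using b[of k r] M by (auto simp: U'_def)
    then show "0 \<le> u r" "u r \<le> M"
      using LIMSEQ_le_const[OF U'lim] LIMSEQ_le_const2[OF U'lim] by blast+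
  qed
  have EW: "(\<integral>\<^sup>+r. ennreal (energy_density g (U' k) (W' k) r) \<partial>on_Ioo R) = ennreal (profile_energy R g (U k) (W k))" for k
  proof -
    have "AE r in on_Ioo R. energy_density g (U' k) (W' k) r = energy_density g (U k) (W k) r"
    proof -
      have "AE r in on_Ioo R. r \<in> {0<..<R}" by (rule AE_I2) (simp add: space_restrict_space)
      moreover have "AE r in on_Ioo R. Y r \<noteq> \<infinity>"
      proof -
        have "AE r in lborel. r \<in> {0<..<R} \<longrightarrow> Y r \<noteq> \<infinity>" using Yae by eventually_elim simp
        then show ?thesis by (simp add: AE_restrict_space_iff)
      qed
      ultimately show ?thesis by eventually_elim (simp add: energy_density_def U'_def W'_def)
    qed
    then have "(\<integral>\<^sup>+r. ennreal (energy_density g (U' k) (W' k) r) \<partial>on_Ioo R) = (\<integral>\<^sup>+r. ennreal (energy_density g (U k) (W k) r) \<partial>on_Ioo R)"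
      by (intro nn_integral_cong_AE) (auto elim!: eventually_mono)
    also have "\<dots> = ennreal (profile_energy R g (U k) (W k))"
      unfolding profile_energy_def
      by (rule nn_integral_eq_integral[OF integrable_energy_density[OF g(1) p]]) (simp add: energy_density_nonneg[OF g(2)])
    finally show ?thesis .
  qed
  have gm[measurable]: "g \<in> borel_measurable borel" using g(1) by (rule borel_measurable_continuous_onI)
  have dlim: "(\<lambda>k. energy_density g (U' k) (W' k) r) \<longlonglongrightarrow> energy_density g u w r" for r
  proof -
    have "isCont g (u r)" using g(1) by (simp add: continuous_on_eq_continuous_at)
    from isCont_tendsto_compose[OF this U'lim] show ?thesis
      unfolding energy_density_def by (intro tendsto_intros U'lim W'lim)
  qed
  have dm: "energy_density g a c \<in> borel_measurable (on_Ioo R)"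
    if [measurable]: "a \<in> borel_measurable borel" "c \<in> borel_measurable borel" for a c
    unfolding energy_density_def[abs_def] by (rule borel_measurable_on_Ioo) measurable
  have fatou: "(\<integral>\<^sup>+r. ennreal (energy_density g u w r) \<partial>on_Ioo R) \<le> ennreal m"
  proof -
    have "(\<integral>\<^sup>+r. ennreal (energy_density g u w r) \<partial>on_Ioo R)
        = (\<integral>\<^sup>+r. liminf (\<lambda>k. ennreal (energy_density g (U' k) (W' k) r)) \<partial>on_Ioo R)"
      by (intro nn_integral_cong lim_imp_Liminf[symmetric] tendsto_ennrealI dlim) simp
    also have "\<dots> \<le> liminf (\<lambda>k. \<integral>\<^sup>+r. ennreal (energy_density g (U' k) (W' k) r) \<partial>on_Ioo R)"
      by (rule nn_integral_liminf) (intro measurable_compose[OF dm measurable_ennreal]; measurable)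
    also have "\<dots> = liminf (\<lambda>k. ennreal (profile_energy R g (U k) (W k)))" by (simp add: EW)
    also have "\<dots> = ennreal m" by (intro lim_imp_Liminf tendsto_ennrealI E) simp
    finally show ?thesis .
  qed
  have di: "integrable (on_Ioo R) (energy_density g u w)"
    by (rule integrableI_bounded[OF dm[OF um wm]])
       (use fatou energy_density_nonneg[OF g(2)] in \<open>simp add: le_less_trans[OF _ ennreal_less_top]\<close>)
  have "integrable (on_Ioo R) (\<lambda>r. r\<^sup>2 * (w r)\<^sup>2)"
  proof (rule Bochner_Integration.integrable_bound[OF integrable_mult_right[OF di, of 2]])
    show "(\<lambda>r. r\<^sup>2 * (w r)\<^sup>2) \<in> borel_measurable (on_Ioo R)"
      by (rule borel_measurable_on_Ioo) measurable
    show "AE r in on_Ioo R. norm (r\<^sup>2 * (w r)\<^sup>2) \<le> norm (2 * energy_density g u w r)"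
      using g(2) by (intro AE_I2) (simp add: energy_density_def)
  qed
  then have wi: "integrable lborel (\<lambda>r. r\<^sup>2 * (w r)\<^sup>2)"
    using integrable_on_Ioo_iff(1)[of R "\<lambda>r. r\<^sup>2 * (w r)\<^sup>2"] wz by simp
  have "bounded_profile R M u w"
    unfolding bounded_profile_def profile_def using um wm prim wz ub wi by (auto simp: u_def)
  moreover have "profile_energy R g u w \<le> m"
  proof -
    have "m \<ge> 0" using E profile_energy_nonneg[OF g(2)] by (intro LIMSEQ_le_const) auto
    moreover have "ennreal (profile_energy R g u w) \<le> ennreal m"
      unfolding profile_energy_def
      using nn_integral_eq_integral[OF di] energy_density_nonneg[OF g(2)] fatou by simp
    ultimately show ?thesis by (simp add: ennreal_le_iff)
  qed
  ultimately show ?thesis by (rule that)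
qed

text \<open>A minimizing sequence is thinned out twice: first for pointwise convergence of the functions, then for
  geometric convergence of the gradients.\<close>

lemma bounded_minimizer_exists:
  assumes R: "R > 0" and M: "M \<ge> 0" and g: "continuous_on UNIV g" "\<And>a. g a \<ge> 0"
    and Lnn: "L \<ge> 0"
    and L: "\<And>a b. 0 \<le> a \<Longrightarrow> a \<le> M \<Longrightarrow> 0 \<le> b \<Longrightarrow> b \<le> M \<Longrightarrow> \<bar>g a - g b\<bar> \<le> L * \<bar>a - b\<bar>"
  obtains u w where "bounded_profile R M u w"
    "\<And>u' w'. bounded_profile R M u' w' \<Longrightarrow> profile_energy R g u w \<le> profile_energy R g u' w'"
proof -
  define X where "X = {profile_energy R g u w | u w. bounded_profile R M u w}"
  define m where "m = Inf X"
  have X: "X \<noteq> {}" "bdd_below X"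
    using bounded_profile_const[OF M] profile_energy_nonneg[OF g(2)] by (auto simp: X_def intro!: bdd_belowI[of _ 0])
  have mle: "m \<le> profile_energy R g u w" if "bounded_profile R M u w" for u w
    unfolding m_def using that by (intro cInf_lower X) (auto simp: X_def)
  have m0: "m \<ge> 0" unfolding m_def using X profile_energy_nonneg[OF g(2)] by (intro cInf_greatest) (auto simp: X_def)
  have "\<exists>u w. bounded_profile R M u w \<and> profile_energy R g u w < m + 1 / real (Suc n)" for n
  proof -
    have "Inf X < m + 1 / real (Suc n)" by (simp add: m_def)
    then obtain x where "x \<in> X" "x < m + 1 / real (Suc n)" using cInf_lessD[OF X(1)] by blast
    then show ?thesis by (auto simp: X_def)
  qed
  then obtain u w where p: "\<And>n. bounded_profile R M (u n) (w n)"
    and e: "\<And>n. profile_energy R g (u n) (w n) < m + 1 / real (Suc n)" by metis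
  have C: "(\<integral>r. r\<^sup>2 * (w n r)\<^sup>2 \<partial>lborel) \<le> 2 * (m + 1)" for n
  proof -
    have "profile_energy R g (u n) (w n) < m + 1" by (rule less_le_trans[OF e]) simp
    then have "2 * profile_energy R g (u n) (w n) \<le> 2 * (m + 1)" by simp
    with weighted_square_le_energy[OF g p] show ?thesis by (rule order_trans)
  qed
  obtain k v where k: "strict_mono (k :: nat \<Rightarrow> nat)" and v': "\<forall>r\<in>{0<..<R}. (\<lambda>n. u (k n) r) \<longlonglongrightarrow> v r"
    by (rule bounded_profiles_compact[where u = u and w = w and M = M, OF p C])
  note v = v'[rule_format]
  have vb: "0 \<le> v r \<and> v r \<le> M" if "r \<in> {0<..<R}" for r
    using LIMSEQ_le_const[OF v[OF that]] LIMSEQ_le_const2[OF v[OF that]] bounded_profileD(2,3)[OF p] by blast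
  have um: "u n \<in> borel_measurable (on_Ioo R)" for n
    using profileD(1)[OF bounded_profileD(1)[OF p]] by (rule borel_measurable_on_Ioo)
  have vm: "v \<in> borel_measurable (on_Ioo R)"
    by (rule borel_measurable_LIMSEQ_real[OF _ um]) (use v in \<open>simp add: space_restrict_space\<close>)
  have d0: "(\<lambda>n. \<integral>r. \<bar>u (k n) r - v r\<bar> \<partial>on_Ioo R) \<longlonglongrightarrow> (\<integral>r. 0 \<partial>on_Ioo R)"
  proof (rule integral_dominated_convergence[where w = "\<lambda>_. M"])
    show "integrable (on_Ioo R) (\<lambda>_. M)" by (rule integrable_on_Ioo_bounded[of _ _ "\<bar>M\<bar>"]) auto
    show "(\<lambda>r. \<bar>u (k n) r - v r\<bar>) \<in> borel_measurable (on_Ioo R)" for n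
      using um vm by measurable
    show "AE r in on_Ioo R. (\<lambda>n. \<bar>u (k n) r - v r\<bar>) \<longlonglongrightarrow> 0"
    proof (rule AE_I2)
      fix r assume "r \<in> space (on_Ioo R)"
      then have "(\<lambda>n. u (k n) r) \<longlonglongrightarrow> v r" using v by (simp add: space_restrict_space)
      then show "(\<lambda>n. \<bar>u (k n) r - v r\<bar>) \<longlonglongrightarrow> 0"
        using tendsto_rabs_zero LIM_zero by blast
    qed
    show "AE r in on_Ioo R. norm \<bar>u (k n) r - v r\<bar> \<le> M" for n
    proof (rule AE_I2)
      fix r assume "r \<in> space (on_Ioo R)"
      then have "0 \<le> v r \<and> v r \<le> M" using vb by (simp add: space_restrict_space)
      then show "norm \<bar>u (k n) r - v r\<bar> \<le> M"
        using bounded_profileD(2,3)[OF p, of "k n" r] by (auto simp: abs_le_iff)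
    qed
  qed simp
  define L' where "L' = 6 * M + R\<^sup>2 * L"
  \<comment> \<open>The share of the \<open>n\<close>-th function in the bound on the distance of two gradients.\<close>
  define s where "s n = 4 * (profile_energy R g (u (k n)) (w (k n)) - m) + 4 * L' * (\<integral>r. \<bar>u (k n) r - v r\<bar> \<partial>on_Ioo R)" for n
  have E: "(\<lambda>n. profile_energy R g (u n) (w n)) \<longlonglongrightarrow> m"
  proof (rule tendsto_sandwich[of "\<lambda>_. m" _ _ "\<lambda>n. m + inverse (real (Suc n))"])
    have "(\<lambda>n. m + inverse (real (Suc n))) \<longlonglongrightarrow> m + 0"
      by (intro tendsto_intros LIMSEQ_inverse_real_of_nat)
    then show "(\<lambda>n. m + inverse (real (Suc n))) \<longlonglongrightarrow> m" by simp
    show "eventually (\<lambda>n. profile_energy R g (u n) (w n) \<le> m + inverse (real (Suc n))) sequentially"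
      using e by (intro always_eventually) (auto simp: inverse_eq_divide intro: less_imp_le)
  qed (use mle[OF p] in auto)
  have Ek: "(\<lambda>n. profile_energy R g (u (k n)) (w (k n))) \<longlonglongrightarrow> m"
    using LIMSEQ_subseq_LIMSEQ[OF E k] by (simp add: o_def)
  have "s \<longlonglongrightarrow> 4 * (m - m) + 4 * L' * (\<integral>r. 0 \<partial>on_Ioo R)"
    unfolding s_def by (intro tendsto_intros Ek d0)
  then have s0: "s \<longlonglongrightarrow> 0" by simp
  have par: "(\<integral>r. r\<^sup>2 * (w (k i) r - w (k j) r)\<^sup>2 \<partial>lborel) \<le> s i + s j" for i j
    using parallelogram_energy_bound(1)[OF g(1) Lnn L p p mle vm vb, of "k i" "k j"]
    by (simp add: s_def L'_def)
  have "\<exists>n\<ge>i. s n \<le> (1/4) ^ i / 2" for i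
  proof -
    have "eventually (\<lambda>n. s n < (1/4) ^ i / 2) sequentially"
      using s0 by (rule order_tendstoD) simp
    then obtain N where "\<And>n. n \<ge> N \<Longrightarrow> s n < (1/4) ^ i / 2" by (auto simp: eventually_sequentially)
    then show ?thesis by (intro exI[of _ "max N i"]) (auto intro: less_imp_le)
  qed
  then obtain \<sigma> where \<sigma>: "\<And>i. \<sigma> i \<ge> i" "\<And>i. s (\<sigma> i) \<le> (1/4) ^ i / 2" by metis
  have \<sigma>top: "filterlim \<sigma> sequentially sequentially"
    using \<sigma>(1) by (intro filterlim_at_top_mono[OF filterlim_ident]) auto
  have c1: "(\<integral>r. r\<^sup>2 * (w (k (\<sigma> (Suc i))) r - w (k (\<sigma> i)) r)\<^sup>2 \<partial>lborel) \<le> (1/4) ^ i" for i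
  proof -
    have "(1/4 :: real) ^ Suc i \<le> (1/4) ^ i" by simp
    then show ?thesis using par[of "\<sigma> (Suc i)" "\<sigma> i"] \<sigma>(2)[of i] \<sigma>(2)[of "Suc i"] by linarith
  qed
  show ?thesis
  proof (rule bounded_profile_of_limit[OF R g, of M "\<lambda>i. u (k (\<sigma> i))" "\<lambda>i. w (k (\<sigma> i))" v m])
    show "(\<lambda>i. u (k (\<sigma> i)) r) \<longlonglongrightarrow> v r" if "r \<in> {0<..<R}" for r
      using filterlim_compose[OF v[OF that] \<sigma>top] .
    show "(\<lambda>i. profile_energy R g (u (k (\<sigma> i))) (w (k (\<sigma> i)))) \<longlonglongrightarrow> m"
      using filterlim_compose[OF Ek \<sigma>top] .
    show "integrable lborel (\<lambda>r. r\<^sup>2 * (w (k (\<sigma> (Suc i))) r - w (k (\<sigma> i)) r)\<^sup>2)" for i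
      by (rule parallelogram_energy_bound(2)[OF g(1) Lnn L p p mle vm vb])
    show thesis if "bounded_profile R M a b" "profile_energy R g a b \<le> m" for a b
      using \<open>\<And>u w. bounded_profile R M u w \<Longrightarrow> (\<And>u' w'. bounded_profile R M u' w' \<Longrightarrow> profile_energy R g u w \<le> profile_energy R g u' w') \<Longrightarrow> thesis\<close>[OF that(1)] mle that(2) order_trans by blast
  qed (use p c1 in auto)
qed

section \<open>Smooth plateau functions\<close>

text \<open>Smoothness by coinduction: iterated derivatives need no explicit formula when they all stay in one class.\<close>

lemma all_derivs_differentiable_if_closed:
  assumes "f \<in> F" and F: "\<And>f. f \<in> F \<Longrightarrow> \<exists>f'\<in>F. \<forall>x::real. (f has_real_derivative f' x) (at x)"
  shows "(deriv ^^ n) f field_differentiable (at x)"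
proof -
  have "(deriv ^^ n) f \<in> F" for n
  proof (induction n)
    case (Suc n)
    then obtain f' where f': "f' \<in> F" "\<And>x. ((deriv ^^ n) f has_real_derivative f' x) (at x)"
      using F by blast
    have "deriv ((deriv ^^ n) f) = f'"
      using DERIV_imp_deriv[OF f'(2)] by (intro ext)
    then show ?case using f'(1) by simp
  qed (use assms in simp)
  from F[OF this[of n]] show ?thesis by (auto simp: field_differentiable_def)
qed

text \<open>The class of all these functions, for varying \<open>p\<close> and \<open>m\<close>, is closed under differentiation.\<close>

definition bump :: "real poly \<Rightarrow> nat \<Rightarrow> real \<Rightarrow> real" where
  "bump p m x = (if 0 < x \<and> x < 1 then poly p x / (x * (1 - x)) ^ m * exp (- 1 / (x * (1 - x))) else 0)"

text \<open>The exponential beats every negative power of \<open>x (1 - x)\<close>, leaving two factors to spare. This is what makes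
  the derivative vanish at the end points \<open>0\<close> and \<open>1\<close>.\<close>

lemma bump_quadratic_bound:
  obtains C where "\<And>x. \<bar>bump p m x\<bar> \<le> C * (x * (1 - x))\<^sup>2" "C \<ge> 0"
proof -
  have "bounded (poly p ` {0..1})"
    by (intro compact_imp_bounded compact_continuous_image continuous_intros) auto
  then obtain K where "\<forall>x\<in>{0..1}. \<bar>poly p x\<bar> \<le> K"
    unfolding bounded_iff by auto
  then have K: "\<bar>poly p x\<bar> \<le> K" if "x \<in> {0..1}" for x using that by blast
  have K0: "K \<ge> 0" using K[of 0] by (auto intro: order_trans[OF abs_ge_zero])
  show ?thesis
  proof (rule that[of "K * fact (m + 2)"])
    fix x :: real
    show "\<bar>bump p m x\<bar> \<le> K * fact (m + 2) * (x * (1 - x))\<^sup>2"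
    proof (cases "0 < x \<and> x < 1")
      case True
      define q where "q = x * (1 - x)"
      have q: "q > 0" using True by (auto simp: q_def)
      have "(1 / q) ^ (m + 2) /\<^sub>R fact (m + 2) \<le> (\<Sum>n. (1 / q) ^ n /\<^sub>R fact n)"
        using sum_le_suminf[OF summable_exp_generic[of "1 / q"], of "{m + 2}"] q by auto
      then have "(1 / q) ^ (m + 2) / fact (m + 2) \<le> exp (1 / q)"
        by (simp add: exp_def divide_real_def mult.commute)
      then have "exp (- 1 / q) / q ^ m \<le> F * q\<^sup>2" if "F = fact (m + 2)" "F > 0" for F
        unfolding that(1)[symmetric]
        using q that(2) by (simp add: exp_minus field_simps power_add power2_eq_square del: fact_Suc)
      then have "exp (- 1 / q) / q ^ m \<le> fact (m + 2) * q\<^sup>2" by simp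
      then have "K * (exp (- 1 / q) / q ^ m) \<le> K * (fact (m + 2) * q\<^sup>2)"
        using K0 by (rule mult_left_mono)
      moreover have "\<bar>poly p x\<bar> * (exp (- 1 / q) / q ^ m) \<le> K * (exp (- 1 / q) / q ^ m)"
        using K[of x] True q by (intro mult_right_mono) auto
      moreover have "\<bar>bump p m x\<bar> = \<bar>poly p x\<bar> * (exp (- 1 / q) / q ^ m)"
        using True q by (simp add: bump_def q_def abs_mult)
      ultimately show ?thesis by (simp add: q_def mult.assoc)
    qed (use K0 in \<open>auto simp: bump_def\<close>)
  qed (use K0 in auto)
qed

definition bump_deriv_poly :: "real poly \<Rightarrow> nat \<Rightarrow> real poly" where
  "bump_deriv_poly p m =
     pderiv p * [:0, 1, -1:]\<^sup>2 - of_nat m * p * [:1, -2:] * [:0, 1, -1:] + p * [:1, -2:]"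

lemma has_derivative_bump:
  "(bump p m has_real_derivative bump (bump_deriv_poly p m) (m + 2) x) (at x)"
proof -
  consider "0 < x \<and> x < 1" | "x < 0 \<or> x > 1" | "x = 0 \<or> x = 1" by linarith
  then show ?thesis
  proof cases
    case 1
    define q where "q = x * (1 - x)"
    have q: "q > 0" using 1 by (auto simp: q_def)
    have "((\<lambda>x. x * (1 - x)) has_real_derivative (1 - 2 * x)) (at x)"
      by (auto intro!: derivative_eq_intros)
    from DERIV_inverse_fun[OF this]
    have di: "((\<lambda>x. inverse (x * (1 - x))) has_real_derivative - ((1 - 2 * x) * inverse q ^ 2)) (at x)"
      using q by (simp add: q_def[symmetric] power2_eq_square mult_ac)
    have d: "((\<lambda>x. poly p x * (inverse (x * (1 - x))) ^ m * exp (- inverse (x * (1 - x)))) has_real_derivative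
       (poly (pderiv p) x * inverse q ^ m * exp (- inverse q)
         - poly p x * (of_nat m * inverse q ^ (m - 1) * ((1 - 2 * x) * inverse q ^ 2)) * exp (- inverse q)
         + poly p x * inverse q ^ m * (exp (- inverse q) * ((1 - 2 * x) * inverse q ^ 2)))) (at x)"
      using DERIV_mult[OF DERIV_mult[OF poly_DERIV[of p x] DERIV_power[OF di, of m]]
          DERIV_chain2[OF DERIV_exp DERIV_minus[OF di]]]
      unfolding q_def[symmetric]
      by (rule DERIV_cong) (simp add: algebra_simps)
    have *: "of_nat m * inverse q ^ (m - 1) = of_nat m * inverse q ^ m * q"
      using q by (cases m) auto
    have e: "(poly (pderiv p) x * inverse q ^ m * exp (- inverse q)
         - poly p x * (of_nat m * inverse q ^ (m - 1) * ((1 - 2 * x) * inverse q ^ 2)) * exp (- inverse q)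
         + poly p x * inverse q ^ m * (exp (- inverse q) * ((1 - 2 * x) * inverse q ^ 2)))
       = (poly (pderiv p) x * q ^ 2 - of_nat m * poly p x * (1 - 2 * x) * q + poly p x * (1 - 2 * x))
           / q ^ (m + 2) * exp (- 1 / q)"
      (is "?l = ?N / _ * _")
    proof -
      define A where "A = inverse q ^ m"
      define X where "X = exp (- inverse q)"
      have "?N / q ^ (m + 2) * exp (- 1 / q) = ?N * A * inverse q ^ 2 * X"
        by (simp add: A_def X_def divide_inverse power_add power_inverse power2_eq_square)
      moreover have "?l = ?N * A * inverse q ^ 2 * X"
        unfolding * A_def[symmetric] X_def[symmetric] mult.assoc[symmetric]
        using q by (simp add: field_simps power2_eq_square)
      ultimately show ?thesis by simp
    qed
    have "bump (bump_deriv_poly p m) (m + 2) x =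
      (poly (pderiv p) x * q ^ 2 - of_nat m * poly p x * (1 - 2 * x) * q + poly p x * (1 - 2 * x))
           / q ^ (m + 2) * exp (- 1 / q)"
      using 1 by (simp add: bump_def bump_deriv_poly_def q_def poly_of_nat algebra_simps)
    with d e have "((\<lambda>x. poly p x * (inverse (x * (1 - x))) ^ m * exp (- inverse (x * (1 - x)))) has_real_derivative
       bump (bump_deriv_poly p m) (m + 2) x) (at x)" by simp
    then show ?thesis
      by (rule has_field_derivative_transform_within_open[where S = "{0<..<1}"])
         (use 1 in \<open>auto simp: bump_def divide_inverse power_inverse simp del: inverse_mult_distrib\<close>)
  next
    case 2
    have "(bump p m has_real_derivative 0) (at x)"
      by (rule has_field_derivative_transform_within_open[OF DERIV_const[of 0], where S = "- {0..1}"])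
         (use 2 in \<open>auto simp: bump_def\<close>)
    then show ?thesis using 2 by (auto simp: bump_def)
  next
    case 3
    obtain C where C: "\<And>x. \<bar>bump p m x\<bar> \<le> C * (x * (1 - x))\<^sup>2" "C \<ge> 0"
      using bump_quadratic_bound by blast
    have "(bump p m has_real_derivative 0) (at x)"
    proof (rule DERIV_zero_if_quadratic_bound)
      fix y
      show "\<bar>bump p m y - bump p m x\<bar> \<le> C * (y - x)\<^sup>2"
      proof (cases "0 < y \<and> y < 1")
        case True
        have "(y * (1 - y)) \<le> \<bar>y - x\<bar>"
          using True 3 by (auto simp: mult_left_le mult_le_cancel_right1)
        then have "(y * (1 - y))\<^sup>2 \<le> (y - x)\<^sup>2"
          using True abs_le_square_iff[of "y * (1 - y)" "y - x"] by simp
        then have "C * (y * (1 - y))\<^sup>2 \<le> C * (y - x)\<^sup>2" using C(2) by (rule mult_left_mono)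
        then show ?thesis using C(1)[of y] 3 by (auto simp: bump_def)
      qed (use 3 C in \<open>auto simp: bump_def\<close>)
    qed
    then show ?thesis using 3 by (auto simp: bump_def)
  qed
qed

text \<open>The lower limit lies strictly below the support of the bump, so that the fundamental theorem applies at \<open>0\<close>.\<close>

definition smooth_step :: "real \<Rightarrow> real" where
  "smooth_step x = integral {-1..x} (bump 1 0)"

lemma continuous_on_bump: "continuous_on S (bump p m)"
  by (rule DERIV_continuous_on[of _ _ "bump (bump_deriv_poly p m) (m + 2)"])
     (rule has_field_derivative_at_within[OF has_derivative_bump])

lemma smooth_step_eq_0: "x \<le> 0 \<Longrightarrow> smooth_step x = 0"
  unfolding smooth_step_def
  by (rule integral_unique[OF has_integral_is_0]) (auto simp: bump_def)

lemma smooth_step_eq_1: "x \<ge> 1 \<Longrightarrow> smooth_step x = smooth_step 1"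
proof -
  assume x: "x \<ge> 1"
  have "integral {1..x} (bump 1 0) = 0"
    by (rule integral_unique[OF has_integral_is_0]) (auto simp: bump_def)
  moreover have "integral {-1..1} (bump 1 0) + integral {1..x} (bump 1 0) = integral {-1..x} (bump 1 0)"
    using x by (intro Henstock_Kurzweil_Integration.integral_combine integrable_continuous_real continuous_on_bump) auto
  ultimately show ?thesis by (simp add: smooth_step_def)
qed

lemma has_derivative_smooth_step: "(smooth_step has_real_derivative bump 1 0 x) (at x)"
proof (cases "x < 0")
  case True
  have "(smooth_step has_real_derivative 0) (at x)"
    by (rule has_field_derivative_transform_within_open[OF DERIV_const[of 0], where S = "{..<0}"])
       (use True in \<open>auto simp: smooth_step_eq_0\<close>)
  then show ?thesis using True by (simp add: bump_def)
next
  case False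
  have "((\<lambda>u. integral {-1..u} (bump 1 0)) has_real_derivative bump 1 0 x) (at x within {-1..x+1})"
    by (rule integral_has_real_derivative[OF continuous_on_bump]) (use False in auto)
  moreover have "at x within {-1..x+1} = at x"
    using False by (intro at_within_interior) auto
  ultimately show ?thesis by (simp add: smooth_step_def[abs_def])
qed

text \<open>A class that contains the plateau functions below and is closed under differentiation.\<close>

definition bump_combinations :: "real \<Rightarrow> real \<Rightarrow> real \<Rightarrow> (real \<Rightarrow> real) set" where
  "bump_combinations e a b =
     {\<lambda>x. c * (f ((x - a) / e) - f ((x - b) / e)) | c f. f = smooth_step \<or> (\<exists>p m. f = bump p m)}"

text \<open>The derivative of the plateau is one bump near \<open>a\<close> minus the same bump near \<open>b\<close>; testing against it
  compares local averages at the two points.\<close>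

lemma plateau_test_function:
  fixes a b e :: real
  assumes "e > 0" "a \<le> b" "{a..b + e} \<subseteq> S"
  defines "\<phi> \<equiv> \<lambda>x. smooth_step ((x - a) / e) - smooth_step ((x - b) / e)"
  shows "test_function S \<phi>"
    and "\<And>x. (\<phi> has_real_derivative (bump 1 0 ((x - a) / e) - bump 1 0 ((x - b) / e)) / e) (at x)"
    and "\<And>x. x \<notin> {a..b + e} \<Longrightarrow> \<phi> x = 0"
proof -
  have D: "((\<lambda>x. c * (f ((x - a) / e) - f ((x - b) / e))) has_real_derivative
      (c / e) * (f' ((x - a) / e) - f' ((x - b) / e))) (at x)"
    if "\<And>x. (f has_real_derivative f' x) (at x)" for c f f' x
  proof -
    have "((\<lambda>x. (x - z) / e) has_real_derivative 1 / e) (at x)" for z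
      using assms(1) by (auto intro!: derivative_eq_intros)
    note l = DERIV_chain2[OF that this]
    show ?thesis
      by (rule DERIV_cong[OF DERIV_cmult[OF DERIV_diff[OF l l]]]) (simp add: algebra_simps)
  qed
  have \<phi>: "\<phi> = (\<lambda>x. 1 * (smooth_step ((x - a) / e) - smooth_step ((x - b) / e)))"
    by (simp add: \<phi>_def)
  have sm: "(deriv ^^ n) \<phi> field_differentiable (at x)" for n x
  proof (rule all_derivs_differentiable_if_closed[where F = "bump_combinations e a b"])
    show "\<phi> \<in> bump_combinations e a b"
      unfolding bump_combinations_def \<phi> by blast
    fix g assume "g \<in> bump_combinations e a b"
    then obtain c f where g: "g = (\<lambda>x. c * (f ((x - a) / e) - f ((x - b) / e)))"
      and "f = smooth_step \<or> (\<exists>p m. f = bump p m)" by (auto simp: bump_combinations_def)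
    then obtain q k where f: "\<And>x. (f has_real_derivative bump q k x) (at x)"
      using has_derivative_smooth_step has_derivative_bump by blast
    show "\<exists>f'\<in>bump_combinations e a b. \<forall>x. (g has_real_derivative f' x) (at x)"
    proof (intro bexI allI)
      show "(g has_real_derivative (\<lambda>x. (c / e) * (bump q k ((x - a) / e) - bump q k ((x - b) / e))) x) (at x)" for x
        unfolding g by (rule D[OF f])
      show "(\<lambda>x. (c / e) * (bump q k ((x - a) / e) - bump q k ((x - b) / e))) \<in> bump_combinations e a b"
        unfolding bump_combinations_def by blast
    qed
  qed
  show z: "\<phi> x = 0" if "x \<notin> {a..b + e}" for x
  proof (cases "x < a")
    case True
    then show ?thesis using assms by (simp add: \<phi>_def smooth_step_eq_0 divide_le_0_iff)
  next
    case False
    then have "(x - a) / e \<ge> 1" "(x - b) / e \<ge> 1" using that assms by (auto simp: field_simps)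
    from this[THEN smooth_step_eq_1] show ?thesis by (simp add: \<phi>_def)
  qed
  have sub: "closure {x. \<phi> x \<noteq> 0} \<subseteq> {a..b + e}"
    by (rule closure_minimal) (use z in blast, simp)
  then have "compact (closure {x. \<phi> x \<noteq> 0})"
    by (metis bounded_closed_interval bounded_subset closed_closure compact_eq_bounded_closed)
  then show "test_function S \<phi>"
    unfolding test_function_def using sm sub assms(3) by blast
  show "(\<phi> has_real_derivative (bump 1 0 ((x - a) / e) - bump 1 0 ((x - b) / e)) / e) (at x)" for x
    using D[OF has_derivative_smooth_step, of 1 x] \<phi> by simp
qed

section \<open>Weak derivatives as integral primitives\<close>

lemma compact_subset_Ioo:
  fixes K :: "real set"
  assumes "compact K" "K \<subseteq> {0<..<R}" "R > 0"
  obtains a b where "0 < a" "a < b" "b < R" "K \<subseteq> {a<..<b}"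
proof (cases "K = {}")
  case True
  then show ?thesis using that[of "R/3" "R/2"] assms by auto
next
  case False
  obtain l u where "l \<in> K" "u \<in> K" "\<And>x. x \<in> K \<Longrightarrow> l \<le> x" "\<And>x. x \<in> K \<Longrightarrow> x \<le> u"
    using compact_attains_inf[OF assms(1) False] compact_attains_sup[OF assms(1) False] by metis
  moreover have "0 < l" "l \<le> u" "u < R" using calculation assms by auto
  ultimately show ?thesis
    using that[of "l/2" "(u+R)/2"] assms by force
qed

lemma test_function_props:
  assumes "test_function {0<..<R} \<phi>" "R > 0"
  obtains a b where "0 < a" "a < b" "b < R"
    "\<And>x. x \<notin> {a<..<b} \<Longrightarrow> \<phi> x = 0" "\<And>x. x \<notin> {a<..<b} \<Longrightarrow> deriv \<phi> x = 0"
    "\<And>x. (\<phi> has_real_derivative deriv \<phi> x) (at x)" "\<And>S. continuous_on S (deriv \<phi>)"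
proof -
  let ?K = "closure {x. \<phi> x \<noteq> 0}"
  obtain a b where ab: "0 < a" "a < b" "b < R" "?K \<subseteq> {a<..<b}"
    using compact_subset_Ioo[of ?K R] assms by (auto simp: test_function_def)
  have fd: "((deriv ^^ n) \<phi>) field_differentiable (at x)" for n x
    using assms by (auto simp: test_function_def)
  show ?thesis
  proof (rule that[OF ab(1-3)])
    show z: "\<phi> x = 0" if "x \<notin> {a<..<b}" for x
      using ab(4) closure_subset[of "{x. \<phi> x \<noteq> 0}"] that by blast
    show "(\<phi> has_real_derivative deriv \<phi> x) (at x)" for x
      using fd[of 0 x] by (simp add: DERIV_deriv_iff_field_differentiable)
    have "(deriv \<phi> has_real_derivative deriv (deriv \<phi>) x) (at x)" for x
      using fd[of 1 x] by (simp add: DERIV_deriv_iff_field_differentiable)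
    then show "continuous_on S (deriv \<phi>)" for S
      by (rule DERIV_continuous_on[OF has_field_derivative_at_within])
    show "deriv \<phi> x = 0" if "x \<notin> {a<..<b}" for x
    proof -
      have "(\<phi> has_real_derivative 0) (at x)"
      proof (rule has_field_derivative_transform_within_open[OF DERIV_const[of 0], where S = "- ?K"])
        show "x \<in> - ?K" using that ab by auto
        show "0 = \<phi> y" if "y \<in> - ?K" for y using that closure_subset[of "{x. \<phi> x \<noteq> 0}"] by auto
      qed auto
      then show ?thesis by (rule DERIV_imp_deriv)
    qed
  qed
qed

lemma LINT_Ioo_eq_integral_Icc:
  fixes f :: "real \<Rightarrow> real"
  assumes "0 < a" "b < R" "\<And>x. x \<notin> {a<..<b} \<Longrightarrow> f x = 0" "f absolutely_integrable_on {a..b}"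
  shows "(LINT x:{0<..<R}|lebesgue. f x) = integral {a..b} f"
proof -
  have "(LINT x:{0<..<R}|lebesgue. f x) = (LINT x:{a..b}|lebesgue. f x)"
    unfolding set_lebesgue_integral_def
    by (intro Bochner_Integration.integral_cong refl) (use assms in \<open>auto simp: indicator_def\<close>)
  then show ?thesis using set_lebesgue_integral_eq_integral(2)[OF assms(4)] by simp
qed

text \<open>Integration by parts on an interval that contains the support of the test function in its interior.\<close>

lemma has_weak_deriv_if_primitive_on:
  assumes R: "R > 0" and u: "primitive_on {0<..<R} u w"
  shows "has_weak_deriv u w {0<..<R}"
  unfolding has_weak_deriv_def
proof (intro conjI allI impI)
  have I: "is_interval {0<..<R}" "open {0<..<R}" by (auto simp: is_interval_oo)
  have seg: "x \<in> {0<..<R} \<Longrightarrow> y \<in> {0<..<R} \<Longrightarrow> continuous_on {x..y} u" for x y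
    by (rule primitive_on_continuous_on_Icc[OF u _ _ I(1)])
  show "locally_integrable {0<..<R} u"
    unfolding locally_integrable_def
  proof (intro allI impI)
    fix K :: "real set" assume K: "compact K \<and> K \<subseteq> {0<..<R}"
    then obtain a b where ab: "0 < a" "a < b" "b < R" "K \<subseteq> {a<..<b}" using compact_subset_Ioo R by metis
    have "u absolutely_integrable_on {a..b}"
      using ab by (intro absolutely_integrable_continuous_real seg) auto
    then show "u absolutely_integrable_on K"
      by (rule set_integrable_subset) (use ab K in \<open>auto intro: lmeasurable_compact fmeasurableD\<close>)
  qed
  show "locally_integrable {0<..<R} w"
    unfolding locally_integrable_def
  proof (intro allI impI)
    fix K :: "real set" assume K: "compact K \<and> K \<subseteq> {0<..<R}"
    then obtain a b where ab: "0 < a" "a < b" "b < R" "K \<subseteq> {a<..<b}" using compact_subset_Ioo R by metis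
    have "w absolutely_integrable_on {a..b}"
      using ab by (intro primitive_onD(1)[OF u]) auto
    then show "w absolutely_integrable_on K"
      by (rule set_integrable_subset) (use ab K in \<open>auto intro: lmeasurable_compact fmeasurableD\<close>)
  qed
  fix \<phi> assume "test_function {0<..<R} \<phi>"
  then obtain a b where ab: "0 < a" "a < b" "b < R"
    "\<And>x. x \<notin> {a<..<b} \<Longrightarrow> \<phi> x = 0" "\<And>x. x \<notin> {a<..<b} \<Longrightarrow> deriv \<phi> x = 0"
    and d: "\<And>x. (\<phi> has_real_derivative deriv \<phi> x) (at x)" and c: "\<And>S. continuous_on S (deriv \<phi>)"
    using test_function_props R by metis
  have "primitive_on {0<..<R} \<phi> (deriv \<phi>)"
    unfolding primitive_on_def
  proof (intro ballI impI conjI)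
    fix x y :: real assume "x \<le> y"
    then show "(deriv \<phi> has_integral \<phi> y - \<phi> x) {x..y}"
      by (rule fundamental_theorem_of_calculus)
         (simp add: has_real_derivative_iff_has_vector_derivative[symmetric] has_field_derivative_at_within[OF d])
  qed (intro absolutely_integrable_continuous_real c)
  from primitive_on_mult[OF I(1) u this]
  have "((\<lambda>x. \<phi> x * w x + u x * deriv \<phi> x) has_integral (u b * \<phi> b - u a * \<phi> a)) {a..b}"
    by (rule primitive_onD(2)) (use ab in auto)
  then have "integral {a..b} (\<lambda>x. \<phi> x * w x + u x * deriv \<phi> x) = 0"
    using ab(4)[of a] ab(4)[of b] by (simp add: has_integral_iff)
  moreover have a1: "(\<lambda>x. \<phi> x * w x) absolutely_integrable_on {a..b}"
    by (intro absolutely_integrable_continuous_mult primitive_onD(1)[OF u] DERIV_continuous_on[OF has_field_derivative_at_within[OF d]])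
       (use ab in auto)
  moreover have a2: "(\<lambda>x. u x * deriv \<phi> x) absolutely_integrable_on {a..b}"
    by (intro absolutely_integrable_continuous_real continuous_intros c seg) (use ab in auto)
  ultimately have "integral {a..b} (\<lambda>x. \<phi> x * w x) + integral {a..b} (\<lambda>x. u x * deriv \<phi> x) = 0"
    by (subst (asm) Henstock_Kurzweil_Integration.integral_add) (auto intro: set_lebesgue_integral_eq_integral(1))
  moreover have "(LINT x:{0<..<R}|lebesgue. \<phi> x * w x) = integral {a..b} (\<lambda>x. \<phi> x * w x)"
    by (rule LINT_Ioo_eq_integral_Icc[OF ab(1,3) _ a1]) (use ab in auto)
  moreover have "(LINT x:{0<..<R}|lebesgue. u x * deriv \<phi> x) = integral {a..b} (\<lambda>x. u x * deriv \<phi> x)"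
    by (rule LINT_Ioo_eq_integral_Icc[OF ab(1,3) _ a2]) (use ab in auto)
  ultimately show "(LINT x:{0<..<R}|lebesgue. u x * deriv \<phi> x) = - (LINT x:{0<..<R}|lebesgue. w x * \<phi> x)"
    by (simp add: mult.commute)
qed

text \<open>If \<open>k a < k b\<close>, choose a level \<open>m\<close> between the two values. For a plateau from \<open>a\<close> to \<open>b\<close> with steep flanks and
  derivative \<open>\<phi>'\<close>, the function \<open>(m - k) \<phi>'\<close> is nonnegative and positive somewhere near \<open>a\<close>, although its
  integral vanishes.\<close>

lemma constant_if_orthogonal_to_test_derivs:
  fixes k :: "real \<Rightarrow> real"
  assumes k: "continuous_on {0<..<R} k"
    and orth: "\<And>\<phi>. test_function {0<..<R} \<phi> \<Longrightarrow> (LINT x:{0<..<R}|lebesgue. k x * deriv \<phi> x) = 0"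
    and ab: "0 < a" "a < b" "b < R"
  shows "\<not> k a < k b"
proof
  assume less: "k a < k b"
  define m where "m = (k a + k b) / 2"
  have m: "k a < m" "m < k b" using less by (auto simp: m_def)
  have o: "open (k -` {..<m} \<inter> {0<..<R})" "open (k -` {m<..} \<inter> {0<..<R})"
    using continuous_on_open_vimage[of "{0<..<R}" k] k by simp_all
  obtain e1 where e1: "e1 > 0" "cball a e1 \<subseteq> k -` {..<m} \<inter> {0<..<R}"
    using o(1)[unfolded open_contains_cball] m ab by force
  obtain e2 where e2: "e2 > 0" "cball b e2 \<subseteq> k -` {m<..} \<inter> {0<..<R}"
    using o(2)[unfolded open_contains_cball] m ab by force
  define e where "e = min e1 e2"
  have e: "e > 0" using e1 e2 by (auto simp: e_def)
  have ka: "k x < m" if "x \<in> {a..a + e}" for x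
    using e1(2) that by (auto simp: subset_eq dist_real_def e_def)
  have kb: "k x > m" "x < R" if "x \<in> {b..b + e}" for x
    using e2(2) that by (auto simp: subset_eq dist_real_def e_def)
  have beR: "b + e < R" using kb(2)[of "b + e"] e by auto
  define \<phi> where "\<phi> x = smooth_step ((x - a) / e) - smooth_step ((x - b) / e)" for x
  note pt = plateau_test_function[of e a b "{0<..<R}", folded \<phi>_def]
  have tf: "test_function {0<..<R} \<phi>" using e ab beR by (intro pt) auto
  have d: "(\<phi> has_real_derivative (bump 1 0 ((x - a) / e) - bump 1 0 ((x - b) / e)) / e) (at x)" for x
    using e ab beR by (intro pt) auto
  have d': "deriv \<phi> x = (bump 1 0 ((x - a) / e) - bump 1 0 ((x - b) / e)) / e" for x
    using DERIV_imp_deriv[OF d] .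
  obtain a' b' where ab': "0 < a'" "a' < b'" "b' < R"
    "\<And>x. x \<notin> {a'<..<b'} \<Longrightarrow> \<phi> x = 0" "\<And>x. x \<notin> {a'<..<b'} \<Longrightarrow> deriv \<phi> x = 0"
    and d2: "\<And>x. (\<phi> has_real_derivative deriv \<phi> x) (at x)" and c: "\<And>S. continuous_on S (deriv \<phi>)"
    using test_function_props[OF tf] ab by (metis less_trans)
  have kc: "continuous_on {a'..b'} k" by (rule continuous_on_subset[OF k]) (use ab' in auto)
  have "integral {a'..b'} (\<lambda>x. k x * deriv \<phi> x) = (LINT x:{0<..<R}|lebesgue. k x * deriv \<phi> x)"
    by (rule LINT_Ioo_eq_integral_Icc[symmetric])
       (use ab' in \<open>simp_all add: absolutely_integrable_continuous_real continuous_on_mult kc c\<close>)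
  then have i1: "integral {a'..b'} (\<lambda>x. k x * deriv \<phi> x) = 0" using orth[OF tf] by simp
  have "(deriv \<phi> has_integral (\<phi> b' - \<phi> a')) {a'..b'}"
    using ab'(2) by (intro fundamental_theorem_of_calculus)
      (simp_all add: has_real_derivative_iff_has_vector_derivative[symmetric] has_field_derivative_at_within[OF d2])
  then have i2: "integral {a'..b'} (\<lambda>x. m * deriv \<phi> x) = 0"
    using ab'(4)[of a'] ab'(4)[of b'] by (simp add: has_integral_iff)
  have "integral {a'..b'} (\<lambda>x. m * deriv \<phi> x - k x * deriv \<phi> x) = 0"
    using i1 i2 by (subst Henstock_Kurzweil_Integration.integral_diff) (simp_all add: integrable_continuous_real continuous_on_mult kc c)
  moreover have b0: "bump 1 0 x \<ge> 0" "bump 1 0 x = 0 \<longleftrightarrow> x \<notin> {0<..<1}" for x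
    by (auto simp: bump_def)
  have nn: "m * deriv \<phi> x - k x * deriv \<phi> x \<ge> 0" for x
  proof -
    have A: "(m - k x) * bump 1 0 ((x - a) / e) \<ge> 0"
    proof (cases "bump 1 0 ((x - a) / e) = 0")
      case False
      then have "x \<in> {a..a + e}" using e by (auto simp: b0 field_simps)
      then show ?thesis using ka b0(1) by (intro mult_nonneg_nonneg) (auto intro: less_imp_le)
    qed auto
    have B: "(k x - m) * bump 1 0 ((x - b) / e) \<ge> 0"
    proof (cases "bump 1 0 ((x - b) / e) = 0")
      case False
      then have "x \<in> {b..b + e}" using e by (auto simp: b0 field_simps)
      then show ?thesis using kb b0(1) by (intro mult_nonneg_nonneg) (auto intro: less_imp_le)
    qed auto
    have "0 \<le> ((m - k x) * bump 1 0 ((x - a) / e) + (k x - m) * bump 1 0 ((x - b) / e)) / e"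
      using A B e by simp
    then show ?thesis by (simp add: d' algebra_simps diff_divide_distrib add_divide_distrib)
  qed
  define x where "x = a + e / 2"
  have "m * deriv \<phi> x - k x * deriv \<phi> x = 0" if "x \<in> {a'..b'}"
    using calculation that nn
    by (subst (asm) integral_eq_0_iff) (use ab' in \<open>simp_all add: continuous_on_diff continuous_on_mult kc c\<close>)
  moreover have "m - k x > 0" using ka[of x] e by (auto simp: x_def)
  moreover have "bump 1 0 ((x - a) / e) > 0" using b0[of "(x - a) / e"] e by (auto simp: x_def less_le)
  moreover have "bump 1 0 ((x - b) / e) = 0"
  proof -
    have "x \<notin> {b<..<b+e}" using ka[of x] kb[of x] e by (auto simp: x_def)
    then show ?thesis using e by (auto simp: b0 field_simps)
  qed
  ultimately have "x \<notin> {a'..b'}" "deriv \<phi> x > 0" using e by (auto simp: d')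
  then show False using ab'(5)[of x] by auto
qed


text \<open>Subtracting an indefinite integral of \<open>v\<close> from the continuous representative leaves a continuous function
  with weak derivative \<open>0\<close>, which is constant.\<close>

lemma primitive_on_if_has_weak_deriv:
  assumes R: "R > 0" and wd: "has_weak_deriv h v {0<..<R}"
    and hc: "continuous_on {0<..<R} hc" and ae: "eq_ae_on {0<..<R} h hc"
  shows "primitive_on {0<..<R} hc v"
proof -
  define c where "c = R / 2"
  have c: "0 < c" "c < R" using R by (auto simp: c_def)
  have I: "is_interval {0<..<R}" "open {0<..<R}" by (auto simp: is_interval_oo)
  have vi: "v absolutely_integrable_on {x..y}" if "0 < x" "y < R" for x y
  proof -
    have "compact {x..y} \<and> {x..y} \<subseteq> {0<..<R}" using that by auto
    then show ?thesis using wd unfolding has_weak_deriv_def locally_integrable_def by blast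
  qed
  have hi: "h absolutely_integrable_on {x..y}" if "0 < x" "y < R" for x y
  proof -
    have "compact {x..y} \<and> {x..y} \<subseteq> {0<..<R}" using that by auto
    then show ?thesis using wd unfolding has_weak_deriv_def locally_integrable_def by blast
  qed
  note vi' = set_lebesgue_integral_eq_integral(1)[OF vi]
  define u where "u x = (if x \<ge> c then integral {c..x} v else - integral {x..c} v)" for x
  have u: "primitive_on {0<..<R} u v"
    unfolding primitive_on_def
  proof (intro ballI impI conjI)
    fix x y assume xy: "x \<in> {0<..<R}" "y \<in> {0<..<R}" "x \<le> y"
    show "v absolutely_integrable_on {x..y}" using vi xy by auto
    have "integral {p..q} v + integral {q..r} v = integral {p..r} v" if "0 < p" "p \<le> q" "q \<le> r" "r < R" for p q r
      using that by (intro Henstock_Kurzweil_Integration.integral_combine vi')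
    from this[of x y c] this[of x c y] this[of c x y]
    have "u y - u x = integral {x..y} v"
      using xy c by (cases "x \<ge> c"; cases "y \<ge> c") (auto simp: u_def)
    then show "(v has_integral (u y - u x)) {x..y}"
      using vi'[of x y] xy by (simp add: has_integral_iff)
  qed
  note cu = primitive_on_continuous_on[OF u I]
  define k where "k x = hc x - u x" for x
  have k: "continuous_on {0<..<R} k"
    unfolding k_def using hc cu by (rule continuous_on_diff)
  obtain N where N: "negligible N" "{x. \<not> (x \<in> {0<..<R} \<longrightarrow> h x = hc x)} \<subseteq> N"
    using ae unfolding eq_ae_on_def by (auto simp: AE_restrict_space_iff eventually_ae_filter_negligible)
  have orth: "(LINT x:{0<..<R}|lebesgue. k x * deriv \<phi> x) = 0" if tf: "test_function {0<..<R} \<phi>" for \<phi>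
  proof -
    obtain a b where ab: "0 < a" "a < b" "b < R"
      "\<And>x. x \<notin> {a<..<b} \<Longrightarrow> \<phi> x = 0" "\<And>x. x \<notin> {a<..<b} \<Longrightarrow> deriv \<phi> x = 0"
      and d: "\<And>x. (\<phi> has_real_derivative deriv \<phi> x) (at x)" and cd: "\<And>S. continuous_on S (deriv \<phi>)"
      using test_function_props[OF tf R] by metis
    have sub: "{a..b} \<subseteq> {0<..<R}" using ab by auto
    have ah: "(\<lambda>x. h x * deriv \<phi> x) absolutely_integrable_on {a..b}"
      using absolutely_integrable_continuous_mult[OF cd hi[OF ab(1,3)]] by (simp add: mult.commute)
    have au: "(\<lambda>x. u x * deriv \<phi> x) absolutely_integrable_on {a..b}"
      by (intro absolutely_integrable_continuous_real continuous_on_mult cd continuous_on_subset[OF cu sub])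
    have ac: "(\<lambda>x. hc x * deriv \<phi> x) absolutely_integrable_on {a..b}"
      by (intro absolutely_integrable_continuous_real continuous_on_mult cd continuous_on_subset[OF hc sub])
    have ak: "(\<lambda>x. k x * deriv \<phi> x) absolutely_integrable_on {a..b}"
      by (intro absolutely_integrable_continuous_real continuous_on_mult cd continuous_on_subset[OF k sub])
    note L = LINT_Ioo_eq_integral_Icc[OF ab(1,3)]
    have "integral {a..b} (\<lambda>x. k x * deriv \<phi> x) =
        integral {a..b} (\<lambda>x. hc x * deriv \<phi> x) - integral {a..b} (\<lambda>x. u x * deriv \<phi> x)"
      unfolding k_def left_diff_distrib
      by (intro Henstock_Kurzweil_Integration.integral_diff set_lebesgue_integral_eq_integral(1)[OF ac]
          set_lebesgue_integral_eq_integral(1)[OF au])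
    also have "integral {a..b} (\<lambda>x. hc x * deriv \<phi> x) = integral {a..b} (\<lambda>x. h x * deriv \<phi> x)"
    proof (rule integral_spike[OF N(1)])
      fix x assume "x \<in> {a..b} - N"
      then have "h x = hc x" using N(2) sub by blast
      then show "h x * deriv \<phi> x = hc x * deriv \<phi> x" by simp
    qed
    also have "\<dots> = (LINT x:{0<..<R}|lebesgue. h x * deriv \<phi> x)"
      by (rule L[symmetric, OF _ ah]) (simp add: ab)
    also have "\<dots> = - (LINT x:{0<..<R}|lebesgue. v x * \<phi> x)"
      using wd tf by (simp add: has_weak_deriv_def)
    also have "\<dots> = (LINT x:{0<..<R}|lebesgue. u x * deriv \<phi> x)"
      using has_weak_deriv_if_primitive_on[OF R u] tf by (simp add: has_weak_deriv_def)
    also have "\<dots> = integral {a..b} (\<lambda>x. u x * deriv \<phi> x)"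
      by (rule L[OF _ au]) (simp add: ab)
    finally have "integral {a..b} (\<lambda>x. k x * deriv \<phi> x) = 0" by simp
    then show ?thesis by (subst L[OF _ ak]) (simp_all add: ab)
  qed
  have kconst: "k x = k y" if "0 < x" "x < y" "y < R" for x y
  proof (rule antisym)
    show "k y \<le> k x"
      using constant_if_orthogonal_to_test_derivs[OF k orth that] by simp
    have "continuous_on {0<..<R} (\<lambda>x. - k x)" using k by (rule continuous_on_minus)
    moreover have "(LINT x:{0<..<R}|lebesgue. - k x * deriv \<phi> x) = 0" if "test_function {0<..<R} \<phi>" for \<phi>
      using orth[OF that] by (simp add: set_lebesgue_integral_def)
    ultimately have "\<not> - k x < - k y"
      using that by (rule constant_if_orthogonal_to_test_derivs)
    then show "k x \<le> k y" by simp
  qed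
  show ?thesis
    unfolding primitive_on_def
  proof (intro ballI impI conjI)
    fix x y assume xy: "x \<in> {0<..<R}" "y \<in> {0<..<R}" "x \<le> y"
    show "v absolutely_integrable_on {x..y}" using vi xy by auto
    have "k x = k y" using kconst[of x y] xy by (cases "x = y") auto
    then have "hc y - hc x = u y - u x" by (simp add: k_def)
    then show "(v has_integral (hc y - hc x)) {x..y}" using primitive_onD(2)[OF u xy] by simp
  qed
qed

text \<open>The positive and the negative part of \<open>f\<close> are densities of finite measures that agree on half-lines, hence
  everywhere.\<close>

lemma AE_eq_0_if_integral_Ioc_eq_0:
  fixes f :: "real \<Rightarrow> real"
  assumes f: "integrable lborel f" and 0: "\<And>x y. x \<le> y \<Longrightarrow> (LINT z:{x<..y}|lborel. f z) = 0"
  shows "AE x in lborel. f x = 0"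
proof -
  have fm[measurable]: "f \<in> borel_measurable borel" using f by auto
  have half: "(LINT z:{x<..}|lborel. f z) = 0" for x
  proof -
    have "((\<lambda>y. LINT z:{..y}|lborel. indicator {x<..} z * f z) \<longlongrightarrow> (LINT z|lborel. indicator {x<..} z * f z)) at_top"
      unfolding set_lebesgue_integral_def
      by (rule tendsto_integral_at_top) (use f integrable_mult_indicator[of "{x<..}" lborel f] in simp_all)
    moreover have "(LINT z:{..y}|lborel. indicator {x<..} z * f z) = 0" if "y \<ge> x" for y
    proof -
      have "(LINT z:{..y}|lborel. indicator {x<..} z * f z) = (LINT z:{x<..y}|lborel. f z)"
        unfolding set_lebesgue_integral_def
        by (intro Bochner_Integration.integral_cong) (auto simp: indicator_def)
      then show ?thesis using 0[OF that] by simp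
    qed
    then have "eventually (\<lambda>y. (LINT z:{..y}|lborel. indicator {x<..} z * f z) = 0) at_top"
      by (auto simp: eventually_at_top_linorder)
    then have "((\<lambda>y. LINT z:{..y}|lborel. indicator {x<..} z * f z) \<longlongrightarrow> 0) at_top"
      by (rule tendsto_eventually)
    ultimately have "(LINT z|lborel. indicator {x<..} z * f z) = 0"
      using tendsto_unique[OF trivial_limit_at_top_linorder] by blast
    then show ?thesis by (simp add: set_lebesgue_integral_def)
  qed
  let ?P = "density lborel (\<lambda>x. ennreal (f x))" and ?N = "density lborel (\<lambda>x. ennreal (- f x))"
  have fp: "integrable lborel (\<lambda>z. indicator {x<..} z * max 0 (f z))" "integrable lborel (\<lambda>z. indicator {x<..} z * max 0 (- f z))" for x
    using integrable_mult_indicator[of "{x<..}" lborel "\<lambda>z. max 0 (f z)"]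
      integrable_mult_indicator[of "{x<..}" lborel "\<lambda>z. max 0 (- f z)"] f by (auto intro!: integrable_max)
  have em: "emeasure ?P {x<..} = ennreal (LINT z|lborel. indicator {x<..} z * max 0 (f z))"
           "emeasure ?N {x<..} = ennreal (LINT z|lborel. indicator {x<..} z * max 0 (- f z))" for x
  proof -
    have "emeasure ?P {x<..} = (\<integral>\<^sup>+z. ennreal (indicator {x<..} z * max 0 (f z)) \<partial>lborel)"
      by (subst emeasure_density) (auto intro!: nn_integral_cong simp: indicator_def max_def ennreal_neg)
    also have "\<dots> = ennreal (LINT z|lborel. indicator {x<..} z * max 0 (f z))"
      by (rule nn_integral_eq_integral[OF fp(1)]) auto
    finally show "emeasure ?P {x<..} = ennreal (LINT z|lborel. indicator {x<..} z * max 0 (f z))" .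
    have "emeasure ?N {x<..} = (\<integral>\<^sup>+z. ennreal (indicator {x<..} z * max 0 (- f z)) \<partial>lborel)"
      by (subst emeasure_density) (auto intro!: nn_integral_cong simp: indicator_def max_def ennreal_neg)
    also have "\<dots> = ennreal (LINT z|lborel. indicator {x<..} z * max 0 (- f z))"
      by (rule nn_integral_eq_integral[OF fp(2)]) auto
    finally show "emeasure ?N {x<..} = ennreal (LINT z|lborel. indicator {x<..} z * max 0 (- f z))" .
  qed
  have "?P = ?N"
  proof (rule measure_eqI_lessThan)
    fix x
    have "(LINT z|lborel. indicator {x<..} z * max 0 (f z)) - (LINT z|lborel. indicator {x<..} z * max 0 (- f z))
       = (LINT z|lborel. indicator {x<..} z * max 0 (f z) - indicator {x<..} z * max 0 (- f z))"
      by (rule Bochner_Integration.integral_diff[OF fp, symmetric])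
    also have "\<dots> = (LINT z:{x<..}|lborel. f z)"
      unfolding set_lebesgue_integral_def by (intro Bochner_Integration.integral_cong) (auto simp: indicator_def)
    finally show "emeasure ?P {x<..} = emeasure ?N {x<..}" by (simp add: em half)
  qed (auto simp: em)
  then have "AE x in lborel. ennreal (f x) = ennreal (- f x)"
    by (intro sigma_finite_measure.density_unique[OF sigma_finite_lborel]) auto
  then show ?thesis
    by eventually_elim (metis ennreal_eq_0_iff ennreal_neg linorder_linear neg_le_0_iff_le antisym ennreal_0 nle_le)
qed

lemma primitive_on_unique_AE:
  assumes "primitive_on {0<..<R} u v" "primitive_on {0<..<R} u w"
  shows "AE x in lebesgue. x \<in> {0<..<R} \<longrightarrow> v x = w x"
proof -
  have main: "AE x in lebesgue. x \<in> {a..b} \<longrightarrow> v x = w x" if ab: "0 < a" "a \<le> b" "b < R" for a b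
  proof -
    have z: "primitive_on {0<..<R} (\<lambda>x. 0) (\<lambda>x. v x - w x)"
      using primitive_on_diff[OF assms] by simp
    have "set_integrable lebesgue {a..b} (\<lambda>x. v x - w x)"
      using ab by (intro primitive_onD(1)[OF z]) auto
    then have fi: "integrable lebesgue (\<lambda>x. indicator {a..b} x * (v x - w x))"
      by (simp add: set_integrable_def)
    then have "(\<lambda>x. indicator {a..b} x * (v x - w x)) \<in> borel_measurable (completion lborel)"
      by auto
    then obtain g where "g \<in> borel_measurable lborel"
      and ge: "AE x in lborel. indicator {a..b} x * (v x - w x) = g x"
      using completion_ex_borel_measurable_real by blast
    then have g[measurable]: "g \<in> borel_measurable borel" by simp
    have geL: "AE x in lebesgue. indicator {a..b} x * (v x - w x) = g x"
      using ge by (rule AE_completion)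
    have gL: "integrable lebesgue g"
      using fi geL by (subst integrable_cong_AE[symmetric]) (auto intro: measurable_completion)
    then have gi: "integrable lborel g"
      by (subst (asm) integrable_completion) auto
    have "AE x in lborel. g x = 0"
    proof (rule AE_eq_0_if_integral_Ioc_eq_0[OF gi])
      fix x y :: real assume xy: "x \<le> y"
      have "(LINT z:{x<..y}|lborel. g z) = (LINT z:{x<..y}|lebesgue. g z)"
        unfolding set_lebesgue_integral_def by (rule integral_completion[symmetric]) auto
      also have "\<dots> = (LINT z|lebesgue. indicator {x<..y} z * (indicator {a..b} z * (v z - w z)))"
        unfolding set_lebesgue_integral_def
      proof (rule integral_cong_AE)
        show "(\<lambda>z. indicat_real {x<..y} z *\<^sub>R g z) \<in> borel_measurable lebesgue"
          by (rule measurable_completion) measurable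
        show "(\<lambda>z. indicat_real {x<..y} z * (indicator {a..b} z * (v z - w z))) \<in> borel_measurable lebesgue"
          by (rule borel_measurable_times[OF _ borel_measurable_integrable[OF fi]]) (rule measurable_completion, simp)
        show "AE z in lebesgue. indicat_real {x<..y} z *\<^sub>R g z = indicat_real {x<..y} z * (indicator {a..b} z * (v z - w z))"
          using geL by eventually_elim simp
      qed
      also have "\<dots> = (LINT z:{max x a<..min y b} \<union> (if x < a \<and> a \<le> y then {a} else {})|lebesgue. (v z - w z))"
        unfolding set_lebesgue_integral_def
        by (intro Bochner_Integration.integral_cong refl) (use ab in \<open>auto simp: indicator_def\<close>)
      also have "\<dots> = integral ({max x a<..min y b} \<union> (if x < a \<and> a \<le> y then {a} else {})) (\<lambda>z. v z - w z)"
      proof (rule set_lebesgue_integral_eq_integral(2))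
        show "set_integrable lebesgue ({max x a<..min y b} \<union> (if x < a \<and> a \<le> y then {a} else {})) (\<lambda>z. v z - w z)"
          by (rule set_integrable_subset[OF \<open>set_integrable lebesgue {a..b} (\<lambda>x. v x - w x)\<close>]) (use ab in auto)
      qed
      also have "\<dots> = integral {max x a..min y b} (\<lambda>z. v z - w z)"
        by (rule integral_spike_set) (auto intro!: negligible_subset[OF negligible_finite[of "{a, x}"]] split: if_splits)
      also have "\<dots> = 0"
      proof (cases "max x a \<le> min y b")
        case True
        then show ?thesis using primitive_onD(3)[OF z, of "max x a" "min y b"] ab by auto
      qed auto
      finally show "(LINT z:{x<..y}|lborel. g z) = 0" .
    qed
    then have "AE x in lebesgue. g x = 0" by (rule AE_completion)
    with geL show ?thesis by eventually_elim auto
  qed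
  have "AE x in lebesgue. \<forall>n::nat. x \<in> {inverse (Suc n)..R - inverse (Suc n)} \<longrightarrow> v x = w x"
    unfolding AE_all_countable
  proof
    fix n
    show "AE x in lebesgue. x \<in> {inverse (Suc n)..R - inverse (Suc n)} \<longrightarrow> v x = w x"
    proof (cases "inverse (Suc n) \<le> R - inverse (Suc n)")
      case True then show ?thesis by (intro main) auto
    qed auto
  qed
  then show ?thesis
  proof eventually_elim
    case (elim x)
    show ?case
    proof
      assume "x \<in> {0<..<R}"
      then obtain n where "inverse (Suc n) < min x (R - x)" using reals_Archimedean[of "min x (R - x)"] by auto
      then have "x \<in> {inverse (Suc n)..R - inverse (Suc n)}" by auto
      then show "v x = w x" using elim by blast
    qed
  qed
qed

section \<open>Admissible functions as profiles\<close>

lemma AE_lebesgue_on_Ioo_iff: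
  "(AE r in lebesgue_on {0<..<R::real}. P r) \<longleftrightarrow> (AE r in lebesgue. r \<in> {0<..<R} \<longrightarrow> P r)"
  by (simp add: AE_restrict_space_iff)

lemma AE_on_Ioo_iff:
  "(AE r in on_Ioo R. P r) \<longleftrightarrow> (AE r in lborel. r \<in> {0<..<R} \<longrightarrow> P r)"
  by (simp add: AE_restrict_space_iff)

lemma nn_integral_lebesgue_on_eq_on_Ioo:
  assumes [measurable]: "f \<in> borel_measurable borel"
  shows "(\<integral>\<^sup>+r. f r \<partial>lebesgue_on {0<..<R::real}) = (\<integral>\<^sup>+r. f r \<partial>on_Ioo R)"
  by (simp add: nn_integral_restrict_space nn_integral_completion)

lemma integrable_lebesgue_on_if_on_Ioo:
  fixes f :: "real \<Rightarrow> real"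
  assumes [measurable]: "f \<in> borel_measurable borel" and "integrable (on_Ioo R) f"
  shows "integrable (lebesgue_on {0<..<R}) f"
  using assms by (simp add: integrable_restrict_space integrable_completion)

text \<open>The arbitrary choice in \<open>weak_deriv\<close> is harmless: every weak derivative is a derivative of the same
  primitive.\<close>

lemma weak_deriv_AE_eq:
  assumes R: "R > 0" and wd: "has_weak_deriv h v {0<..<R}"
    and hc: "continuous_on {0<..<R} hc" and ae: "eq_ae_on {0<..<R} h hc"
    and w: "primitive_on {0<..<R} hc w"
  shows "AE r in lebesgue. r \<in> {0<..<R} \<longrightarrow> weak_deriv h {0<..<R} r = w r"
proof -
  have "has_weak_deriv h (weak_deriv h {0<..<R}) {0<..<R}"
    unfolding weak_deriv_def by (rule someI[of "\<lambda>v. has_weak_deriv h v {0<..<R}", OF wd])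
  from primitive_on_if_has_weak_deriv[OF R this hc ae] w show ?thesis by (rule primitive_on_unique_AE)
qed

lemma energy_eq_nn_integral_density:
  assumes t: "t < 0" and u: "u \<in> borel_measurable borel" "w \<in> borel_measurable borel"
    and hu: "AE r in lebesgue. r \<in> {0<..<R} \<longrightarrow> h r = u r"
    and hw: "AE r in lebesgue. r \<in> {0<..<R} \<longrightarrow> weak_deriv h {0<..<R} r = w r"
    and gm: "bulk t \<in> borel_measurable borel"
  shows "energy R t h = (\<integral>\<^sup>+r. ennreal (energy_density (bulk t) u w r) \<partial>on_Ioo R)"
proof -
  note [measurable] = u gm
  have "energy R t h = (\<integral>\<^sup>+r. ennreal (energy_density (bulk t) u w r) \<partial>lebesgue_on {0<..<R})"
    unfolding energy_def
  proof (rule nn_integral_cong_AE, unfold AE_lebesgue_on_Ioo_iff)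
    show "AE r in lebesgue. r \<in> {0<..<R} \<longrightarrow>
       ennreal (r\<^sup>2 * (1 / 2 * \<bar>weak_deriv h {0<..<R} r\<bar>\<^sup>2 + 3 * \<bar>h r\<bar>\<^sup>2 / r\<^sup>2 + bulk t (h r))) =
       ennreal (energy_density (bulk t) u w r)"
      using hu hw
    proof eventually_elim
      case (elim r)
      show ?case
      proof
        assume r: "r \<in> {0<..<R}"
        have "r\<^sup>2 * (1 / 2 * (w r)\<^sup>2 + 3 * (u r)\<^sup>2 / r\<^sup>2 + bulk t (u r)) = energy_density (bulk t) u w r"
          using r by (simp add: energy_density_def field_simps)
        then show "ennreal (r\<^sup>2 * (1 / 2 * \<bar>weak_deriv h {0<..<R} r\<bar>\<^sup>2 + 3 * \<bar>h r\<bar>\<^sup>2 / r\<^sup>2 + bulk t (h r))) =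
           ennreal (energy_density (bulk t) u w r)"
          using elim r by simp
      qed
    qed
  qed
  also have "\<dots> = (\<integral>\<^sup>+r. ennreal (energy_density (bulk t) u w r) \<partial>on_Ioo R)"
    by (rule nn_integral_lebesgue_on_eq_on_Ioo) (unfold energy_density_def, measurable)
  finally show ?thesis .
qed

lemma continuous_on_bulk: "continuous_on S (bulk t)"
  unfolding bulk_def[abs_def] bulk_poly_def by (intro continuous_intros)

lemma bounded_profile_admissible:
  assumes R: "R > 0" and t: "t < 0" and p: "bounded_profile R (h_plus t) u w"
  shows "u \<in> admissible R t"
    and "energy R t u = ennreal (profile_energy R (bulk t) u w)"
proof -
  note u = profileD[OF bounded_profileD(1)[OF p]] and b = bounded_profileD(2,3)[OF p]
  note [measurable] = u(1,2)
  have gm: "bulk t \<in> borel_measurable borel" by (rule borel_measurable_continuous_onI[OF continuous_on_bulk])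
  have prim: "primitive_on {0<..<R} u w"
    using u(3) by (auto simp: primitive_on_def)
  have wd: "has_weak_deriv u w {0<..<R}" by (rule has_weak_deriv_if_primitive_on[OF R prim])
  have cont: "continuous_on {0<..} u"
    by (rule primitive_on_continuous_on[OF u(3) is_interval_positive]) simp
  have cont': "continuous_on {0<..<R} u" by (rule continuous_on_subset[OF cont]) auto
  have i1: "integrable (on_Ioo R) (\<lambda>r. (u r)\<^sup>2)"
    by (rule integrable_on_Ioo_bounded[where B = "(h_plus t)\<^sup>2"]) (use b in \<open>auto intro: power_mono\<close>)
  have i2: "integrable (on_Ioo R) (\<lambda>r. r\<^sup>2 * (w r)\<^sup>2)" by (rule integrable_on_IooI[OF u(6)])
  show "u \<in> admissible R t"
    unfolding admissible_def
  proof (intro CollectI conjI exI)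
    show "u \<in> borel_measurable (lebesgue_on {0<..<R})"
      by (intro measurable_restrict_space1 measurable_completion) simp
    show "integrable (lebesgue_on {0<..<R}) (\<lambda>r. (u r)\<^sup>2)"
      by (rule integrable_lebesgue_on_if_on_Ioo[OF _ i1]) measurable
    show "has_weak_deriv u w {0<..<R}" by fact
    show "integrable (lebesgue_on {0<..<R}) (\<lambda>r. r\<^sup>2 * (w r)\<^sup>2)"
      by (rule integrable_lebesgue_on_if_on_Ioo[OF _ i2]) measurable
    show "continuous_on {0<..R} u" by (rule continuous_on_subset[OF cont]) auto
    show "eq_ae_on {0<..<R} u u" by (simp add: eq_ae_on_def)
    show "u R = h_plus t" using u(4) by simp
  qed
  have "energy R t u = (\<integral>\<^sup>+r. ennreal (energy_density (bulk t) u w r) \<partial>on_Ioo R)"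
    by (rule energy_eq_nn_integral_density[OF t u(1,2) _ weak_deriv_AE_eq[OF R wd cont' _ prim] gm])
       (simp_all add: eq_ae_on_def)
  also have "\<dots> = ennreal (profile_energy R (bulk t) u w)"
    unfolding profile_energy_def
    by (rule nn_integral_eq_integral[OF integrable_energy_density[OF continuous_on_bulk p]])
       (simp add: energy_density_nonneg bulk_nonneg[OF t])
  finally show "energy R t u = ennreal (profile_energy R (bulk t) u w)" .
qed

text \<open>Exhausting \<open>{0<..<R}\<close> by compact intervals.\<close>

lemma lebesgue_measurable_if_locally_integrable:
  fixes v :: "real \<Rightarrow> real"
  assumes "locally_integrable {0<..<R} v"
  shows "(\<lambda>x. indicator {0<..<R} x * v x) \<in> borel_measurable lebesgue"
proof (rule borel_measurable_LIMSEQ_real)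
  fix n :: nat
  have "{e..R - e} \<subseteq> {0<..<R}" if "e > 0" for e using that by auto
  from this[of "inverse (Suc n)"] have "{inverse (Suc n)..R - inverse (Suc n)} \<subseteq> {0<..<R}" by simp
  then have "set_integrable lebesgue {inverse (Suc n)..R - inverse (Suc n)} v"
    using assms unfolding locally_integrable_def by blast
  then show "(\<lambda>x. indicat_real {inverse (Suc n)..R - inverse (Suc n)} x * v x) \<in> borel_measurable lebesgue"
    by (auto simp: set_integrable_def dest: borel_measurable_integrable)
next
  fix x :: real
  show "(\<lambda>n. indicat_real {inverse (Suc n)..R - inverse (Suc n)} x * v x) \<longlonglongrightarrow> indicator {0<..<R} x * v x"
  proof (cases "x \<in> {0<..<R}")
    case True
    then obtain N where N: "inverse (Suc N) < min x (R - x)" using reals_Archimedean[of "min x (R - x)"] by auto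
    have "eventually (\<lambda>n. indicat_real {inverse (Suc n)..R - inverse (Suc n)} x * v x = indicator {0<..<R} x * v x) sequentially"
    proof (rule eventually_sequentiallyI[of N])
      fix n assume "N \<le> n"
      then have "inverse (real (Suc n)) \<le> inverse (real (Suc N))" by (intro le_imp_inverse_le) auto
      with N have "x \<in> {inverse (Suc n)..R - inverse (Suc n)}"
        unfolding atLeastAtMost_iff min_less_iff_conj by linarith
      then show "indicat_real {inverse (Suc n)..R - inverse (Suc n)} x * v x = indicator {0<..<R} x * v x"
        using True by (simp add: indicator_def)
    qed
    then show ?thesis by (rule tendsto_eventually)
  next
    case False
    then have "x \<notin> {e..R - e}" if "e > 0" for e using that by auto
    from this[of "inverse (Suc n)" for n] have "x \<notin> {inverse (Suc n)..R - inverse (Suc n)}" for n by simp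
    then have z: "indicat_real {inverse (Suc n)..R - inverse (Suc n)} x = 0" for n by (rule indicator_simps(2))
    show ?thesis unfolding z using False by simp
  qed
qed

text \<open>The continuous representative is a primitive on the open interval. It extends to the end point \<open>R\<close>
  because \<open>w\<close> is integrable there, the weight \<open>r\<^sup>2\<close> being bounded below away from \<open>0\<close>.\<close>

lemma admissible_has_profile:
  assumes R: "R > 0" and t: "t < 0" and h: "h \<in> admissible R t"
  obtains u w where "profile R (h_plus t) u w" "AE r in lebesgue. r \<in> {0<..<R} \<longrightarrow> h r = u r"
    "energy R t h = (\<integral>\<^sup>+r. ennreal (energy_density (bulk t) u w r) \<partial>on_Ioo R)"
proof -
  obtain v hc where wd: "has_weak_deriv h v {0<..<R}"
    and iv: "integrable (lebesgue_on {0<..<R}) (\<lambda>r. r\<^sup>2 * (v r)\<^sup>2)"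
    and hc: "continuous_on {0<..R} hc" and ae: "eq_ae_on {0<..<R} h hc" and hcR: "hc R = h_plus t"
    using h by (auto simp: admissible_def)
  have gm: "bulk t \<in> borel_measurable borel" by (rule borel_measurable_continuous_onI[OF continuous_on_bulk])
  have hc': "continuous_on {0<..<R} hc" by (rule continuous_on_subset[OF hc]) auto
  have prim_v: "primitive_on {0<..<R} hc v" by (rule primitive_on_if_has_weak_deriv[OF R wd hc' ae])
  have "(\<lambda>x. indicator {0<..<R} x * v x) \<in> borel_measurable (completion lborel)"
    using wd by (intro lebesgue_measurable_if_locally_integrable) (simp add: has_weak_deriv_def)
  then obtain f where "f \<in> borel_measurable lborel" and f: "AE x in lborel. indicator {0<..<R} x * v x = f x"
    using completion_ex_borel_measurable_real by blast
  then have fm[measurable]: "f \<in> borel_measurable borel" by simp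
  define w where "w x = indicator {0<..<R} x * f x" for x
  have wm[measurable]: "w \<in> borel_measurable borel" unfolding w_def[abs_def] by measurable
  have wz: "w x = 0" if "x \<notin> {0<..<R}" for x using that by (simp add: w_def)
  have vw: "AE x in lebesgue. x \<in> {0<..<R} \<longrightarrow> v x = w x"
    using AE_completion[OF f] by eventually_elim (auto simp: w_def)
  have "integrable lebesgue (\<lambda>r. indicator {0<..<R} r * (r\<^sup>2 * (v r)\<^sup>2))"
    using iv by (simp add: integrable_restrict_space)
  then have "integrable lebesgue (\<lambda>r. r\<^sup>2 * (w r)\<^sup>2)"
  proof (rule integrable_cong_AE_imp)
    show "(\<lambda>r. r\<^sup>2 * (w r)\<^sup>2) \<in> borel_measurable lebesgue" by (rule measurable_completion) measurable
    show "AE r in lebesgue. indicator {0<..<R} r * (r\<^sup>2 * (v r)\<^sup>2) = r\<^sup>2 * (w r)\<^sup>2"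
      using vw by eventually_elim (auto simp: indicator_def wz)
  qed
  then have wi: "integrable lborel (\<lambda>r. r\<^sup>2 * (w r)\<^sup>2)"
    by (subst (asm) integrable_completion) auto
  have ai: "w absolutely_integrable_on {x..y}" if x: "x > 0" for x y
  proof -
    have "integrable lborel (\<lambda>r. indicator {x..y} r * w r)"
    proof (rule Bochner_Integration.integrable_bound)
      show "integrable lborel (\<lambda>r. 1 / x\<^sup>2 * (r\<^sup>2 * (w r)\<^sup>2) + indicat_real {x..y} r)"
        by (intro Bochner_Integration.integrable_add integrable_mult_right wi) (simp add: integrable_indicator_iff emeasure_lborel_Icc_eq)
      show "AE r in lborel. norm (indicator {x..y} r * w r) \<le> norm (1 / x\<^sup>2 * (r\<^sup>2 * (w r)\<^sup>2) + indicat_real {x..y} r)"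
      proof (rule AE_I2)
        fix r
        show "norm (indicator {x..y} r * w r) \<le> norm (1 / x\<^sup>2 * (r\<^sup>2 * (w r)\<^sup>2) + indicat_real {x..y} r)"
        proof (cases "r \<in> {x..y}")
          case True
          define a where "a = \<bar>w r\<bar>"
          have "a \<le> a\<^sup>2 + 1"
            by (rule le_square_plus_one)
          moreover have "x\<^sup>2 * a\<^sup>2 \<le> r\<^sup>2 * a\<^sup>2"
            using True x by (intro mult_right_mono power_mono) auto
          then have "a\<^sup>2 \<le> 1 / x\<^sup>2 * (r\<^sup>2 * a\<^sup>2)" using x by (simp add: field_simps)
          ultimately have "a \<le> 1 / x\<^sup>2 * (r\<^sup>2 * a\<^sup>2) + 1" by linarith
          then show ?thesis using True by (simp add: a_def)
        qed auto
      qed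
    qed measurable
    then show ?thesis
      unfolding set_integrable_def by (subst integrable_completion) auto
  qed
  note ii = set_lebesgue_integral_eq_integral(1)[OF ai]
  have int1: "integral {x..y} w = hc y - hc x" if "0 < x" "x \<le> y" "y < R" for x y
  proof -
    obtain N where N: "negligible N" "{x. \<not> (x \<in> {0<..<R} \<longrightarrow> v x = w x)} \<subseteq> N"
      using vw by (auto simp: eventually_ae_filter_negligible)
    have "(w has_integral (hc y - hc x)) {x..y}"
    proof (rule has_integral_spike[OF N(1), where f = v])
      show "(v has_integral (hc y - hc x)) {x..y}" using primitive_onD(2)[OF prim_v] that by auto
      show "w z = v z" if z: "z \<in> {x..y} - N" for z
      proof -
        have "z \<in> {0<..<R}" "z \<notin> N" using z \<open>0 < x\<close> \<open>y < R\<close> by auto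
        then show ?thesis using N(2) by auto
      qed
    qed
    then show ?thesis by (rule integral_unique)
  qed
  have int2: "integral {x..R} w = hc R - hc x" if x: "0 < x" "x < R" for x
  proof -
    have cl: "closure {x..<R} = {x..R}" using x by simp
    have "hc R - hc x - integral {x..R} w = 0"
    proof (rule continuous_constant_on_closure[where S = "{x..<R}" and f = "\<lambda>z. hc z - hc x - integral {x..z} w"])
      show "continuous_on (closure {x..<R}) (\<lambda>z. hc z - hc x - integral {x..z} w)"
        unfolding cl
        by (intro continuous_intros indefinite_integral_continuous_1 ii x continuous_on_subset[OF hc]) (use x in auto)
      show "hc z - hc x - integral {x..z} w = 0" if "z \<in> {x..<R}" for z
        using int1[of x z] that x by auto
      show "R \<in> closure {x..<R}" unfolding cl using x by simp
    qed
    then show ?thesis by simp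
  qed
  define u where "u r = (if r \<ge> R then h_plus t else if r > 0 then hc r else 0)" for r
  have prim: "primitive_on {0<..} u w"
    unfolding primitive_on_def
  proof (intro ballI impI conjI)
    fix x y :: real assume xy: "x \<in> {0<..}" "y \<in> {0<..}" "x \<le> y"
    then have x: "x > 0" by simp
    show "w absolutely_integrable_on {x..y}" by (rule ai[OF x])
    have out: "integral {a..b} w = 0" if "R \<le> a" for a b
      using that by (intro integral_unique has_integral_is_0) (auto simp: w_def)
    have "integral {x..y} w = u y - u x"
    proof -
      consider "R \<le> x" | "x < R" "R \<le> y" | "y < R" by linarith
      then show ?thesis
      proof cases
        case 1 then show ?thesis using xy out[of x y] by (simp add: u_def)
      next
        case 2
        have "integral {x..R} w + integral {R..y} w = integral {x..y} w"
          using 2 x by (intro Henstock_Kurzweil_Integration.integral_combine ii) auto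
        then show ?thesis using int2[OF x 2(1)] out[of R y] 2 x by (simp add: u_def hcR)
      next
        case 3 then show ?thesis using int1[of x y] xy by (simp add: u_def)
      qed
    qed
    then show "(w has_integral (u y - u x)) {x..y}" using ii[OF x] by (simp add: has_integral_iff)
  qed
  have "continuous_on {0<..} u"
    by (rule primitive_on_continuous_on[OF prim is_interval_positive]) simp
  then have "(\<lambda>x. indicator {0<..} x *\<^sub>R u x) \<in> borel_measurable borel"
    by (rule borel_measurable_continuous_on_indicator[rotated]) simp
  also have "(\<lambda>x. indicator {0<..} x *\<^sub>R u x) = u"
    using R by (auto simp: u_def indicator_def fun_eq_iff)
  finally have um: "u \<in> borel_measurable borel" .
  have p: "profile R (h_plus t) u w"
    unfolding profile_def using um wm prim wz wi by (auto simp: u_def)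
  have hu: "AE r in lebesgue. r \<in> {0<..<R} \<longrightarrow> h r = u r"
    using ae unfolding eq_ae_on_def AE_lebesgue_on_Ioo_iff by eventually_elim (auto simp: u_def)
  have prim': "primitive_on {0<..<R} hc w"
    unfolding primitive_on_def using ai ii int1 by (auto simp: has_integral_iff)
  show ?thesis
    by (rule that[OF p hu energy_eq_nn_integral_density[OF t um wm hu weak_deriv_AE_eq[OF R wd hc' ae prim'] gm]])
qed


text \<open>The profile is folded to \<open>min \<bar>u\<bar> M\<close>, which raises none of the three
  terms of the density. Equality forces
  \<open>u'\<^sup>2 = u\<^sup>2\<close> and \<open>g \<bar>u\<bar> = g u\<close>; the strict inequality for negative arguments then excludes \<open>u < 0\<close>.\<close>

lemma fold_to_bounded_profile:
  assumes M: "M \<ge> 0" and p: "profile R M u w"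
    and even: "\<And>a. a < 0 \<Longrightarrow> g (- a) < g a" and gM: "\<And>a. g M \<le> g a"
  obtains u' w' where "bounded_profile R M u' w'"
    "\<And>r. energy_density g u' w' r \<le> energy_density g u w r"
    "\<And>r. r > 0 \<Longrightarrow> energy_density g u' w' r = energy_density g u w r \<Longrightarrow> u' r = u r"
proof -
  note u = profileD[OF p]
  note [measurable] = u(1,2)
  define u1 where "u1 r = max (u r) (- u r)" for r
  define w1 where "w1 r = (if u r > - u r then w r else - w r)" for r
  define u' where "u' r = min (u1 r) M" for r
  define w' where "w' r = (if u1 r > M then 0 else w1 r)" for r
  have [measurable]: "u1 \<in> borel_measurable borel" "w1 \<in> borel_measurable borel"
    unfolding u1_def[abs_def] w1_def[abs_def] by measurable
  have [measurable]: "u' \<in> borel_measurable borel" "w' \<in> borel_measurable borel"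
    unfolding u'_def[abs_def] w'_def[abs_def] by measurable
  have "primitive_on {0<..} u1 w1"
    unfolding u1_def w1_def by (intro primitive_on_max primitive_on_minus u(3) is_interval_positive)
  then have prim: "primitive_on {0<..} u' w'"
    unfolding u'_def w'_def by (intro primitive_on_min primitive_on_const is_interval_positive)
  have w'le: "(w' r)\<^sup>2 \<le> (w r)\<^sup>2" for r by (auto simp: w'_def w1_def)
  have i: "integrable lborel (\<lambda>r. r\<^sup>2 * (w' r)\<^sup>2)"
  proof (rule Bochner_Integration.integrable_bound[OF u(6)])
    show "AE r in lborel. norm (r\<^sup>2 * (w' r)\<^sup>2) \<le> norm (r\<^sup>2 * (w r)\<^sup>2)"
      using w'le by (intro AE_I2) (simp add: mult_left_mono)
  qed measurable
  have b: "bounded_profile R M u' w'"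
    unfolding bounded_profile_def profile_def
  proof (intro conjI allI impI)
    show "u' x = M" if "R \<le> x" for x using u(4)[OF that] M by (simp add: u'_def u1_def)
    show "w' x = 0" if "x \<notin> {0<..<R}" for x using u(5)[OF that] by (simp add: w'_def w1_def)
  qed (use prim i M in \<open>auto simp: u'_def u1_def\<close>)
  have u1: "u1 r = \<bar>u r\<bar>" for r by (auto simp: u1_def)
  have g1: "g (u1 r) \<le> g (u r)" for r using even[of "u r"] by (auto simp: u1 abs_if)
  have g2: "g (u' r) \<le> g (u1 r)" for r using gM by (auto simp: u'_def min_def)
  have sq: "(u' r)\<^sup>2 \<le> (u r)\<^sup>2" for r
    using M power_mono[of "u' r" "\<bar>u r\<bar>" 2] by (auto simp: u'_def u1)
  show ?thesis
  proof (rule that[OF b])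
    fix r
    have A: "r\<^sup>2 * (w' r)\<^sup>2 \<le> r\<^sup>2 * (w r)\<^sup>2" using w'le by (intro mult_left_mono) auto
    have B: "r\<^sup>2 * g (u' r) \<le> r\<^sup>2 * g (u1 r)" "r\<^sup>2 * g (u1 r) \<le> r\<^sup>2 * g (u r)"
      using g1 g2 by (auto intro: mult_left_mono)
    show "energy_density g u' w' r \<le> energy_density g u w r"
      using A B sq[of r] unfolding energy_density_def by simp
    assume r: "r > 0" and eq: "energy_density g u' w' r = energy_density g u w r"
    have squeeze: "y = y' \<and> d = e" if "x \<le> x'" "c \<le> d" "d \<le> e" "y \<le> y'"
      "1 / 2 * x + 3 * y + c = 1 / 2 * x' + 3 * y' + e" for x x' y y' c d e :: real
      using that by linarith
    have e1: "(u' r)\<^sup>2 = (u r)\<^sup>2" "r\<^sup>2 * g (u1 r) = r\<^sup>2 * g (u r)"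
      using squeeze[OF A B sq[of r] eq[unfolded energy_density_def]] by auto
    have "g (u1 r) = g (u r)" using e1(2) r by simp
    then have "u r \<ge> 0" using even[of "u r"] by (cases "u r \<ge> 0") (auto simp: u1)
    moreover have "u' r \<ge> 0" using M by (auto simp: u'_def u1)
    ultimately show "u' r = u r" using e1(1) by (simp add: power2_eq_iff_nonneg)
  qed
qed

section \<open>The bulk potential\<close>

lemma h_plus_root:
  assumes "t < 0"
  shows "h_plus t > 3 / 2" "t = 3 * h_plus t - 2 * (h_plus t)\<^sup>2"
proof -
  have s: "sqrt (9 - 8 * t) = 4 * h_plus t - 3" by (simp add: h_plus_def field_simps)
  have "sqrt (9 - 8 * t) > 3" using assms by (intro real_less_rsqrt) auto
  then show "h_plus t > 3 / 2" using s by simp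
  have "(4 * h_plus t - 3)\<^sup>2 = 9 - 8 * t"
    unfolding s[symmetric] using assms by (intro real_sqrt_pow2) auto
  then show "t = 3 * h_plus t - 2 * (h_plus t)\<^sup>2" by (simp add: power2_eq_square algebra_simps)
qed

text \<open>With \<open>m = h_plus t\<close> the derivative factors as \<open>x (x - m) (2 (x + m) - 3)\<close>, and \<open>m > 3 / 2\<close> is exactly
  where \<open>t < 0\<close> enters.\<close>

lemma bulk_strictly_decreasing:
  assumes t: "t < 0" and ab: "0 \<le> a" "a < b" "b \<le> h_plus t"
  shows "bulk t b < bulk t a"
proof (rule DERIV_neg_imp_decreasing_open[OF ab(2)])
  fix x assume x: "a < x" "x < b"
  define m where "m = h_plus t"
  have m: "m > 3 / 2" "t = 3 * m - 2 * m\<^sup>2" using h_plus_root[OF t] by (auto simp: m_def)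
  have d: "(bulk t has_real_derivative (t * x - 3 * x\<^sup>2 + 2 * x ^ 3)) (at x)"
    unfolding bulk_def[abs_def] bulk_poly_def by (auto intro!: derivative_eq_intros simp: power2_eq_square)
  have "t * x - 3 * x\<^sup>2 + 2 * x ^ 3 = x * ((x - m) * (2 * (x + m) - 3))"
    unfolding m(2) by (simp add: power2_eq_square power3_eq_cube algebra_simps)
  also have "\<dots> < 0"
    using x ab m unfolding m_def[symmetric] by (intro mult_pos_neg mult_neg_pos) auto
  finally show "\<exists>y. (bulk t has_real_derivative y) (at x) \<and> y < 0" using d by blast
qed (rule continuous_on_bulk)

lemma bulk_Lipschitz:
  assumes "0 \<le> a" "a \<le> M" "0 \<le> b" "b \<le> M"
  shows "\<bar>bulk t a - bulk t b\<bar> \<le> (\<bar>t\<bar> * M + 3 * M\<^sup>2 + 2 * M ^ 3) * \<bar>a - b\<bar>"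
proof -
  define c where "c = t / 2 * (a + b) - (a\<^sup>2 + a * b + b\<^sup>2) + 1 / 2 * ((a + b) * (a\<^sup>2 + b\<^sup>2))"
  have e: "bulk t a - bulk t b = c * (a - b)"
    by (simp add: bulk_def bulk_poly_def c_def power2_eq_square power3_eq_cube power4_eq_xxxx field_simps)
  have M: "M \<ge> 0" using assms by simp
  have sq: "a\<^sup>2 \<le> M\<^sup>2" "b\<^sup>2 \<le> M\<^sup>2" "a * b \<le> M * M" using assms by (auto intro: power_mono mult_mono)
  have s2: "a\<^sup>2 + b\<^sup>2 \<le> 2 * M\<^sup>2" using sq(1,2) by linarith
  have "\<bar>t / 2 * (a + b)\<bar> \<le> \<bar>t\<bar> / 2 * (2 * M)"
    unfolding abs_mult using assms by (intro mult_mono) auto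
  moreover have "\<bar>a\<^sup>2 + a * b + b\<^sup>2\<bar> \<le> 3 * M\<^sup>2"
    using sq assms by (simp add: power2_eq_square)
  moreover have "\<bar>(a + b) * (a\<^sup>2 + b\<^sup>2)\<bar> \<le> (2 * M) * (2 * M\<^sup>2)"
    unfolding abs_mult using assms s2 by (intro mult_mono) auto
  then have "\<bar>1 / 2 * ((a + b) * (a\<^sup>2 + b\<^sup>2))\<bar> \<le> 2 * M ^ 3"
    by (simp add: abs_mult power2_eq_square power3_eq_cube)
  ultimately have "\<bar>c\<bar> \<le> \<bar>t\<bar> * M + 3 * M\<^sup>2 + 2 * M ^ 3"
    unfolding c_def by (simp add: abs_le_iff)
  then show ?thesis unfolding e abs_mult by (intro mult_right_mono) auto
qed

section \<open>The unique minimizer\<close>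

theorem theorem4:
  fixes R t :: real
  assumes "R > 0" and "t < 0"
  shows "\<exists>h. global_minimizer R t h \<and>
    (\<forall>k. global_minimizer R t k \<longrightarrow> eq_ae_on {0<..<R} k h)"
proof -
  note R = \<open>R > 0\<close> and t = \<open>t < 0\<close>
  define M where "M = h_plus t"
  have M: "M \<ge> 0" using h_plus_root[OF t] by (simp add: M_def)
  note g = continuous_on_bulk[of UNIV t] and gnn = bulk_nonneg[OF t]
  have even: "bulk t (- a) < bulk t a" if "a < 0" for a
    using that zero_less_power[of "- a" 3] by (simp add: bulk_def bulk_poly_def)
  have gM: "bulk t M \<le> bulk t a" for a using bulk_h_plus[OF t] gnn[of a] by (simp add: M_def)
  have Lnn: "\<bar>t\<bar> * M + 3 * M\<^sup>2 + 2 * M ^ 3 \<ge> 0" using M by simp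
  obtain u w where p: "bounded_profile R M u w"
    and min: "\<And>u' w'. bounded_profile R M u' w' \<Longrightarrow> profile_energy R (bulk t) u w \<le> profile_energy R (bulk t) u' w'"
    by (rule bounded_minimizer_exists[OF R M g gnn Lnn bulk_Lipschitz]) blast+
  note adm = bounded_profile_admissible[OF R t, folded M_def]
  have dens: "(\<integral>\<^sup>+r. ennreal (energy_density (bulk t) a b r) \<partial>on_Ioo R) = ennreal (profile_energy R (bulk t) a b)"
    if "bounded_profile R M a b" for a b
    unfolding profile_energy_def
    by (rule nn_integral_eq_integral[OF integrable_energy_density[OF g that]])
       (simp add: energy_density_nonneg gnn)
  show ?thesis
  proof (intro exI conjI allI impI)
    show "global_minimizer R t u"
      unfolding global_minimizer_def
    proof (intro conjI ballI adm(1)[OF p])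
      fix k assume "k \<in> admissible R t"
      then obtain a b where ab: "profile R M a b"
        and Ek: "energy R t k = (\<integral>\<^sup>+r. ennreal (energy_density (bulk t) a b r) \<partial>on_Ioo R)"
        using admissible_has_profile[OF R t] unfolding M_def by metis
      obtain a' b' where ab': "bounded_profile R M a' b'"
        and le: "\<And>r. energy_density (bulk t) a' b' r \<le> energy_density (bulk t) a b r"
        using fold_to_bounded_profile[where g = "bulk t", OF M ab even gM] by metis
      have "energy R t u \<le> ennreal (profile_energy R (bulk t) a' b')"
        unfolding adm(2)[OF p] by (intro ennreal_leI min ab')
      also have "\<dots> \<le> energy R t k"
        unfolding dens[OF ab', symmetric] Ek by (intro nn_integral_mono ennreal_leI le)
      finally show "energy R t u \<le> energy R t k" .
    qed
  next
    fix k assume k: "global_minimizer R t k"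
    then have kadm: "k \<in> admissible R t" and kmin: "\<And>h. h \<in> admissible R t \<Longrightarrow> energy R t k \<le> energy R t h"
      by (auto simp: global_minimizer_def)
    obtain a b where ab: "profile R M a b" and ka: "AE r in lebesgue. r \<in> {0<..<R} \<longrightarrow> k r = a r"
      and Ek: "energy R t k = (\<integral>\<^sup>+r. ennreal (energy_density (bulk t) a b r) \<partial>on_Ioo R)"
      using admissible_has_profile[OF R t kadm] unfolding M_def by metis
    obtain a' b' where ab': "bounded_profile R M a' b'"
      and le: "\<And>r. energy_density (bulk t) a' b' r \<le> energy_density (bulk t) a b r"
      and eqD: "\<And>r. r > 0 \<Longrightarrow> energy_density (bulk t) a' b' r = energy_density (bulk t) a b r \<Longrightarrow> a' r = a r"
      using fold_to_bounded_profile[where g = "bulk t", OF M ab even gM] by metis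
    \<comment> \<open>Folding cannot raise the energy and \<open>k\<close> is minimal, so folding keeps the energy and hence the function.\<close>
    have "ennreal (profile_energy R (bulk t) a' b') \<le> energy R t k"
      unfolding dens[OF ab', symmetric] Ek by (intro nn_integral_mono ennreal_leI le)
    moreover have "energy R t k \<le> ennreal (profile_energy R (bulk t) a' b')"
      using kmin[OF adm(1)[OF ab']] adm(2)[OF ab'] by simp
    ultimately have Ek': "energy R t k = ennreal (profile_energy R (bulk t) a' b')" by (rule antisym[rotated])
    note i' = integrable_energy_density[OF g ab']
    note pab = profileD[OF ab]
    have gm: "bulk t \<in> borel_measurable borel" by (rule borel_measurable_continuous_onI[OF g])
    have dm: "energy_density (bulk t) a b \<in> borel_measurable (on_Ioo R)"
    proof (rule borel_measurable_on_Ioo)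
      note [measurable] = pab(1,2) gm
      show "energy_density (bulk t) a b \<in> borel_measurable borel"
        unfolding energy_density_def[abs_def] by measurable
    qed
    have i: "integrable (on_Ioo R) (energy_density (bulk t) a b)"
      by (rule integrableI_bounded[OF dm]) (simp add: energy_density_nonneg gnn Ek[symmetric] Ek')
    have "(\<integral>r. energy_density (bulk t) a b r \<partial>on_Ioo R) = profile_energy R (bulk t) a' b'"
    proof -
      have "ennreal (\<integral>r. energy_density (bulk t) a b r \<partial>on_Ioo R) = ennreal (profile_energy R (bulk t) a' b')"
        using nn_integral_eq_integral[OF i] Ek Ek' by (simp add: energy_density_nonneg gnn)
      then show ?thesis
        by (simp add: profile_energy_nonneg gnn Bochner_Integration.integral_nonneg energy_density_nonneg)
    qed
    then have "(\<integral>r. energy_density (bulk t) a b r - energy_density (bulk t) a' b' r \<partial>on_Ioo R) = 0"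
      using i i' by (simp add: profile_energy_def)
    then have "AE r in on_Ioo R. energy_density (bulk t) a b r - energy_density (bulk t) a' b' r = 0"
      using le i i' by (subst (asm) integral_nonneg_eq_0_iff_AE) auto
    then have aa': "AE r in lborel. r \<in> {0<..<R} \<longrightarrow> a r = a' r"
      unfolding AE_on_Ioo_iff by eventually_elim (use eqD in force)
    have min': "profile_energy R (bulk t) a' b' \<le> profile_energy R (bulk t) x y" if "bounded_profile R M x y" for x y
    proof -
      have "ennreal (profile_energy R (bulk t) a' b') \<le> ennreal (profile_energy R (bulk t) x y)"
        using kmin[OF adm(1)[OF that]] unfolding Ek' adm(2)[OF that] .
      then show ?thesis by (simp add: ennreal_le_iff profile_energy_nonneg gnn)
    qed
    note dec = bulk_strictly_decreasing[OF t, folded M_def]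
    have order1: "AE r in lborel. r \<in> {0<..<R} \<longrightarrow> a' r \<le> u r"
      by (rule bounded_minimizers_ordered[OF R g dec ab' p min' min])
    have order2: "AE r in lborel. r \<in> {0<..<R} \<longrightarrow> u r \<le> a' r"
      by (rule bounded_minimizers_ordered[OF R g dec p ab' min min'])
    have "AE r in lborel. r \<in> {0<..<R} \<longrightarrow> a r = u r"
      using aa' order1 order2 by eventually_elim force
    then have "AE r in lebesgue. r \<in> {0<..<R} \<longrightarrow> a r = u r" by (rule AE_completion)
    with ka have "AE r in lebesgue. r \<in> {0<..<R} \<longrightarrow> k r = u r" by eventually_elim auto
    then show "eq_ae_on {0<..<R} k u" unfolding eq_ae_on_def AE_lebesgue_on_Ioo_iff .
  qed
qed

end
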